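(* Let $k$ be a field of characteristic different from $2$, let $\mathcal{X}$ be a generic $(G,\varepsilon)$-Lie color algebra over $k$, let $x_1,\ldots,x_m$ be a homogeneous basis of $\mathcal{X}_-$, and let $t_1,\ldots,t_p$ be the associated elements of $\mathcal{X}$ with $p=\frac12 m(m+1)$. Let $\mathcal{B}=\{\mathbf{t}^\alpha:\alpha\in\mathbb{N}^p\}$ and let $\preceq$ be a $\mathcal{B}$-admissible ordering on $U(\mathcal{X})$ with $t_1\prec t_2\prec\cdots\prec t_p$. Let $K$ be a homogeneous (i.e. graded) linear subspace of $\mathcal{X}_+$ and let $I$ be the ideal of $U(\mathcal{X})$ generated by $K$. Then $I=U(\mathcal{X})K$ and $U(\mathcal{X}/K)\cong U(\mathcal{X})/I$. Moreover, if $\mathcal{G}=\{u_1,\ldots,u_n\}$ is a homogeneous basis of $K$ such that $u_1\prec u_2\prec\cdots\prec u_n$ and $\exp(u_i)\notin\mathcal{N}(u_j)$ for all $i,j$ with $1\leq i<j\leq n$, then $\mathcal{G}$ is a Gröbner basis of $I$.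
   Context: Let $G$ be an additively written abelian group and $k^\times=k\setminus\{0\}$. A map $\varepsilon:G\times G\to k^\times$ is a skew-symmetric bicharacter if for all $f,g,h\in G$: $\varepsilon(f,g+h)=\varepsilon(f,g)\varepsilon(f,h)$, $\varepsilon(g+h,f)=\varepsilon(g,f)\varepsilon(h,f)$, and $\varepsilon(g,h)\varepsilon(h,g)=1$. For nonzero homogeneous $x$, $\partial x$ denotes its degree, and $\varepsilon(x,y)$ means $\varepsilon(\partial x,\partial y)$. A $(G,\varepsilon)$-Lie color algebra is a $G$-graded vector space $\mathcal{L}$ with a graded bilinear map $\langle\,,\rangle:\mathcal{L}\times\mathcal{L}\to\mathcal{L}$ such that for all homogeneous $x,y,z$: $\langle x,y\rangle=-\varepsilon(x,y)\langle y,x\rangle$ and $\varepsilon(z,x)\langle x,\langle y,z\rangle\rangle+\varepsilon(y,z)\langle z,\langle x,y\rangle\rangle+\varepsilon(x,y)\langle y,\langle z,x\rangle\rangle=0$. Put $G_\pm=\{g\in G:\varepsilon(g,g)=\pm1\}$ and $\mathcal{L}_\pm=\bigoplus_{g\in G_\pm}\mathcal{L}_g$. The universal enveloping algebra $U(\mathcal{L})$ is the quotient of the tensor algebra of $\mathcal{L}$ by the two-sided ideal generated by all $x\otimes y-\varepsilon(x,y)\,y\otimes x-\langle x,y\rangle$ with $x,y\in\mathcal{L}$ homogeneous. A Lie color algebra $\mathcal{X}$ is generic if $m=\dim\mathcal{X}_-<\infty$, $\dim\mathcal{X}_+=\frac12m(m+1)$, $\mathcal{X}_+=\langle\mathcal{X}_-,\mathcal{X}_-\rangle$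 (the span of all brackets of elements of $\mathcal{X}_-$), and $\mathcal{X}_+$ is color central: $\langle x,y\rangle=0$ for all $x\in\mathcal{X}_+$, $y\in\mathcal{X}$. Hence any graded subspace $K\subseteq\mathcal{X}_+$ is a graded ideal and $\mathcal{X}/K$ is a Lie color algebra. Given a homogeneous basis $x_1,\ldots,x_m$ of $\mathcal{X}_-$, put $p=\frac12m(m+1)$ and $s(i,j)=\frac12j(j-1)+i$ for $1\leq i\leq j\leq m$ (a bijection onto $\{1,\ldots,p\}$). Set $t_{s(j,j)}=x_j$ for $1\le j\le m$ and $t_{s(i,j)}=\langle x_i,x_j\rangle$ for $i<j$. For $\alpha=(\alpha_1,\ldots,\alpha_p)\in\mathbb{N}^p$ ($\mathbb{N}$ includes $0$) write $\mathbf{t}^\alpha=t_1^{\alpha_1}\cdots t_p^{\alpha_p}\in U(\mathcal{X})$. The set $\mathcal{B}=\{\mathbf{t}^\alpha:\alpha\in\mathbb{N}^p\}$ is a $k$-basis of $U(\mathcal{X})$, so each $u\in U(\mathcal{X})$ is uniquely $u=\sum_\alpha c_\alpha\mathbf{t}^\alpha$ with $c_\alpha\in k$. The Newton diagram of nonzero $u$ is $\mathcal{N}(u)=\{\alpha:c_\alpha\neq0\}$, and, for a total order $\preceq$ on $\mathbb{N}^p$, the exponent of $u$ is $\exp(u)=\max_{\preceq}\mathcal{N}(u)$. A $\mathcal{B}$-admissible ordering on $U(\mathcal{X})$ is a total order $\preceq$ on $\mathbb{N}^p$ such that $0\preceq\alpha$ for all $\alpha$, $\alpha\prec\beta$ implies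 $\alpha+\gamma\prec\beta+\gamma$, and $\exp(\mathbf{t}^\alpha\mathbf{t}^\beta)=\alpha+\beta$ for all $\alpha,\beta\in\mathbb{N}^p$. For nonzero $u,v\in U(\mathcal{X})$, $u\prec v$ means $\exp(u)\prec\exp(v)$. A finite set $\mathcal{G}$ of nonzero elements of a left ideal $I$ of $U(\mathcal{X})$ is a Gröbner basis of $I$ if $\{\exp(f):0\neq f\in I\}=\bigcup_{u\in\mathcal{G}}(\exp(u)+\mathbb{N}^p)$. *)

theory Defs
  imports "Jordan_Normal_Form.VS_Connect" "HOL-Algebra.QuotRing" "HOL-Algebra.Ideal_Product"
begin

section \<open>Lie color algebras\<close>

locale skew_bicharacter =
  fixes \<epsilon> :: "'g::ab_group_add \<Rightarrow> 'g \<Rightarrow> 'k::field"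
  assumes nonzero: "\<epsilon> g h \<noteq> 0"
    and add_right: "\<epsilon> f (g + h) = \<epsilon> f g * \<epsilon> f h"
    and add_left: "\<epsilon> (g + h) f = \<epsilon> g f * \<epsilon> h f"
    and skew: "\<epsilon> g h * \<epsilon> h g = 1"

text \<open>As for every \<open>module\<close> record, the inherited ring fields \<open>mult\<close> and \<open>one\<close> carry no
  meaning; \<open>homog L g\<close> is the homogeneous component of degree \<open>g\<close>.\<close>

record ('k, 'v, 'g) color_alg = "('k, 'v) module" +
  bracket :: "'v \<Rightarrow> 'v \<Rightarrow> 'v"
  homog :: "'g \<Rightarrow> 'v set"

text \<open>The identities for homogeneous elements are stated for all members of the components,
  zero included, where they are trivial.\<close>

locale lie_color_algebra = skew_bicharacter \<epsilon>
  for \<epsilon> :: "'g::ab_group_add \<Rightarrow> 'g \<Rightarrow> 'k::field" +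
  fixes L :: "('k, 'v, 'g) color_alg" (structure)
  assumes vectorspace: "vectorspace class_ring L"
    and homog_subspace: "VectorSpace.subspace class_ring (homog L g) L"
    and homog_direct_sum: "v \<in> carrier L \<Longrightarrow>
      \<exists>!c. (\<forall>g. c g \<in> homog L g) \<and> finite {g. c g \<noteq> \<zero>} \<and> v = finsum L c {g. c g \<noteq> \<zero>}"
    and bracket_closed: "\<lbrakk>x \<in> carrier L; y \<in> carrier L\<rbrakk> \<Longrightarrow> bracket L x y \<in> carrier L"
    and bracket_add_left: "\<lbrakk>x \<in> carrier L; y \<in> carrier L; z \<in> carrier L\<rbrakk> \<Longrightarrow>
      bracket L (x \<oplus> y) z = bracket L x z \<oplus> bracket L y z"
    and bracket_add_right: "\<lbrakk>x \<in> carrier L; y \<in> carrier L; z \<in> carrier L\<rbrakk> \<Longrightarrow>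
      bracket L z (x \<oplus> y) = bracket L z x \<oplus> bracket L z y"
    and bracket_smult_left: "\<lbrakk>x \<in> carrier L; y \<in> carrier L\<rbrakk> \<Longrightarrow>
      bracket L (c \<odot> x) y = c \<odot> bracket L x y"
    and bracket_smult_right: "\<lbrakk>x \<in> carrier L; y \<in> carrier L\<rbrakk> \<Longrightarrow>
      bracket L x (c \<odot> y) = c \<odot> bracket L x y"
    and bracket_graded: "\<lbrakk>x \<in> homog L g; y \<in> homog L h\<rbrakk> \<Longrightarrow> bracket L x y \<in> homog L (g + h)"
    and color_skew: "\<lbrakk>x \<in> homog L g; y \<in> homog L h\<rbrakk> \<Longrightarrow>
      bracket L x y = \<ominus> (\<epsilon> g h \<odot> bracket L y x)"
    and color_jacobi: "\<lbrakk>x \<in> homog L f; y \<in> homog L g; z \<in> homog L h\<rbrakk> \<Longrightarrow>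
      \<epsilon> h f \<odot> bracket L x (bracket L y z) \<oplus> \<epsilon> g h \<odot> bracket L z (bracket L x y)
        \<oplus> \<epsilon> f g \<odot> bracket L y (bracket L z x) = \<zero>"

definition plus_part :: "('g \<Rightarrow> 'g \<Rightarrow> 'k::field) \<Rightarrow> ('k, 'v, 'g) color_alg \<Rightarrow> 'v set" where
  "plus_part \<epsilon> L = LinearCombinations.module.span class_ring L (\<Union>g\<in>{g. \<epsilon> g g = 1}. homog L g)"

definition minus_part :: "('g \<Rightarrow> 'g \<Rightarrow> 'k::field) \<Rightarrow> ('k, 'v, 'g) color_alg \<Rightarrow> 'v set" where
  "minus_part \<epsilon> L = LinearCombinations.module.span class_ring L (\<Union>g\<in>{g. \<epsilon> g g = -1}. homog L g)"

text \<open>A subspace \<open>W\<close> of \<open>L\<close>, viewed as a vector space, is \<open>L\<lparr>carrier := W\<rparr>\<close>.\<close>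

locale generic_lie_color_algebra = lie_color_algebra \<epsilon> L
  for \<epsilon> :: "'g::ab_group_add \<Rightarrow> 'g \<Rightarrow> 'k::field" and L :: "('k, 'v, 'g) color_alg" (structure) +
  assumes fin_dim_minus: "vectorspace.fin_dim class_ring (L\<lparr>carrier := minus_part \<epsilon> L\<rparr>)"
    and fin_dim_plus: "vectorspace.fin_dim class_ring (L\<lparr>carrier := plus_part \<epsilon> L\<rparr>)"
    and dim_plus: "m = vectorspace.dim class_ring (L\<lparr>carrier := minus_part \<epsilon> L\<rparr>) \<Longrightarrow>
      vectorspace.dim class_ring (L\<lparr>carrier := plus_part \<epsilon> L\<rparr>) = m * (m + 1) div 2"
    and plus_eq_brackets: "plus_part \<epsilon> L = LinearCombinations.module.span class_ring L
      {bracket L x y |x y. x \<in> minus_part \<epsilon> L \<and> y \<in> minus_part \<epsilon> L}"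
    and color_central: "\<lbrakk>x \<in> plus_part \<epsilon> L; y \<in> carrier L\<rbrakk> \<Longrightarrow> bracket L x y = \<zero>"

definition graded_subspace :: "('k::field, 'v, 'g) color_alg \<Rightarrow> 'v set \<Rightarrow> bool" where
  "graded_subspace L W \<longleftrightarrow> VectorSpace.subspace class_ring W L \<and>
     W = LinearCombinations.module.span class_ring L (\<Union>g. W \<inter> homog L g)"

definition homogeneous_basis ::
    "('k::field, 'v, 'g) color_alg \<Rightarrow> 'v set \<Rightarrow> nat \<Rightarrow> (nat \<Rightarrow> 'v) \<Rightarrow> bool" where
  "homogeneous_basis L W n x \<longleftrightarrow>
     inj_on x {1..n} \<and> vectorspace.basis class_ring (L\<lparr>carrier := W\<rparr>) (x ` {1..n}) \<and>
     (\<forall>i\<in>{1..n}. \<exists>g. x i \<in> homog L g)"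

text \<open>The quotient \<open>L/K\<close>; its elements are the cosets of \<open>K\<close>.\<close>

definition color_quot :: "('k, 'v, 'g) color_alg \<Rightarrow> 'v set \<Rightarrow> ('k, 'v set, 'g) color_alg" where
  "color_quot L K = \<lparr>carrier = a_rcosets\<^bsub>L\<^esub> K,
     monoid.mult = undefined, monoid.one = undefined,
     ring.zero = K, ring.add = set_add L,
     smult = (\<lambda>c A. \<Union>a\<in>A. K +>\<^bsub>L\<^esub> (c \<odot>\<^bsub>L\<^esub> a)),
     bracket = (\<lambda>A B. \<Union>a\<in>A. \<Union>b\<in>B. K +>\<^bsub>L\<^esub> bracket L a b),
     homog = (\<lambda>g. (\<lambda>a. K +>\<^bsub>L\<^esub> a) ` homog L g)\<rparr>"


section \<open>Universal enveloping algebras\<close>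

text \<open>An associative algebra over the field \<open>'k\<close> is a \<open>module\<close> record in which all fields are
  meaningful.  The locale \<open>algebra\<close> of the library is restricted to commutative algebras.\<close>

definition alg_quot :: "('k, 'a) module \<Rightarrow> 'a set \<Rightarrow> ('k, 'a set) module" where
  "alg_quot A J = \<lparr>carrier = carrier (A Quot J), monoid.mult = monoid.mult (A Quot J),
     monoid.one = monoid.one (A Quot J),
     ring.zero = ring.zero (A Quot J), ring.add = ring.add (A Quot J),
     smult = (\<lambda>c B. \<Union>b\<in>B. J +>\<^bsub>A\<^esub> (c \<odot>\<^bsub>A\<^esub> b))\<rparr>"

text \<open>The free associative algebra on a set \<open>S\<close>: finitely supported functions on the words
  with letters in \<open>S\<close>, with convolution along concatenation.\<close>

definition free_alg :: "'v set \<Rightarrow> ('k::field, 'v list \<Rightarrow> 'k) module" where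
  "free_alg S = \<lparr>carrier = {f. finite {w. f w \<noteq> 0} \<and> {w. f w \<noteq> 0} \<subseteq> lists S},
     monoid.mult = (\<lambda>f g w. \<Sum>i\<le>length w. f (take i w) * g (drop i w)),
     monoid.one = (\<lambda>w. if w = [] then 1 else 0),
     ring.zero = (\<lambda>w. 0), ring.add = (\<lambda>f g w. f w + g w),
     smult = (\<lambda>c f w. c * f w)\<rparr>"

definition letter :: "'v \<Rightarrow> 'v list \<Rightarrow> 'k::field" where
  "letter x = (\<lambda>w. if w = [x] then 1 else 0)"

text \<open>The tensor algebra of a vector space \<open>V\<close>: the free algebra on the underlying set of \<open>V\<close>,
  modulo linearity of the inclusion of \<open>V\<close>.\<close>

definition linear_relations :: "('k::field, 'v, 'c) module_scheme \<Rightarrow> ('v list \<Rightarrow> 'k) set" where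
  "linear_relations V =
     {letter (x \<oplus>\<^bsub>V\<^esub> y) \<ominus>\<^bsub>free_alg (carrier V)\<^esub> (letter x \<oplus>\<^bsub>free_alg (carrier V)\<^esub> letter y)
        |x y. x \<in> carrier V \<and> y \<in> carrier V} \<union>
     {letter (c \<odot>\<^bsub>V\<^esub> x) \<ominus>\<^bsub>free_alg (carrier V)\<^esub> (c \<odot>\<^bsub>free_alg (carrier V)\<^esub> letter x)
        |c x. x \<in> carrier V}"

definition linear_ideal :: "('k::field, 'v, 'c) module_scheme \<Rightarrow> ('v list \<Rightarrow> 'k) set" where
  "linear_ideal V = genideal (free_alg (carrier V)) (linear_relations V)"

definition tensor_alg :: "('k::field, 'v, 'c) module_scheme \<Rightarrow> ('k, ('v list \<Rightarrow> 'k) set) module" where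
  "tensor_alg V = alg_quot (free_alg (carrier V)) (linear_ideal V)"

definition tensor_incl :: "('k::field, 'v, 'c) module_scheme \<Rightarrow> 'v \<Rightarrow> ('v list \<Rightarrow> 'k) set" where
  "tensor_incl V x = linear_ideal V +>\<^bsub>free_alg (carrier V)\<^esub> letter x"

definition color_ideal ::
    "('g \<Rightarrow> 'g \<Rightarrow> 'k::field) \<Rightarrow> ('k, 'v, 'g) color_alg \<Rightarrow> ('v list \<Rightarrow> 'k) set set" where
  "color_ideal \<epsilon> L = genideal (tensor_alg L)
     {tensor_incl L x \<otimes>\<^bsub>tensor_alg L\<^esub> tensor_incl L y
        \<ominus>\<^bsub>tensor_alg L\<^esub> \<epsilon> g h \<odot>\<^bsub>tensor_alg L\<^esub> (tensor_incl L y \<otimes>\<^bsub>tensor_alg L\<^esub> tensor_incl L x)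
        \<ominus>\<^bsub>tensor_alg L\<^esub> tensor_incl L (bracket L x y)
      |x y g h. x \<in> homog L g \<and> y \<in> homog L h}"

definition env_alg ::
    "('g \<Rightarrow> 'g \<Rightarrow> 'k::field) \<Rightarrow> ('k, 'v, 'g) color_alg \<Rightarrow> ('k, ('v list \<Rightarrow> 'k) set set) module" where
  "env_alg \<epsilon> L = alg_quot (tensor_alg L) (color_ideal \<epsilon> L)"

definition env_incl ::
    "('g \<Rightarrow> 'g \<Rightarrow> 'k::field) \<Rightarrow> ('k, 'v, 'g) color_alg \<Rightarrow> 'v \<Rightarrow> ('v list \<Rightarrow> 'k) set set" where
  "env_incl \<epsilon> L x = color_ideal \<epsilon> L +>\<^bsub>tensor_alg L\<^esub> tensor_incl L x"


section \<open>Exponents and Groebner bases\<close>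

text \<open>\<open>\<nat>\<^sup>p\<close>, realised as the functions supported in \<open>{1..p}\<close>.\<close>

definition nat_pow :: "nat \<Rightarrow> (nat \<Rightarrow> nat) set" where
  "nat_pow p = {\<alpha>. \<forall>i. i \<notin> {1..p} \<longrightarrow> \<alpha> i = 0}"

definition exp_plus :: "(nat \<Rightarrow> nat) \<Rightarrow> (nat \<Rightarrow> nat) \<Rightarrow> nat \<Rightarrow> nat" where
  "exp_plus \<alpha> \<beta> = (\<lambda>i. \<alpha> i + \<beta> i)"

definition pair_index :: "nat \<Rightarrow> nat \<Rightarrow> nat" where
  "pair_index i j = j * (j - 1) div 2 + i"

text \<open>\<open>monomial A t p \<alpha>\<close> is the ordered product \<open>t\<^sub>1\<^sup>\<alpha>\<^sup>1 \<cdots> t\<^sub>p\<^sup>\<alpha>\<^sup>p\<close>.\<close>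

primrec monomial :: "('k, 'a) module \<Rightarrow> (nat \<Rightarrow> 'a) \<Rightarrow> nat \<Rightarrow> (nat \<Rightarrow> nat) \<Rightarrow> 'a" where
  "monomial A t 0 \<alpha> = \<one>\<^bsub>A\<^esub>"
| "monomial A t (Suc n) \<alpha> = monomial A t n \<alpha> \<otimes>\<^bsub>A\<^esub> (t (Suc n) [^]\<^bsub>A\<^esub> \<alpha> (Suc n))"

text \<open>\<open>coeffs\<close>, \<open>newton_diagram\<close> and \<open>exponent\<close> are meaningful if the monomials form a basis
  of \<open>A\<close> and \<open>r\<close> is a linear order on \<open>nat_pow p\<close>, where \<open>(\<alpha>, \<beta>) \<in> r\<close> means
  \<open>\<alpha> \<preceq> \<beta>\<close>.\<close>

definition coeffs ::
    "('k::field, 'a) module \<Rightarrow> (nat \<Rightarrow> 'a) \<Rightarrow> nat \<Rightarrow> 'a \<Rightarrow> (nat \<Rightarrow> nat) \<Rightarrow> 'k" where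
  "coeffs A t p u = (THE c. finite {\<alpha>. c \<alpha> \<noteq> 0} \<and> {\<alpha>. c \<alpha> \<noteq> 0} \<subseteq> nat_pow p \<and>
     u = (\<Oplus>\<^bsub>A\<^esub>\<alpha>\<in>{\<alpha>. c \<alpha> \<noteq> 0}. c \<alpha> \<odot>\<^bsub>A\<^esub> monomial A t p \<alpha>))"

definition newton_diagram ::
    "('k::field, 'a) module \<Rightarrow> (nat \<Rightarrow> 'a) \<Rightarrow> nat \<Rightarrow> 'a \<Rightarrow> (nat \<Rightarrow> nat) set" where
  "newton_diagram A t p u = {\<alpha>. coeffs A t p u \<alpha> \<noteq> 0}"

definition exponent ::
    "('k::field, 'a) module \<Rightarrow> (nat \<Rightarrow> 'a) \<Rightarrow> nat \<Rightarrow> (nat \<Rightarrow> nat) rel \<Rightarrow> 'a \<Rightarrow> nat \<Rightarrow> nat" where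
  "exponent A t p r u = (THE \<alpha>. \<alpha> \<in> newton_diagram A t p u \<and>
     (\<forall>\<beta>\<in>newton_diagram A t p u. (\<beta>, \<alpha>) \<in> r))"

definition prec :: "(nat \<Rightarrow> nat) rel \<Rightarrow> (nat \<Rightarrow> nat) \<Rightarrow> (nat \<Rightarrow> nat) \<Rightarrow> bool" where
  "prec r \<alpha> \<beta> \<longleftrightarrow> (\<alpha>, \<beta>) \<in> r \<and> \<alpha> \<noteq> \<beta>"

definition admissible_ordering ::
    "('k::field, 'a) module \<Rightarrow> (nat \<Rightarrow> 'a) \<Rightarrow> nat \<Rightarrow> (nat \<Rightarrow> nat) rel \<Rightarrow> bool" where
  "admissible_ordering A t p r \<longleftrightarrow> linear_order_on (nat_pow p) r \<and>
     (\<forall>\<alpha>\<in>nat_pow p. ((\<lambda>i. 0), \<alpha>) \<in> r) \<and>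
     (\<forall>\<alpha>\<in>nat_pow p. \<forall>\<beta>\<in>nat_pow p. \<forall>\<gamma>\<in>nat_pow p.
        prec r \<alpha> \<beta> \<longrightarrow> prec r (exp_plus \<alpha> \<gamma>) (exp_plus \<beta> \<gamma>)) \<and>
     (\<forall>\<alpha>\<in>nat_pow p. \<forall>\<beta>\<in>nat_pow p.
        exponent A t p r (monomial A t p \<alpha> \<otimes>\<^bsub>A\<^esub> monomial A t p \<beta>) = exp_plus \<alpha> \<beta>)"

definition left_ideal :: "'a set \<Rightarrow> ('k, 'a) module \<Rightarrow> bool" where
  "left_ideal I A \<longleftrightarrow> additive_subgroup I A \<and> (\<forall>a\<in>carrier A. \<forall>f\<in>I. a \<otimes>\<^bsub>A\<^esub> f \<in> I)"

definition groebner_basis ::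
    "('k::field, 'a) module \<Rightarrow> (nat \<Rightarrow> 'a) \<Rightarrow> nat \<Rightarrow> (nat \<Rightarrow> nat) rel \<Rightarrow> 'a set \<Rightarrow> 'a set \<Rightarrow> bool" where
  "groebner_basis A t p r I B \<longleftrightarrow> left_ideal I A \<and> finite B \<and> B \<subseteq> I - {\<zero>\<^bsub>A\<^esub>} \<and>
     {exponent A t p r f |f. f \<in> I \<and> f \<noteq> \<zero>\<^bsub>A\<^esub>} =
     (\<Union>u\<in>B. exp_plus (exponent A t p r u) ` nat_pow p)"

end

theory Submission
  imports Defs
begin

text \<open>The monomials \<open>t\<^sup>\<alpha>\<close> span the enveloping algebra because a swap of two generators only costs a
  scalar and a term of smaller length.  They are linearly independent because the algebra acts on
  the functions on \<open>\<nat>\<^sup>p\<close> as a color version of a generic Clifford algebra: \<open>x\<^sub>j\<close> acts as multiplication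
  by the variable plus a sum of odd derivations in the \<open>x\<^sub>i\<close>, \<open>i < j\<close>, with coefficients the
  variables for the brackets of \<open>x\<^sub>i\<close> and \<open>x\<^sub>j\<close>.

  Since \<open>K\<close> is color central, left multiples of \<open>K\<close> form a two-sided ideal.  The leading exponents
  of the \<open>u\<^sub>i\<close> are \<open>1\<close> or \<open>2\<close> times distinct unit vectors, so the products of standard monomials
  reduced with respect to them and of powers of the \<open>u\<^sub>i\<close> have every exponent as leading exponent
  exactly once; as admissible orderings are well-founded, they form a basis.  The \<open>u\<^sub>i\<close> commute up to
  scalars, so \<open>I\<close> is spanned by the members of this basis with a factor \<open>u\<^sub>i\<close>.\<close>

section \<open>Associative algebras and the universal property\<close>

text \<open>Genericity makes an explicit model possible. The dimension condition forces the brackets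
  [x_i, x_j] with i \<le> j to be independent; those with i < j become independent variables, while
  [x_j, x_j] = 2 x_j^2 is already carried by the variable of x_j. Hence odd variables keep all their
  powers and the exponents fill the whole of N^p. Derivations are attached on one side only, for i <
  j, because the color commutator of x_i and x_j has to produce its bracket exactly once. Applied to
  the constant 1, the factors of an ordered monomial act from the highest index downwards, so a
  derivation only meets polynomials free of its variable: the monomial with exponent \<alpha>
  produces exactly the monomial \<alpha> in the variables, and a single vector reads off all
  coefficients. In characteristic other than 2 the square 2 x_j^2 is nonzero, which is where leading
  exponents with the entry 2 come from. A given axis of N^p carries only one of the entries 1 and 2,
  so distinct leading exponents lie on distinct axes; division with remainder is then possible in
  each coordinate separately, and no critical pairs have to be reduced.\<close>

locale assoc_alg = ring A for A :: "('k::field, 'a) module" (structure) +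
  assumes smult_closed [simp, intro]: "x \<in> carrier A \<Longrightarrow> c \<odot> x \<in> carrier A"
    and smult_add_left: "x \<in> carrier A \<Longrightarrow> (c + d) \<odot> x = c \<odot> x \<oplus> d \<odot> x"
    and smult_add_right: "\<lbrakk>x \<in> carrier A; y \<in> carrier A\<rbrakk> \<Longrightarrow> c \<odot> (x \<oplus> y) = c \<odot> x \<oplus> c \<odot> y"
    and smult_smult: "x \<in> carrier A \<Longrightarrow> c \<odot> (d \<odot> x) = (c * d) \<odot> x"
    and smult_one [simp]: "x \<in> carrier A \<Longrightarrow> 1 \<odot> x = x"
    and smult_mult_left: "\<lbrakk>x \<in> carrier A; y \<in> carrier A\<rbrakk> \<Longrightarrow> (c \<odot> x) \<otimes> y = c \<odot> (x \<otimes> y)"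
    and smult_mult_right: "\<lbrakk>x \<in> carrier A; y \<in> carrier A\<rbrakk> \<Longrightarrow> x \<otimes> (c \<odot> y) = c \<odot> (x \<otimes> y)"
begin

lemma smult_zero_left [simp]: "x \<in> carrier A \<Longrightarrow> 0 \<odot> x = \<zero>"
  using smult_add_left[of x 0 0] by (metis add.l_cancel_one add_0 smult_closed)

lemma smult_zero_right [simp]: "c \<odot> \<zero> = \<zero>"
  using smult_add_right[of \<zero> \<zero> c] by (metis add.l_cancel_one l_zero smult_closed zero_closed)

lemma smult_minus_one: "x \<in> carrier A \<Longrightarrow> (- 1) \<odot> x = \<ominus> x"
  using smult_add_left[of x 1 "-1"]
  by (metis add.right_inverse add.inv_equality add.inv_closed add.inv_inv smult_closed smult_one
      smult_zero_left r_neg add.m_comm)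

lemma smult_minus_left: "x \<in> carrier A \<Longrightarrow> (- c) \<odot> x = \<ominus> (c \<odot> x)"
  using smult_smult[of x "-1" c] smult_minus_one[of "c \<odot> x"] by simp

end

section \<open>Homomorphisms of associative algebras\<close>

definition alg_homs :: "('k, 'a) module \<Rightarrow> ('k, 'b) module \<Rightarrow> ('a \<Rightarrow> 'b) set" where
  "alg_homs A B = {h \<in> Ring.ring_hom A B. \<forall>c. \<forall>x\<in>carrier A. h (c \<odot>\<^bsub>A\<^esub> x) = c \<odot>\<^bsub>B\<^esub> h x}"

lemma alg_homs_closed: "h \<in> alg_homs A B \<Longrightarrow> x \<in> carrier A \<Longrightarrow> h x \<in> carrier B"
  and alg_homs_mult: "h \<in> alg_homs A B \<Longrightarrow> x \<in> carrier A \<Longrightarrow> y \<in> carrier A \<Longrightarrow>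
    h (x \<otimes>\<^bsub>A\<^esub> y) = h x \<otimes>\<^bsub>B\<^esub> h y"
  and alg_homs_add: "h \<in> alg_homs A B \<Longrightarrow> x \<in> carrier A \<Longrightarrow> y \<in> carrier A \<Longrightarrow>
    h (x \<oplus>\<^bsub>A\<^esub> y) = h x \<oplus>\<^bsub>B\<^esub> h y"
  and alg_homs_one: "h \<in> alg_homs A B \<Longrightarrow> h \<one>\<^bsub>A\<^esub> = \<one>\<^bsub>B\<^esub>"
  and alg_homs_smult: "h \<in> alg_homs A B \<Longrightarrow> x \<in> carrier A \<Longrightarrow> h (c \<odot>\<^bsub>A\<^esub> x) = c \<odot>\<^bsub>B\<^esub> h x"
  by (auto simp: alg_homs_def Ring.ring_hom_def)

lemma alg_homs_ring_hom: "h \<in> alg_homs A B \<Longrightarrow> h \<in> Ring.ring_hom A B"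
  by (simp add: alg_homs_def)

lemma alg_homs_module_hom: "h \<in> alg_homs A B \<Longrightarrow> h \<in> LinearCombinations.module_hom class_ring A B"
  by (auto simp: alg_homs_def Ring.ring_hom_def LinearCombinations.module_hom_def)

lemma alg_homsI:
  assumes "\<And>x. x \<in> carrier A \<Longrightarrow> h x \<in> carrier B"
    and "\<And>x y. x \<in> carrier A \<Longrightarrow> y \<in> carrier A \<Longrightarrow> h (x \<otimes>\<^bsub>A\<^esub> y) = h x \<otimes>\<^bsub>B\<^esub> h y"
    and "\<And>x y. x \<in> carrier A \<Longrightarrow> y \<in> carrier A \<Longrightarrow> h (x \<oplus>\<^bsub>A\<^esub> y) = h x \<oplus>\<^bsub>B\<^esub> h y"
    and "h \<one>\<^bsub>A\<^esub> = \<one>\<^bsub>B\<^esub>"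
    and "\<And>c x. x \<in> carrier A \<Longrightarrow> h (c \<odot>\<^bsub>A\<^esub> x) = c \<odot>\<^bsub>B\<^esub> h x"
  shows "h \<in> alg_homs A B"
  using assms by (auto simp: alg_homs_def Ring.ring_hom_def)

lemma alg_homs_comp: "g \<in> alg_homs A B \<Longrightarrow> h \<in> alg_homs B C \<Longrightarrow> h \<circ> g \<in> alg_homs A C"
  by (rule alg_homsI) (simp_all add: alg_homs_closed alg_homs_mult alg_homs_add alg_homs_one alg_homs_smult)

lemma alg_homs_zero:
  assumes "assoc_alg A" "assoc_alg B" "h \<in> alg_homs A B"
  shows "h \<zero>\<^bsub>A\<^esub> = \<zero>\<^bsub>B\<^esub>"
proof -
  interpret A: assoc_alg A by fact
  interpret B: assoc_alg B by fact
  show ?thesis using alg_homs_smult[OF assms(3), of "\<zero>\<^bsub>A\<^esub>" 0] alg_homs_closed[OF assms(3), of "\<zero>\<^bsub>A\<^esub>"]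
    by simp
qed

lemma alg_homs_minus:
  assumes "assoc_alg A" "assoc_alg B" "h \<in> alg_homs A B" "x \<in> carrier A" "y \<in> carrier A"
  shows "h (x \<ominus>\<^bsub>A\<^esub> y) = h x \<ominus>\<^bsub>B\<^esub> h y"
proof -
  interpret A: assoc_alg A by fact
  interpret B: assoc_alg B by fact
  have "h (x \<ominus>\<^bsub>A\<^esub> y) = h (x \<oplus>\<^bsub>A\<^esub> (-1) \<odot>\<^bsub>A\<^esub> y)"
    using assms by (simp add: A.smult_minus_one A.minus_eq)
  also have "\<dots> = h x \<oplus>\<^bsub>B\<^esub> (-1) \<odot>\<^bsub>B\<^esub> h y"
    using assms by (simp add: alg_homs_add alg_homs_smult)
  also have "\<dots> = h x \<ominus>\<^bsub>B\<^esub> h y"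
    using assms alg_homs_closed[OF assms(3)] by (simp add: B.smult_minus_one B.minus_eq)
  finally show ?thesis .
qed

lemma ring_hom_ring_alg_homs:
  "assoc_alg A \<Longrightarrow> assoc_alg B \<Longrightarrow> h \<in> alg_homs A B \<Longrightarrow> ring_hom_ring A B h"
  by (simp add: alg_homs_ring_hom assoc_alg.axioms(1) ring_hom_ringI2)

lemma alg_homs_kernel_ideal:
  assumes "assoc_alg A" "assoc_alg B" "h \<in> alg_homs A B"
  shows "ideal {x \<in> carrier A. h x = \<zero>\<^bsub>B\<^esub>} A"
  using ring_hom_ring.kernel_is_ideal[OF ring_hom_ring_alg_homs[OF assms]]
  by (simp add: a_kernel_def')

lemma alg_homs_genideal:
  assumes "assoc_alg A" "assoc_alg B" "h \<in> alg_homs A B" "S \<subseteq> carrier A"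
    and "\<And>x. x \<in> S \<Longrightarrow> h x = \<zero>\<^bsub>B\<^esub>" "y \<in> genideal A S"
  shows "h y = \<zero>\<^bsub>B\<^esub>"
proof -
  interpret A: assoc_alg A by fact
  have "genideal A S \<subseteq> {x \<in> carrier A. h x = \<zero>\<^bsub>B\<^esub>}"
    by (rule A.genideal_minimal[OF alg_homs_kernel_ideal[OF assms(1-3)]]) (use assms in auto)
  then show ?thesis using assms by auto
qed

subsection \<open>Quotient algebras\<close>

text \<open>\<open>alg_quot\<close> rebuilds a record from the operations of \<open>Quot\<close> and
  adds a scalar multiplication. The ring axioms mention the carrier and the four ring operations
  alone, so they pass from one record type to the other.\<close>

lemma ring_transfer:
  assumes "ring R" "carrier S = carrier R" "monoid.mult S = monoid.mult R"
    "monoid.one S = monoid.one R" "ring.zero S = ring.zero R" "ring.add S = ring.add R"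
  shows "ring S"
proof -
  interpret R: ring R by fact
  show ?thesis
  proof (rule ringI)
    show "abelian_group S"
    proof (rule abelian_groupI)
      fix x assume "x \<in> carrier S"
      then show "\<exists>y\<in>carrier S. y \<oplus>\<^bsub>S\<^esub> x = \<zero>\<^bsub>S\<^esub>"
        using assms R.add.inv_closed R.l_neg by metis
    qed (use assms R.a_ac in simp_all)
    show "Group.monoid S"
      by (rule Group.monoidI) (use assms R.m_assoc in simp_all)
  qed (use assms R.l_distr R.r_distr in simp_all)
qed

locale alg_ideal = assoc_alg A + ideal J A for A :: "('k::field, 'a) module" (structure) and J
begin

abbreviation proj :: "'a \<Rightarrow> 'a set" where "proj \<equiv> (+>) J"

text \<open>Scalars act through the multiples of the unit, so a ring ideal is automatically a
  subspace.\<close>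

lemma smult_ideal: "j \<in> J \<Longrightarrow> c \<odot> j \<in> J"
  using I_l_closed[of j "c \<odot> \<one>"] Icarr[of j] by (simp add: smult_mult_left)

lemma proj_eq_iff: "x \<in> carrier A \<Longrightarrow> y \<in> carrier A \<Longrightarrow> proj x = proj y \<longleftrightarrow> x \<ominus> y \<in> J"
  using quotient_eq_iff_same_a_r_cos[OF is_ideal] by auto

text \<open>All cosets in the union that defines the scalar multiplication of
  \<open>alg_quot\<close> are equal, because two representatives differ by an element of J; the
  union collapses to a single coset.\<close>

lemma proj_smult: "x \<in> carrier A \<Longrightarrow> (\<Union>b\<in>proj x. proj (c \<odot> b)) = proj (c \<odot> x)"
proof -
  assume x: "x \<in> carrier A"
  have "proj (c \<odot> b) = proj (c \<odot> x)" if b: "b \<in> proj x" for b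
  proof -
    from b have "\<exists>j\<in>J. b = j \<oplus> x" by (simp add: a_r_coset_def')
    then obtain j where j: "j \<in> J" "b = j \<oplus> x" by blast
    have jc: "j \<in> carrier A" using j Icarr by auto
    have "c \<odot> b \<ominus> c \<odot> x = c \<odot> j" using j x jc
      by (simp add: smult_add_right minus_eq a_assoc r_neg)
    then show ?thesis using j x jc smult_ideal by (simp add: proj_eq_iff)
  qed
  moreover have "x \<in> proj x" using a_rcos_self x by blast
  ultimately show ?thesis by blast
qed

lemma carrier_alg_quot: "carrier (alg_quot A J) = proj ` carrier A"
  by (auto simp: alg_quot_def FactRing_def A_RCOSETS_defs a_r_coset_def)

lemma proj_in [simp]: "x \<in> carrier A \<Longrightarrow> proj x \<in> carrier (alg_quot A J)"
  by (simp add: carrier_alg_quot)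

lemma proj_mult: "x \<in> carrier A \<Longrightarrow> y \<in> carrier A \<Longrightarrow>
    proj (x \<otimes> y) = proj x \<otimes>\<^bsub>alg_quot A J\<^esub> proj y"
  using ring_hom_mult[OF rcos_ring_hom] by (simp add: alg_quot_def)

lemma proj_add: "x \<in> carrier A \<Longrightarrow> y \<in> carrier A \<Longrightarrow>
    proj (x \<oplus> y) = proj x \<oplus>\<^bsub>alg_quot A J\<^esub> proj y"
  using ring_hom_add[OF rcos_ring_hom] by (simp add: alg_quot_def)

lemma proj_one: "proj \<one> = \<one>\<^bsub>alg_quot A J\<^esub>"
  using ring_hom_one[OF rcos_ring_hom] by (simp add: alg_quot_def)

lemma proj_sm: "x \<in> carrier A \<Longrightarrow> proj (c \<odot> x) = c \<odot>\<^bsub>alg_quot A J\<^esub> proj x"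
  by (simp add: alg_quot_def proj_smult)

lemma assoc_alg_quot: "assoc_alg (alg_quot A J)"
proof -
  interpret Q: ring "alg_quot A J"
    by (rule ring_transfer[OF quotient_is_ring]) (simp_all add: alg_quot_def)
  have *: "\<exists>x\<in>carrier A. X = proj x" if "X \<in> carrier (alg_quot A J)" for X
    using that by (auto simp: carrier_alg_quot)
  show ?thesis
  proof (unfold_locales, goal_cases)
    case (1 x c) then show ?case by (auto dest!: * simp flip: proj_sm)
  next
    case (2 x c d) then show ?case by (auto dest!: * simp: smult_add_left simp flip: proj_sm proj_add)
  next
    case (3 x y c) then show ?case by (auto dest!: * simp: smult_add_right simp flip: proj_sm proj_add)
  next
    case (4 x c d) then show ?case by (auto dest!: * simp: smult_smult simp flip: proj_sm proj_add)
  next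
    case (5 x) then show ?case by (auto dest!: * simp: smult_smult simp flip: proj_sm proj_add)
  next
    case (6 x y c) then show ?case
      by (auto dest!: * simp: smult_mult_left simp flip: proj_sm proj_add proj_mult)
  next
    case (7 x y c) then show ?case
      by (auto dest!: * simp: smult_mult_right simp flip: proj_sm proj_add proj_mult)
  qed
qed

lemma proj_hom: "proj \<in> alg_homs A (alg_quot A J)"
  by (rule alg_homsI) (simp_all add: proj_mult proj_add proj_one proj_sm)

lemma alg_quot_factor:
  assumes "assoc_alg B" "h \<in> alg_homs A B" "\<And>j. j \<in> J \<Longrightarrow> h j = \<zero>\<^bsub>B\<^esub>"
  shows "\<exists>h'\<in>alg_homs (alg_quot A J) B. \<forall>x\<in>carrier A. h' (proj x) = h x"
proof -
  interpret B: assoc_alg B by fact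
  \<comment> \<open>A representative is chosen for each coset; the value of h does not depend on it
    because h vanishes on J.\<close>
  define h' where "h' X = h (SOME x. x \<in> carrier A \<and> X = proj x)" for X
  have h': "h' (proj x) = h x" if x: "x \<in> carrier A" for x
  proof -
    define y where "y = (SOME y. y \<in> carrier A \<and> proj x = proj y)"
    have y: "y \<in> carrier A" "proj x = proj y"
      using someI[of "\<lambda>y. y \<in> carrier A \<and> proj x = proj y" x] x by (simp_all add: y_def)
    have "h (y \<ominus> x) = \<zero>\<^bsub>B\<^esub>" using assms(3) y x proj_eq_iff[of y x] by metis
    moreover have "h (y \<ominus> x) = h y \<ominus>\<^bsub>B\<^esub> h x"
      using alg_homs_minus[OF assoc_alg_axioms assms(1,2)] x y by simp
    ultimately have "h y = h x" using x y alg_homs_closed[OF assms(2)] by simp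
    then show ?thesis by (simp add: h'_def y_def)
  qed
  have *: "\<exists>x\<in>carrier A. X = proj x" if "X \<in> carrier (alg_quot A J)" for X
    using that by (auto simp: carrier_alg_quot)
  have "h' \<in> alg_homs (alg_quot A J) B"
    by (rule alg_homsI)
      (use alg_homs_closed[OF assms(2)] alg_homs_mult[OF assms(2)] alg_homs_add[OF assms(2)]
        alg_homs_one[OF assms(2)] alg_homs_smult[OF assms(2)] in
        \<open>auto dest!: * simp: h' simp flip: proj_mult proj_add proj_one proj_sm\<close>)
  then show ?thesis using h' by blast
qed

end

subsection \<open>Free algebras\<close>

declare in_lists_conv_set [simp del] in_listsI [simp del, rule del] in_listsD [rule del]

definition word_conv :: "('v list \<Rightarrow> 'k::field) \<Rightarrow> ('v list \<Rightarrow> 'k) \<Rightarrow> 'v list \<Rightarrow> 'k" where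
  "word_conv f g w = (\<Sum>i\<le>length w. f (take i w) * g (drop i w))"

lemma word_conv_assoc: "word_conv (word_conv f g) h = word_conv f (word_conv g h)"
proof
  fix w :: "'a list"
  let ?n = "length w"
  let ?F = "\<lambda>j i. f (take j w) * g (take (i - j) (drop j w)) * h (drop i w)"
  have "word_conv (word_conv f g) h w = (\<Sum>i\<le>?n. \<Sum>j\<le>i. ?F j i)"
    unfolding word_conv_def
    by (intro sum.cong refl) (auto simp: sum_distrib_right min_def drop_take intro!: sum.cong)
  also have "\<dots> = (\<Sum>(i, j)\<in>(SIGMA i:{..?n}. {..i}). ?F j i)"
    by (simp add: sum.Sigma)
  \<comment> \<open>Both sides sum over all ways to cut w into three consecutive pieces: (i, j)
    records the two cut positions, (j, l) the lengths of the first two pieces.\<close>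
  also have "\<dots> = (\<Sum>(j, l)\<in>(SIGMA j:{..?n}. {..?n - j}). ?F j (j + l))"
    by (rule sum.reindex_bij_witness[of _ "\<lambda>(j, l). (j + l, j)" "\<lambda>(i, j). (j, i - j)"]) auto
  also have "\<dots> = (\<Sum>j\<le>?n. \<Sum>l\<le>?n - j. ?F j (j + l))"
    by (simp add: sum.Sigma)
  also have "\<dots> = word_conv f (word_conv g h) w"
    unfolding word_conv_def
    by (intro sum.cong refl) (auto simp: sum_distrib_left add.commute mult.assoc intro!: sum.cong)
  finally show "word_conv (word_conv f g) h w = word_conv f (word_conv g h) w" .
qed

definition word_delta :: "'v list \<Rightarrow> 'v list \<Rightarrow> 'k::field" where
  "word_delta u = (\<lambda>w. if w = u then 1 else 0)"

lemma word_conv_delta: "word_conv (word_delta u) (word_delta v) = (word_delta (u @ v) :: 'v list \<Rightarrow> 'k::field)"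
proof
  fix w
  have "word_conv (word_delta u) (word_delta v) w =
      (\<Sum>i\<le>length w. if i = length u then (if w = u @ v then 1 else 0) else (0::'k))"
    unfolding word_conv_def word_delta_def
  proof (intro sum.cong refl)
    fix i assume "i \<in> {..length w}"
    then have "(take i w = u \<and> drop i w = v) = (i = length u \<and> w = u @ v)"
      by (metis append_eq_conv_conj append_take_drop_id atMost_iff length_take min.absorb2)
    moreover have "(if take i w = u then 1 else 0) * (if drop i w = v then 1 else 0) =
        (if take i w = u \<and> drop i w = v then 1 else (0::'k))"
      by simp
    moreover have "(if i = length u then if w = u @ v then 1 else 0 else 0) =
        (if i = length u \<and> w = u @ v then 1 else (0::'k))"
      by simp
    ultimately show "(if take i w = u then 1 else 0) * (if drop i w = v then 1 else 0) =
        (if i = length u then if w = u @ v then 1 else 0 else (0::'k))"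
      by (simp only:)
  qed
  also have "\<dots> = word_delta (u @ v) w"
    by (auto simp: word_delta_def)
  finally show "word_conv (word_delta u) (word_delta v) w = (word_delta (u @ v) w :: 'k)" .
qed

lemma free_alg_simps [simp]:
  "monoid.mult (free_alg S) = word_conv" "monoid.one (free_alg S) = word_delta []"
  "ring.zero (free_alg S) = (\<lambda>w. 0)" "ring.add (free_alg S) = (\<lambda>f g w. f w + g w)"
  "module.smult (free_alg S) = (\<lambda>c f w. c * f w)"
  by (auto simp: free_alg_def word_conv_def word_delta_def fun_eq_iff)

lemma carrier_free_alg: "f \<in> carrier (free_alg S) \<longleftrightarrow> finite {w. f w \<noteq> 0} \<and> (\<forall>w. f w \<noteq> 0 \<longrightarrow> w \<in> lists S)"
  by (auto simp: free_alg_def)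

lemma word_conv_add_left: "word_conv (\<lambda>w. f w + g w) h = (\<lambda>w. word_conv f h w + word_conv g h w)"
  and word_conv_add_right: "word_conv h (\<lambda>w. f w + g w) = (\<lambda>w. word_conv h f w + word_conv h g w)"
  and word_conv_smult_left: "word_conv (\<lambda>w. c * f w) h = (\<lambda>w. c * word_conv f h w)"
  and word_conv_smult_right: "word_conv h (\<lambda>w. c * f w) = (\<lambda>w. c * word_conv h f w)"
  by (simp_all add: word_conv_def fun_eq_iff distrib_left distrib_right sum.distrib sum_distrib_left mult_ac)

lemma word_conv_one: "word_conv (word_delta []) f = f" "word_conv f (word_delta []) = f"
proof -
  have "word_conv (word_delta []) f w = f w" for w
  proof -
    have "word_conv (word_delta []) f w = (\<Sum>i\<le>length w. if i = 0 then f w else 0)"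
      unfolding word_conv_def word_delta_def by (intro sum.cong) auto
    then show ?thesis by simp
  qed
  then show "word_conv (word_delta []) f = f" by blast
  have "word_conv f (word_delta []) w = f w" for w
  proof -
    have "word_conv f (word_delta []) w = (\<Sum>i\<le>length w. if i = length w then f w else 0)"
      unfolding word_conv_def word_delta_def by (intro sum.cong) auto
    then show ?thesis by simp
  qed
  then show "word_conv f (word_delta []) = f" by blast
qed

lemma word_conv_closed:
  assumes "f \<in> carrier (free_alg S)" "g \<in> carrier (free_alg S)"
  shows "word_conv f g \<in> carrier (free_alg S)"
proof -
  have *: "{w. word_conv f g w \<noteq> 0} \<subseteq> (\<lambda>(u, v). u @ v) ` ({w. f w \<noteq> 0} \<times> {w. g w \<noteq> 0})"
  proof
    fix w assume "w \<in> {w. word_conv f g w \<noteq> 0}"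
    then obtain i where "f (take i w) * g (drop i w) \<noteq> 0"
      unfolding word_conv_def by (metis (mono_tags, lifting) mem_Collect_eq sum.neutral)
    then show "w \<in> (\<lambda>(u, v). u @ v) ` ({w. f w \<noteq> 0} \<times> {w. g w \<noteq> 0})"
      by (intro image_eqI[of _ _ "(take i w, drop i w)"]) auto
  qed
  moreover have "finite ((\<lambda>(u, v). u @ v) ` ({w. f w \<noteq> 0} \<times> {w. g w \<noteq> 0}))"
    using assms by (auto simp: carrier_free_alg)
  moreover have "(\<lambda>(u, v). u @ v) ` ({w. f w \<noteq> 0} \<times> {w. g w \<noteq> 0}) \<subseteq> lists S"
    using assms by (auto simp: carrier_free_alg)
  ultimately show ?thesis unfolding carrier_free_alg by (meson finite_subset mem_Collect_eq subsetD)
qed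

lemma word_delta_closed: "u \<in> lists S \<Longrightarrow> word_delta u \<in> carrier (free_alg S)"
  by (auto simp: carrier_free_alg word_delta_def)

lemma free_alg_add_closed:
  "f \<in> carrier (free_alg S) \<Longrightarrow> g \<in> carrier (free_alg S) \<Longrightarrow> (\<lambda>w. f w + g w) \<in> carrier (free_alg S)"
  unfolding carrier_free_alg
  by (auto intro: finite_subset[of _ "{w. f w \<noteq> 0} \<union> {w. g w \<noteq> 0}"]) (metis add_0)

lemma free_alg_smult_closed:
  "f \<in> carrier (free_alg S) \<Longrightarrow> (\<lambda>w. c * f w) \<in> carrier (free_alg S)"
  unfolding carrier_free_alg
  by (auto intro: finite_subset[of _ "{w. f w \<noteq> 0}"])

lemma assoc_alg_free: "assoc_alg (free_alg S :: ('k::field, 'v list \<Rightarrow> 'k) module)"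
proof -
  interpret ring "free_alg S :: ('k::field, 'v list \<Rightarrow> 'k) module"
  proof (rule ringI)
    show "abelian_group (free_alg S :: ('k::field, 'v list \<Rightarrow> 'k) module)"
    proof (rule abelian_groupI)
      fix f :: "'v list \<Rightarrow> 'k" assume "f \<in> carrier (free_alg S)"
      then have "(\<lambda>w. - 1 * f w) \<in> carrier (free_alg S)" by (rule free_alg_smult_closed)
      then show "\<exists>g\<in>carrier (free_alg S). g \<oplus>\<^bsub>free_alg S\<^esub> f = \<zero>\<^bsub>free_alg S\<^esub>"
        by (rule bexI[rotated]) simp
    qed (simp_all add: free_alg_add_closed add_ac, simp add: carrier_free_alg)
    show "Group.monoid (free_alg S :: ('k::field, 'v list \<Rightarrow> 'k) module)"
      by (rule Group.monoidI) (simp_all add: word_conv_closed word_conv_assoc word_conv_one word_delta_closed)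
  qed (simp_all add: word_conv_add_left word_conv_add_right)
  show ?thesis
    by unfold_locales
      (simp_all add: free_alg_smult_closed word_conv_smult_left word_conv_smult_right distrib_left
        distrib_right mult_ac)
qed

text \<open>Induction on the finite support, removing the coefficient of one word at a time; linear
  and bilinear identities on the free algebra thereby reduce to single words.\<close>

lemma free_alg_induct [consumes 1, case_names zero add]:
  assumes "f \<in> carrier (free_alg S)"
    and "P (\<lambda>w. 0)"
    and "\<And>c u f. u \<in> lists S \<Longrightarrow> f \<in> carrier (free_alg S) \<Longrightarrow> P f \<Longrightarrow> P (\<lambda>w. c * word_delta u w + f w)"
  shows "P f"
proof -
  have "finite T \<Longrightarrow> f \<in> carrier (free_alg S) \<Longrightarrow> {w. f w \<noteq> 0} = T \<Longrightarrow> P f" for T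
  proof (induction T arbitrary: f rule: finite_induct)
    case empty
    then have "f = (\<lambda>w. 0)" by auto
    then show ?case using assms(2) by simp
  next
    case (insert u T)
    let ?g = "f(u := 0)"
    have g: "{w. ?g w \<noteq> 0} = T" using insert.hyps insert.prems by (auto split: if_splits)
    moreover have gc: "?g \<in> carrier (free_alg S)"
      using insert.prems(1) insert.hyps g unfolding carrier_free_alg by auto
    ultimately have "P ?g" using insert.IH by blast
    moreover have "u \<in> lists S" using insert.prems by (auto simp: carrier_free_alg)
    ultimately have "P (\<lambda>w. f u * word_delta u w + ?g w)" using assms(3)[OF _ gc] by blast
    moreover have "(\<lambda>w. f u * word_delta u w + ?g w) = f" by (auto simp: word_delta_def)
    ultimately show ?case by simp
  qed
  then show ?thesis using assms(1) by (auto simp: carrier_free_alg)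
qed

lemma letter_eq_delta: "letter x = word_delta [x]"
  by (simp add: letter_def word_delta_def)

lemma letter_closed: "x \<in> S \<Longrightarrow> letter x \<in> carrier (free_alg S)"
  by (simp add: letter_eq_delta word_delta_closed)

context assoc_alg
begin

definition word_prod :: "('v \<Rightarrow> 'a) \<Rightarrow> 'v list \<Rightarrow> 'a" where
  "word_prod f w = foldr (\<lambda>x a. f x \<otimes> a) w \<one>"

lemma word_prod_closed: "f \<in> S \<rightarrow> carrier A \<Longrightarrow> w \<in> lists S \<Longrightarrow> word_prod f w \<in> carrier A"
  unfolding word_prod_def by (induction w) auto

lemma word_prod_append: "f \<in> S \<rightarrow> carrier A \<Longrightarrow> u \<in> lists S \<Longrightarrow> v \<in> lists S \<Longrightarrow>
    word_prod f (u @ v) = word_prod f u \<otimes> word_prod f v"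
proof (induction u)
  case Nil
  then show ?case using word_prod_closed[of f S v] by (simp add: word_prod_def)
next
  case (Cons x u)
  then show ?case using word_prod_closed[of f S v] word_prod_closed[of f S u]
    by (auto simp: word_prod_def m_assoc Pi_iff)
qed

text \<open>The homomorphism out of the free algebra that extends f. Additivity is proved by summing
  over a common finite set of words, since the support of a sum can be smaller than the union of the
  supports.\<close>

definition free_eval :: "('v \<Rightarrow> 'a) \<Rightarrow> ('v list \<Rightarrow> 'k) \<Rightarrow> 'a" where
  "free_eval f F = (\<Oplus>w\<in>{w. F w \<noteq> 0}. F w \<odot> word_prod f w)"

context
  fixes f :: "'v \<Rightarrow> 'a" and S :: "'v set"
  assumes f: "f \<in> S \<rightarrow> carrier A"
begin

lemma free_eval_superset:
  assumes "F \<in> carrier (free_alg S)" "finite T" "{w. F w \<noteq> 0} \<subseteq> T" "T \<subseteq> lists S"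
  shows "free_eval f F = (\<Oplus>w\<in>T. F w \<odot> word_prod f w)"
  unfolding free_eval_def
  by (rule add.finprod_mono_neutral_cong_left) (use assms word_prod_closed[OF f] in \<open>auto simp: subset_iff\<close>)

lemma free_eval_add:
  assumes "F \<in> carrier (free_alg S)" "G \<in> carrier (free_alg S)"
  shows "free_eval f (\<lambda>w. F w + G w) = free_eval f F \<oplus> free_eval f G"
proof -
  let ?T = "{w. F w \<noteq> 0} \<union> {w. G w \<noteq> 0}"
  have T: "finite ?T" "?T \<subseteq> lists S" using assms by (auto simp: carrier_free_alg)
  have "free_eval f (\<lambda>w. F w + G w) = (\<Oplus>w\<in>?T. (F w + G w) \<odot> word_prod f w)"
    by (rule free_eval_superset) (use T free_alg_add_closed[OF assms] in auto)
  also have "\<dots> = (\<Oplus>w\<in>?T. F w \<odot> word_prod f w \<oplus> G w \<odot> word_prod f w)"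
    by (rule finsum_cong') (use T word_prod_closed[OF f] in \<open>auto simp: smult_add_left\<close>)
  also have "\<dots> = (\<Oplus>w\<in>?T. F w \<odot> word_prod f w) \<oplus> (\<Oplus>w\<in>?T. G w \<odot> word_prod f w)"
    by (rule finsum_addf) (use T word_prod_closed[OF f] in auto)
  also have "\<dots> = free_eval f F \<oplus> free_eval f G"
    using free_eval_superset[OF assms(1) T(1) _ T(2)] free_eval_superset[OF assms(2) T(1) _ T(2)] by simp
  finally show ?thesis .
qed

lemma free_eval_closed:
  assumes "F \<in> carrier (free_alg S)"
  shows "free_eval f F \<in> carrier A"
  unfolding free_eval_def by (rule finsum_closed) (use assms word_prod_closed[OF f] in \<open>auto simp: carrier_free_alg\<close>)

lemma free_eval_delta:
  assumes "u \<in> lists S"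
  shows "free_eval f (\<lambda>w. c * word_delta u w) = c \<odot> word_prod f u"
proof -
  have "free_eval f (\<lambda>w. c * word_delta u w) = (\<Oplus>w\<in>{u}. (c * word_delta u w) \<odot> word_prod f w)"
    by (rule free_eval_superset)
      (use assms free_alg_smult_closed[OF word_delta_closed[OF assms]] in \<open>auto simp: word_delta_def split: if_splits\<close>)
  then show ?thesis using word_prod_closed[OF f assms] by (simp add: word_delta_def)
qed

lemma free_eval_zero: "free_eval f (\<lambda>w. 0) = \<zero>"
  by (simp add: free_eval_def)

lemma free_eval_smult:
  assumes "F \<in> carrier (free_alg S)"
  shows "free_eval f (\<lambda>w. c * F w) = c \<odot> free_eval f F"
  using assms
proof (induction rule: free_alg_induct)
  case (add d u F)
  have *: "(\<lambda>w. c * (d * word_delta u w + F w)) = (\<lambda>w. (c * d) * word_delta u w + c * F w)"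
    by (simp add: algebra_simps)
  show ?case unfolding *
    using add free_eval_closed[OF add(2)] word_prod_closed[OF f add(1)]
    by (simp add: free_eval_add free_eval_delta free_alg_smult_closed word_delta_closed smult_add_right smult_smult)
qed (simp add: free_eval_zero)

lemma free_eval_delta_mult:
  assumes "G \<in> carrier (free_alg S)" "u \<in> lists S"
  shows "free_eval f (word_conv (word_delta u) G) = word_prod f u \<otimes> free_eval f G"
  using assms(1)
proof (induction rule: free_alg_induct)
  case zero
  have "word_conv (word_delta u) (\<lambda>w. 0) = (\<lambda>w. 0 :: 'k)" by (simp add: word_conv_def fun_eq_iff)
  then show ?case using word_prod_closed[OF f assms(2)] by (simp add: free_eval_zero)
next
  case (add d v F)
  have "u @ v \<in> lists S" using assms add by simp
  then show ?case
    using add assms free_eval_closed[OF add(2)] word_prod_closed[OF f add(1)] word_prod_closed[OF f assms(2)]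
    by (simp add: word_conv_add_right word_conv_smult_right word_conv_delta free_eval_add free_eval_delta
        word_conv_closed free_alg_smult_closed word_delta_closed smult_mult_right r_distr
        word_prod_append[OF f] del: append_in_lists_conv)
qed

lemma free_eval_mult:
  assumes "F \<in> carrier (free_alg S)" "G \<in> carrier (free_alg S)"
  shows "free_eval f (word_conv F G) = free_eval f F \<otimes> free_eval f G"
  using assms(1)
proof (induction rule: free_alg_induct)
  case zero
  have "word_conv (\<lambda>w. 0) G = (\<lambda>w. 0 :: 'k)" by (simp add: word_conv_def fun_eq_iff)
  then show ?case using free_eval_closed[OF assms(2)] by (simp add: free_eval_zero)
next
  case (add d u F)
  then show ?case
    using assms(2) free_eval_closed[OF add(2)] free_eval_closed[OF assms(2)] word_prod_closed[OF f add(1)]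
    by (simp add: word_conv_add_left word_conv_smult_left free_eval_add free_eval_delta free_eval_delta_mult
        word_conv_closed free_alg_smult_closed word_delta_closed smult_mult_left l_distr free_eval_smult)
qed

lemma free_eval_hom: "free_eval f \<in> alg_homs (free_alg S) A"
proof (rule alg_homsI)
  show "free_eval f \<one>\<^bsub>free_alg S\<^esub> = \<one>"
    using free_eval_delta[of "[]" 1] by (simp add: word_prod_def)
qed (simp_all add: free_eval_closed free_eval_mult free_eval_add free_eval_smult)

lemma free_eval_letter: "x \<in> S \<Longrightarrow> free_eval f (letter x) = f x"
  using free_eval_delta[of "[x]" 1] f by (simp add: letter_eq_delta word_prod_def Pi_iff)

end

end

text \<open>Words are products of letters, so a property closed under the algebra operations can be
  checked on letters. Transported along two projections this gives induction over an enveloping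
  algebra.\<close>

lemma free_alg_generated:
  assumes "F \<in> carrier (free_alg S)"
    and "P (\<lambda>w. 0)" "P (word_delta [])" "\<And>x. x \<in> S \<Longrightarrow> P (letter x)"
    and "\<And>F G. F \<in> carrier (free_alg S) \<Longrightarrow> G \<in> carrier (free_alg S) \<Longrightarrow> P F \<Longrightarrow> P G \<Longrightarrow> P (\<lambda>w. F w + G w)"
    and "\<And>F G. F \<in> carrier (free_alg S) \<Longrightarrow> G \<in> carrier (free_alg S) \<Longrightarrow> P F \<Longrightarrow> P G \<Longrightarrow> P (word_conv F G)"
    and "\<And>c F. F \<in> carrier (free_alg S) \<Longrightarrow> P F \<Longrightarrow> P (\<lambda>w. c * F w)"
  shows "P F"
proof -
  have delta: "P (word_delta u)" if "u \<in> lists S" for u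
    using that
  proof (induction u)
    case (Cons x u)
    then have "P (word_conv (letter x) (word_delta u))"
      using assms(4,6) letter_closed[of x S] word_delta_closed[of u S] by auto
    then show ?case by (simp add: letter_eq_delta word_conv_delta)
  qed (fact assms(3))
  from assms(1) show ?thesis
  proof (induction rule: free_alg_induct)
    case (add c u F)
    show ?case
      by (rule assms(5)[OF free_alg_smult_closed[OF word_delta_closed[OF add(1)]] add(2)
            assms(7)[OF word_delta_closed[OF add(1)] delta[OF add(1)]] add(3)])
  qed (fact assms(2))
qed

section \<open>The enveloping algebra\<close>

declare free_alg_simps [simp del]

text \<open>These are the maps on L that extend to algebra homomorphisms on the enveloping algebra.
  The defining relation is solved for the product of \<open>f x\<close> and \<open>f y\<close>,
  which avoids subtraction.\<close>

definition relation_preserving ::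
    "('g \<Rightarrow> 'g \<Rightarrow> 'k::field) \<Rightarrow> ('k, 'v, 'g) color_alg \<Rightarrow> ('k, 'a) module \<Rightarrow> ('v \<Rightarrow> 'a) \<Rightarrow> bool" where
  "relation_preserving \<epsilon> L A f \<longleftrightarrow> f \<in> carrier L \<rightarrow> carrier A \<and>
     (\<forall>x\<in>carrier L. \<forall>y\<in>carrier L. f (x \<oplus>\<^bsub>L\<^esub> y) = f x \<oplus>\<^bsub>A\<^esub> f y) \<and>
     (\<forall>c. \<forall>x\<in>carrier L. f (c \<odot>\<^bsub>L\<^esub> x) = c \<odot>\<^bsub>A\<^esub> f x) \<and>
     (\<forall>g h. \<forall>x\<in>homog L g. \<forall>y\<in>homog L h.
        f x \<otimes>\<^bsub>A\<^esub> f y = \<epsilon> g h \<odot>\<^bsub>A\<^esub> (f y \<otimes>\<^bsub>A\<^esub> f x) \<oplus>\<^bsub>A\<^esub> f (bracket L x y))"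

text \<open>Closure conditions sufficient for the enveloping algebra and its universal property;
  they are isolated so that the same results apply to L and to its quotient by K.\<close>

locale bracket_closed =
  fixes \<epsilon> :: "'g \<Rightarrow> 'g \<Rightarrow> 'k::field" and L :: "('k, 'v, 'g) color_alg"
  assumes add_closed: "x \<in> carrier L \<Longrightarrow> y \<in> carrier L \<Longrightarrow> x \<oplus>\<^bsub>L\<^esub> y \<in> carrier L"
    and smult_closed: "x \<in> carrier L \<Longrightarrow> c \<odot>\<^bsub>L\<^esub> x \<in> carrier L"
    and homog_closed: "x \<in> homog L g \<Longrightarrow> x \<in> carrier L"
    and bracket_homog_closed: "x \<in> homog L g \<Longrightarrow> y \<in> homog L h \<Longrightarrow> bracket L x y \<in> carrier L"
begin

abbreviation F where "F \<equiv> free_alg (carrier L) :: ('k, 'v list \<Rightarrow> 'k) module"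
abbreviation T where "T \<equiv> tensor_alg L"
abbreviation U where "U \<equiv> env_alg \<epsilon> L"
abbreviation inc where "inc \<equiv> env_incl \<epsilon> L"

sublocale F: assoc_alg F by (rule assoc_alg_free)

lemma linear_relations_closed: "linear_relations L \<subseteq> carrier F"
proof
  fix z :: "'v list \<Rightarrow> 'k" assume "z \<in> linear_relations L"
  then show "z \<in> carrier F" unfolding linear_relations_def
  proof (elim UnE CollectE exE conjE)
    fix x y assume "z = letter (x \<oplus>\<^bsub>L\<^esub> y) \<ominus>\<^bsub>F\<^esub> (letter x \<oplus>\<^bsub>F\<^esub> letter y)" "x \<in> carrier L" "y \<in> carrier L"
    then show ?thesis
      by (simp only:) (intro F.minus_closed F.add.m_closed letter_closed add_closed)
  next
    fix c x assume "z = letter (c \<odot>\<^bsub>L\<^esub> x) \<ominus>\<^bsub>F\<^esub> (c \<odot>\<^bsub>F\<^esub> letter x)" "x \<in> carrier L"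
    then show ?thesis
      by (simp only:) (intro F.minus_closed F.smult_closed letter_closed smult_closed)
  qed
qed

sublocale FI: alg_ideal F "linear_ideal L"
  unfolding linear_ideal_def
  by (intro alg_ideal.intro F.assoc_alg_axioms F.genideal_ideal linear_relations_closed)

sublocale T: assoc_alg T
  unfolding tensor_alg_def by (rule FI.assoc_alg_quot)

lemma tensor_incl_closed: "x \<in> carrier L \<Longrightarrow> tensor_incl L x \<in> carrier T"
  unfolding tensor_incl_def tensor_alg_def by (intro FI.proj_in letter_closed)

lemma tensor_incl_add:
  assumes "x \<in> carrier L" "y \<in> carrier L"
  shows "tensor_incl L (x \<oplus>\<^bsub>L\<^esub> y) = tensor_incl L x \<oplus>\<^bsub>T\<^esub> tensor_incl L y"
proof -
  have "letter (x \<oplus>\<^bsub>L\<^esub> y) \<ominus>\<^bsub>F\<^esub> (letter x \<oplus>\<^bsub>F\<^esub> letter y) \<in> linear_relations L"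
    using assms unfolding linear_relations_def by blast
  then have "letter (x \<oplus>\<^bsub>L\<^esub> y) \<ominus>\<^bsub>F\<^esub> (letter x \<oplus>\<^bsub>F\<^esub> letter y) \<in> linear_ideal L"
    unfolding linear_ideal_def using F.genideal_self[OF linear_relations_closed] by blast
  moreover have c: "letter (x \<oplus>\<^bsub>L\<^esub> y) \<in> carrier F" "letter x \<in> carrier F" "letter y \<in> carrier F"
    using assms by (simp_all add: letter_closed add_closed)
  ultimately have "FI.proj (letter (x \<oplus>\<^bsub>L\<^esub> y)) = FI.proj (letter x \<oplus>\<^bsub>F\<^esub> letter y)"
    using FI.proj_eq_iff[OF c(1) F.add.m_closed[OF c(2,3)]] by blast
  then show ?thesis
    unfolding tensor_incl_def tensor_alg_def by (simp only: FI.proj_add[OF c(2,3)])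
qed

lemma tensor_incl_smult:
  assumes "x \<in> carrier L"
  shows "tensor_incl L (c \<odot>\<^bsub>L\<^esub> x) = c \<odot>\<^bsub>T\<^esub> tensor_incl L x"
proof -
  have "letter (c \<odot>\<^bsub>L\<^esub> x) \<ominus>\<^bsub>F\<^esub> (c \<odot>\<^bsub>F\<^esub> letter x) \<in> linear_relations L"
    using assms unfolding linear_relations_def by blast
  then have "letter (c \<odot>\<^bsub>L\<^esub> x) \<ominus>\<^bsub>F\<^esub> (c \<odot>\<^bsub>F\<^esub> letter x) \<in> linear_ideal L"
    unfolding linear_ideal_def using F.genideal_self[OF linear_relations_closed] by blast
  moreover have c: "letter (c \<odot>\<^bsub>L\<^esub> x) \<in> carrier F" "letter x \<in> carrier F"
    using assms by (simp_all add: letter_closed smult_closed)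
  ultimately have "FI.proj (letter (c \<odot>\<^bsub>L\<^esub> x)) = FI.proj (c \<odot>\<^bsub>F\<^esub> letter x)"
    using FI.proj_eq_iff[OF c(1) F.smult_closed[OF c(2)]] by blast
  then show ?thesis
    unfolding tensor_incl_def tensor_alg_def by (simp only: FI.proj_sm[OF c(2)])
qed

definition color_relations where
  "color_relations = {tensor_incl L x \<otimes>\<^bsub>T\<^esub> tensor_incl L y
        \<ominus>\<^bsub>T\<^esub> \<epsilon> g h \<odot>\<^bsub>T\<^esub> (tensor_incl L y \<otimes>\<^bsub>T\<^esub> tensor_incl L x)
        \<ominus>\<^bsub>T\<^esub> tensor_incl L (bracket L x y)
      |x y g h. x \<in> homog L g \<and> y \<in> homog L h}"

lemma color_relations_closed: "color_relations \<subseteq> carrier T"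
  unfolding color_relations_def using tensor_incl_closed homog_closed bracket_homog_closed by blast

sublocale TI: alg_ideal T "color_ideal \<epsilon> L"
  unfolding color_ideal_def color_relations_def[symmetric]
  by (intro alg_ideal.intro T.assoc_alg_axioms T.genideal_ideal color_relations_closed)

sublocale U: assoc_alg U
  unfolding env_alg_def by (rule TI.assoc_alg_quot)

lemma inc_relation_preserving: "relation_preserving \<epsilon> L U inc"
  unfolding relation_preserving_def
proof (intro conjI ballI allI funcsetI)
  show "inc x \<in> carrier U" if "x \<in> carrier L" for x
    unfolding env_incl_def env_alg_def using that by (intro TI.proj_in tensor_incl_closed)
  show "inc (x \<oplus>\<^bsub>L\<^esub> y) = inc x \<oplus>\<^bsub>U\<^esub> inc y" if "x \<in> carrier L" "y \<in> carrier L" for x y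
    unfolding env_incl_def env_alg_def using that
    by (simp add: tensor_incl_add tensor_incl_closed TI.proj_add)
  show "inc (c \<odot>\<^bsub>L\<^esub> x) = c \<odot>\<^bsub>U\<^esub> inc x" if "x \<in> carrier L" for c x
    unfolding env_incl_def env_alg_def using that
    by (simp add: tensor_incl_smult tensor_incl_closed TI.proj_sm)
  fix g h x y assume xy: "x \<in> homog L g" "y \<in> homog L h"
  let ?x = "tensor_incl L x" and ?y = "tensor_incl L y" and ?z = "tensor_incl L (bracket L x y)"
  have c: "?x \<in> carrier T" "?y \<in> carrier T" "?z \<in> carrier T"
    using xy tensor_incl_closed homog_closed bracket_homog_closed by blast+
  have "?x \<otimes>\<^bsub>T\<^esub> ?y \<ominus>\<^bsub>T\<^esub> \<epsilon> g h \<odot>\<^bsub>T\<^esub> (?y \<otimes>\<^bsub>T\<^esub> ?x) \<ominus>\<^bsub>T\<^esub> ?z \<in> color_relations"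
    unfolding color_relations_def using xy by blast
  then have "?x \<otimes>\<^bsub>T\<^esub> ?y \<ominus>\<^bsub>T\<^esub> \<epsilon> g h \<odot>\<^bsub>T\<^esub> (?y \<otimes>\<^bsub>T\<^esub> ?x) \<ominus>\<^bsub>T\<^esub> ?z \<in> color_ideal \<epsilon> L"
    unfolding color_ideal_def color_relations_def[symmetric]
    using T.genideal_self[OF color_relations_closed] by blast
  also have "?x \<otimes>\<^bsub>T\<^esub> ?y \<ominus>\<^bsub>T\<^esub> \<epsilon> g h \<odot>\<^bsub>T\<^esub> (?y \<otimes>\<^bsub>T\<^esub> ?x) \<ominus>\<^bsub>T\<^esub> ?z =
     ?x \<otimes>\<^bsub>T\<^esub> ?y \<ominus>\<^bsub>T\<^esub> (\<epsilon> g h \<odot>\<^bsub>T\<^esub> (?y \<otimes>\<^bsub>T\<^esub> ?x) \<oplus>\<^bsub>T\<^esub> ?z)"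
    using c by (simp add: T.minus_eq T.minus_add T.a_assoc)
  finally have "TI.proj (?x \<otimes>\<^bsub>T\<^esub> ?y) = TI.proj (\<epsilon> g h \<odot>\<^bsub>T\<^esub> (?y \<otimes>\<^bsub>T\<^esub> ?x) \<oplus>\<^bsub>T\<^esub> ?z)"
    using c by (subst TI.proj_eq_iff) auto
  then show "inc x \<otimes>\<^bsub>U\<^esub> inc y = \<epsilon> g h \<odot>\<^bsub>U\<^esub> (inc y \<otimes>\<^bsub>U\<^esub> inc x) \<oplus>\<^bsub>U\<^esub> inc (bracket L x y)"
    unfolding env_incl_def env_alg_def using c
    by (simp add: TI.proj_mult TI.proj_add TI.proj_sm)
qed

text \<open>The composite of the two projections from the free algebra is onto, so induction over
  letters becomes induction over the images of elements of L.\<close>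

lemma env_alg_generated [consumes 1, case_names one inc add mult smult]:
  assumes u: "u \<in> carrier U"
    and P: "P \<one>\<^bsub>U\<^esub>" "\<And>x. x \<in> carrier L \<Longrightarrow> P (inc x)"
    "\<And>u v. u \<in> carrier U \<Longrightarrow> v \<in> carrier U \<Longrightarrow> P u \<Longrightarrow> P v \<Longrightarrow> P (u \<oplus>\<^bsub>U\<^esub> v)"
    "\<And>u v. u \<in> carrier U \<Longrightarrow> v \<in> carrier U \<Longrightarrow> P u \<Longrightarrow> P v \<Longrightarrow> P (u \<otimes>\<^bsub>U\<^esub> v)"
    "\<And>c u. u \<in> carrier U \<Longrightarrow> P u \<Longrightarrow> P (c \<odot>\<^bsub>U\<^esub> u)"
  shows "P u"
proof -
  define \<pi> where "\<pi> = (\<lambda>f. TI.proj (FI.proj f))"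
  have "TI.proj \<in> alg_homs T U"
    unfolding env_alg_def by (rule TI.proj_hom)
  moreover have "FI.proj \<in> alg_homs F T"
    unfolding tensor_alg_def by (rule FI.proj_hom)
  ultimately have \<pi>: "\<pi> \<in> alg_homs F U"
    unfolding \<pi>_def using alg_homs_comp[of FI.proj F T TI.proj U] by (simp add: comp_def)
  have letter: "\<pi> (letter x) = inc x" for x
    by (simp add: \<pi>_def env_incl_def tensor_incl_def)
  obtain f where f: "f \<in> carrier F" "u = \<pi> f"
    using u TI.carrier_alg_quot FI.carrier_alg_quot
    unfolding env_alg_def tensor_alg_def \<pi>_def by auto
  have "P (\<pi> f)"
    using f(1)
  proof (rule free_alg_generated)
    show "P (\<pi> (\<lambda>w. 0))"
      using P(5)[OF _ P(1), of 0] alg_homs_zero[OF F.assoc_alg_axioms U.assoc_alg_axioms \<pi>] by (simp add: free_alg_simps)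
    show "P (\<pi> (word_delta []))"
      using P(1) alg_homs_one[OF \<pi>] by (simp add: free_alg_simps)
    show "P (\<pi> (letter x))" if "x \<in> carrier L" for x
      using P(2) letter that by simp
    show "P (\<pi> (\<lambda>w. f w + g w))" if "f \<in> carrier F" "g \<in> carrier F" "P (\<pi> f)" "P (\<pi> g)" for f g
      using P(3) that alg_homs_add[OF \<pi>] alg_homs_closed[OF \<pi>] by (simp add: free_alg_simps)
    show "P (\<pi> (word_conv f g))" if "f \<in> carrier F" "g \<in> carrier F" "P (\<pi> f)" "P (\<pi> g)" for f g
      using P(4) that alg_homs_mult[OF \<pi>] alg_homs_closed[OF \<pi>] by (simp add: free_alg_simps)
    show "P (\<pi> (\<lambda>w. c * f w))" if "f \<in> carrier F" "P (\<pi> f)" for c f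
      using P(5) that alg_homs_smult[OF \<pi>] alg_homs_closed[OF \<pi>] by (simp add: free_alg_simps)
  qed
  then show ?thesis using f by simp
qed

text \<open>Evaluation on the free algebra is pushed through the two quotients in turn: linearity of
  f kills the linear relations, the color relation kills the second ideal.\<close>

lemma env_alg_universal:
  assumes A: "assoc_alg A" and f: "relation_preserving \<epsilon> L A f"
  shows "\<exists>h\<in>alg_homs U A. \<forall>x\<in>carrier L. h (inc x) = f x"
proof -
  interpret A: assoc_alg A by fact
  have fc: "f \<in> carrier L \<rightarrow> carrier A"
    and fadd: "\<And>x y. x \<in> carrier L \<Longrightarrow> y \<in> carrier L \<Longrightarrow> f (x \<oplus>\<^bsub>L\<^esub> y) = f x \<oplus>\<^bsub>A\<^esub> f y"
    and fsm: "\<And>c x. x \<in> carrier L \<Longrightarrow> f (c \<odot>\<^bsub>L\<^esub> x) = c \<odot>\<^bsub>A\<^esub> f x"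
    and frel: "\<And>g h x y. x \<in> homog L g \<Longrightarrow> y \<in> homog L h \<Longrightarrow>
        f x \<otimes>\<^bsub>A\<^esub> f y = \<epsilon> g h \<odot>\<^bsub>A\<^esub> (f y \<otimes>\<^bsub>A\<^esub> f x) \<oplus>\<^bsub>A\<^esub> f (bracket L x y)"
    using f unfolding relation_preserving_def by blast+
  define e where "e = A.free_eval f"
  have e: "e \<in> alg_homs F A" and e_letter: "\<And>x. x \<in> carrier L \<Longrightarrow> e (letter x) = f x"
    unfolding e_def using A.free_eval_hom[OF fc] A.free_eval_letter[OF fc] by auto
  have minus0: "a \<ominus>\<^bsub>A\<^esub> a = \<zero>\<^bsub>A\<^esub>" if "a \<in> carrier A" for a
    using that by simp
  have "e z = \<zero>\<^bsub>A\<^esub>" if z: "z \<in> linear_relations L" for z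
    using z unfolding linear_relations_def
  proof (elim UnE CollectE exE conjE)
    fix x y assume *: "z = letter (x \<oplus>\<^bsub>L\<^esub> y) \<ominus>\<^bsub>F\<^esub> (letter x \<oplus>\<^bsub>F\<^esub> letter y)" "x \<in> carrier L" "y \<in> carrier L"
    have c: "letter (x \<oplus>\<^bsub>L\<^esub> y) \<in> carrier F" "letter x \<in> carrier F" "letter y \<in> carrier F"
      using *(2,3) by (simp_all add: letter_closed add_closed)
    have "e z = e (letter (x \<oplus>\<^bsub>L\<^esub> y)) \<ominus>\<^bsub>A\<^esub> (e (letter x) \<oplus>\<^bsub>A\<^esub> e (letter y))"
      using alg_homs_minus[OF F.assoc_alg_axioms A e c(1) F.add.m_closed[OF c(2,3)]]
        alg_homs_add[OF e c(2,3)] *(1) by (simp only:)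
    then show ?thesis using * fc fadd add_closed by (auto simp: e_letter Pi_iff)
  next
    fix d x assume *: "z = letter (d \<odot>\<^bsub>L\<^esub> x) \<ominus>\<^bsub>F\<^esub> (d \<odot>\<^bsub>F\<^esub> letter x)" "x \<in> carrier L"
    have c: "letter (d \<odot>\<^bsub>L\<^esub> x) \<in> carrier F" "letter x \<in> carrier F"
      using *(2) by (simp_all add: letter_closed smult_closed)
    have "e z = e (letter (d \<odot>\<^bsub>L\<^esub> x)) \<ominus>\<^bsub>A\<^esub> (d \<odot>\<^bsub>A\<^esub> e (letter x))"
      using alg_homs_minus[OF F.assoc_alg_axioms A e c(1) F.smult_closed[OF c(2)]]
        alg_homs_smult[OF e c(2)] *(1) by (simp only:)
    then show ?thesis using * fc fsm smult_closed by (auto simp: e_letter Pi_iff)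
  qed
  then have "e z = \<zero>\<^bsub>A\<^esub>" if "z \<in> linear_ideal L" for z
    using alg_homs_genideal[OF F.assoc_alg_axioms A e linear_relations_closed] that
    unfolding linear_ideal_def by blast
  then obtain e1 where e1: "e1 \<in> alg_homs T A" "\<And>z. z \<in> carrier F \<Longrightarrow> e1 (FI.proj z) = e z"
    using FI.alg_quot_factor[OF A e] unfolding tensor_alg_def by blast
  have e1_incl: "e1 (tensor_incl L x) = f x" if "x \<in> carrier L" for x
    unfolding tensor_incl_def using e1(2)[OF letter_closed[OF that]] e_letter[OF that] by simp
  have "e1 z = \<zero>\<^bsub>A\<^esub>" if z: "z \<in> color_relations" for z
    using z unfolding color_relations_def
  proof (elim CollectE exE conjE)
    fix x y g h
    assume *: "z = tensor_incl L x \<otimes>\<^bsub>T\<^esub> tensor_incl L y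
        \<ominus>\<^bsub>T\<^esub> \<epsilon> g h \<odot>\<^bsub>T\<^esub> (tensor_incl L y \<otimes>\<^bsub>T\<^esub> tensor_incl L x)
        \<ominus>\<^bsub>T\<^esub> tensor_incl L (bracket L x y)"
      and xy: "x \<in> homog L g" "y \<in> homog L h"
    let ?x = "tensor_incl L x" and ?y = "tensor_incl L y" and ?z = "tensor_incl L (bracket L x y)"
    have cl: "x \<in> carrier L" "y \<in> carrier L" "bracket L x y \<in> carrier L"
      using xy homog_closed bracket_homog_closed by blast+
    then have c: "?x \<in> carrier T" "?y \<in> carrier T" "?z \<in> carrier T"
      using tensor_incl_closed by blast+
    have "e1 z = f x \<otimes>\<^bsub>A\<^esub> f y \<ominus>\<^bsub>A\<^esub> \<epsilon> g h \<odot>\<^bsub>A\<^esub> (f y \<otimes>\<^bsub>A\<^esub> f x) \<ominus>\<^bsub>A\<^esub> f (bracket L x y)"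
      unfolding * using c cl
      by (simp add: alg_homs_minus[OF T.assoc_alg_axioms A e1(1)] alg_homs_smult[OF e1(1)]
          alg_homs_mult[OF e1(1)] e1_incl)
    moreover have "f x \<in> carrier A" "f y \<in> carrier A" "f (bracket L x y) \<in> carrier A"
      using cl fc by auto
    ultimately show ?thesis unfolding frel[OF xy]
      by (simp add: A.minus_eq A.add.m_comm[of "_ \<odot>\<^bsub>A\<^esub> _"] A.a_assoc A.r_neg A.r_neg1 A.r_neg2)
  qed
  then have "e1 z = \<zero>\<^bsub>A\<^esub>" if "z \<in> color_ideal \<epsilon> L" for z
    using alg_homs_genideal[OF T.assoc_alg_axioms A e1(1) color_relations_closed] that
    unfolding color_ideal_def color_relations_def[symmetric] by blast
  then obtain e2 where e2: "e2 \<in> alg_homs U A" "\<And>z. z \<in> carrier T \<Longrightarrow> e2 (TI.proj z) = e1 z"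
    using TI.alg_quot_factor[OF A e1(1)] unfolding env_alg_def by blast
  have "e2 (inc x) = f x" if "x \<in> carrier L" for x
    unfolding env_incl_def using e2(2)[OF tensor_incl_closed[OF that]] e1_incl[OF that] by simp
  then show ?thesis using e2(1) by blast
qed

end

section \<open>A faithful representation\<close>

text \<open>Linear operators form a type of their own so that type class ring arithmetic applies to
  them. They act on all functions, among which the finitely supported ones are the polynomials; no
  finiteness has to be carried along.\<close>

typedef (overloaded) ('b, 'k::field) lin_op = "{T :: ('b \<Rightarrow> 'k) \<Rightarrow> ('b \<Rightarrow> 'k).
    (\<forall>f g. T (\<lambda>x. f x + g x) = (\<lambda>x. T f x + T g x)) \<and> (\<forall>c f. T (\<lambda>x. c * f x) = (\<lambda>x. c * T f x))}"
  by (rule exI[of _ "\<lambda>f. f"]) simp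

setup_lifting type_definition_lin_op

lemma Rep_lin_op_smult: "Rep_lin_op T (\<lambda>x. c * f x) = (\<lambda>x. c * Rep_lin_op T f x)"
  using Rep_lin_op[of T] by auto

instantiation lin_op :: (type, field) ring_1
begin

lift_definition zero_lin_op :: "('a, 'b) lin_op" is "\<lambda>f x. 0" by simp
lift_definition one_lin_op :: "('a, 'b) lin_op" is "\<lambda>f. f" by simp
lift_definition plus_lin_op :: "('a, 'b) lin_op \<Rightarrow> ('a, 'b) lin_op \<Rightarrow> ('a, 'b) lin_op"
  is "\<lambda>S T f x. S f x + T f x" by (simp add: algebra_simps)
lift_definition uminus_lin_op :: "('a, 'b) lin_op \<Rightarrow> ('a, 'b) lin_op"
  is "\<lambda>S f x. - S f x" by (simp add: algebra_simps)
lift_definition minus_lin_op :: "('a, 'b) lin_op \<Rightarrow> ('a, 'b) lin_op \<Rightarrow> ('a, 'b) lin_op"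
  is "\<lambda>S T f x. S f x - T f x" by (simp add: algebra_simps)
lift_definition times_lin_op :: "('a, 'b) lin_op \<Rightarrow> ('a, 'b) lin_op \<Rightarrow> ('a, 'b) lin_op"
  is "\<lambda>S T f. S (T f)" by simp

instance
proof
  show "(0 :: ('a, 'b) lin_op) \<noteq> 1"
    by transfer (metis zero_neq_one)
qed (transfer; simp add: algebra_simps fun_eq_iff)+

end

lift_definition op_smult :: "'k::field \<Rightarrow> ('b, 'k) lin_op \<Rightarrow> ('b, 'k) lin_op"  (infixr "*\<^sub>o" 75)
  is "\<lambda>c T f x. c * T f x" by (simp add: algebra_simps)

lemma op_smult_simps:
  "(c *\<^sub>o S) * T = c *\<^sub>o (S * T)" "S * (c *\<^sub>o T) = c *\<^sub>o (S * T)"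
  "c *\<^sub>o (a *\<^sub>o T) = (c * a) *\<^sub>o T" "1 *\<^sub>o T = T" "c *\<^sub>o 0 = 0" "0 *\<^sub>o T = 0"
  "c *\<^sub>o (S + T) = c *\<^sub>o S + c *\<^sub>o T" "(c + a) *\<^sub>o T = c *\<^sub>o T + a *\<^sub>o T"
  "(- c) *\<^sub>o T = - (c *\<^sub>o T)" "c *\<^sub>o (- T) = - (c *\<^sub>o T)"
  by (transfer; simp add: algebra_simps)+

lemma op_smult_sum: "c *\<^sub>o (\<Sum>i\<in>S. T i) = (\<Sum>i\<in>S. c *\<^sub>o T i)"
  by (induction S rule: infinite_finite_induct) (auto simp: op_smult_simps)

lemma Rep_lin_op_simps:
  "Rep_lin_op (S + T) f x = Rep_lin_op S f x + Rep_lin_op T f x"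
  "Rep_lin_op (S * T) f = Rep_lin_op S (Rep_lin_op T f)"
  "Rep_lin_op 1 f = f" "Rep_lin_op 0 f x = 0"
  "Rep_lin_op (c *\<^sub>o T) f x = c * Rep_lin_op T f x"
  by (transfer; simp)+

lemma Rep_lin_op_sum: "Rep_lin_op (\<Sum>i\<in>S. T i) f x = (\<Sum>i\<in>S. Rep_lin_op (T i) f x)"
  by (induction S rule: infinite_finite_induct) (auto simp: Rep_lin_op_simps)

definition op_alg :: "('k::field, ('b, 'k) lin_op) module" where
  "op_alg = \<lparr>carrier = UNIV, monoid.mult = (*), monoid.one = 1, ring.zero = 0, ring.add = (+),
     module.smult = (*\<^sub>o)\<rparr>"

lemma op_alg_simps [simp]:
  "carrier op_alg = UNIV" "monoid.mult op_alg = (*)" "monoid.one op_alg = 1"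
  "ring.zero op_alg = 0" "ring.add op_alg = (+)" "module.smult op_alg = (*\<^sub>o)"
  by (simp_all add: op_alg_def)

lemma assoc_alg_op_alg: "assoc_alg (op_alg :: ('k::field, ('b, 'k) lin_op) module)"
proof -
  interpret ring "op_alg :: ('k::field, ('b, 'k) lin_op) module"
  proof (rule ringI)
    show "abelian_group (op_alg :: ('k::field, ('b, 'k) lin_op) module)"
      by (rule abelian_groupI) (auto simp: add_ac intro: exI[of _ "- x" for x])
    show "Group.monoid (op_alg :: ('k::field, ('b, 'k) lin_op) module)"
      by (rule Group.monoidI) (auto simp: mult.assoc)
  qed (auto simp: algebra_simps)
  show ?thesis by unfold_locales (auto simp: op_smult_simps)
qed

section \<open>Color commutation of operators\<close>

context skew_bicharacter
begin

lemma zero_left [simp]: "\<epsilon> 0 g = 1" and zero_right [simp]: "\<epsilon> g 0 = 1"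
  using add_left[of 0 0 g] add_right[of g 0 0] nonzero[of 0 g] nonzero[of g 0] by auto

lemma minus_left: "\<epsilon> (- g) h = inverse (\<epsilon> g h)" and minus_right: "\<epsilon> g (- h) = inverse (\<epsilon> g h)"
  using add_left[of g "- g" h] add_right[of g h "- h"] nonzero[of g h]
  by (simp_all add: field_simps)

lemma skew_inverse: "\<epsilon> h g = inverse (\<epsilon> g h)"
  using skew[of g h] nonzero[of g h] by (simp add: field_simps)

lemma self_cases: "\<epsilon> g g = 1 \<or> \<epsilon> g g = - 1"
  using skew[of g g] by (simp add: square_eq_1_iff)

text \<open>The mixed factors \<open>\<epsilon> g h\<close> and \<open>\<epsilon> h g\<close> cancel
  by skew symmetry, leaving the product of two signs.\<close>

lemma pair_plus: "\<epsilon> g g = - 1 \<Longrightarrow> \<epsilon> h h = - 1 \<Longrightarrow> \<epsilon> (g + h) (g + h) = 1"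
  using skew[of g h] by (simp add: add_left add_right mult.commute)

text \<open>The degrees g and h are carried as labels, because the operators themselves are not
  given a grading.\<close>

definition color_comm where
  "color_comm g h S T \<longleftrightarrow> S * T = \<epsilon> g h *\<^sub>o (T * S)"

lemma color_comm_sym: "color_comm g h S T \<Longrightarrow> color_comm h g T S"
  using skew[of h g] by (simp add: color_comm_def op_smult_simps)

lemma color_comm_mult_right: "color_comm g h S T \<Longrightarrow> color_comm g h' S T' \<Longrightarrow> color_comm g (h + h') S (T * T')"
proof -
  assume T: "color_comm g h S T" and T': "color_comm g h' S T'"
  have "S * (T * T') = (S * T) * T'" by (simp add: mult.assoc)
  also have "\<dots> = \<epsilon> g h *\<^sub>o (T * (S * T'))"
    using T by (simp add: color_comm_def op_smult_simps mult.assoc)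
  also have "\<dots> = \<epsilon> g (h + h') *\<^sub>o (T * T' * S)"
    using T' by (simp add: color_comm_def op_smult_simps mult.assoc add_right)
  finally show ?thesis by (simp add: color_comm_def)
qed

lemma color_comm_mult_left: "color_comm g h S T \<Longrightarrow> color_comm g' h S' T \<Longrightarrow> color_comm (g + g') h (S * S') T"
  using color_comm_mult_right color_comm_sym by metis

lemma color_comm_add_right: "color_comm g h S T \<Longrightarrow> color_comm g h S T' \<Longrightarrow> color_comm g h S (T + T')"
  and color_comm_smult_right: "color_comm g h S T \<Longrightarrow> color_comm g h S (c *\<^sub>o T)"
  and color_comm_zero_right: "color_comm g h S 0"
  by (simp_all add: color_comm_def algebra_simps op_smult_simps)

lemma color_comm_sum_right: "(\<And>i. i \<in> A \<Longrightarrow> color_comm g h S (T i)) \<Longrightarrow> color_comm g h S (\<Sum>i\<in>A. T i)"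
  by (induction A rule: infinite_finite_induct) (auto simp: color_comm_add_right color_comm_zero_right)

end

section \<open>Multiplication and derivation operators on color polynomials\<close>

definition weight :: "(nat \<Rightarrow> 'g::ab_group_add) \<Rightarrow> nat \<Rightarrow> (nat \<Rightarrow> nat) \<Rightarrow> 'g" where
  "weight d s \<alpha> = (\<Sum>r<s. \<Sum>k<\<alpha> r. d r)"

lemma weight_upd_ge: "s \<le> r \<Longrightarrow> weight d s (\<alpha>(r := x)) = weight d s \<alpha>"
  unfolding weight_def by (intro sum.cong) auto

lemma weight_upd_less:
  assumes "r < s"
  shows "weight d s (\<alpha>(r := Suc x)) = weight d s (\<alpha>(r := x)) + d r"
proof -
  have "weight d s (\<alpha>(r := y)) = (\<Sum>q\<in>{..<s} - {r}. \<Sum>k<\<alpha> q. d q) + (\<Sum>k<y. d r)" for y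
    unfolding weight_def using assms
    by (subst sum.remove[of _ r]) (auto intro!: sum.cong)
  then show ?thesis by (simp add: add.assoc)
qed

text \<open>A function f is read as the polynomial with coefficients \<open>f \<alpha>\<close> in
  ordered variables z_s; this is left multiplication by z_s. Bringing z_s to its place past the
  lower variables costs the value of \<epsilon> at its degree and the degree of the part before it,
  which is \<open>weight d s \<alpha>\<close>. The inner sum in \<open>weight\<close> stands for a
  natural multiple in G.\<close>

lift_definition mult_op :: "('g::ab_group_add \<Rightarrow> 'g \<Rightarrow> 'k::field) \<Rightarrow> (nat \<Rightarrow> 'g) \<Rightarrow> nat \<Rightarrow> (nat \<Rightarrow> nat, 'k) lin_op"
  is "\<lambda>\<epsilon> d s f \<alpha>. if \<alpha> s = 0 then 0 else \<epsilon> (d s) (weight d s \<alpha>) * f (\<alpha>(s := \<alpha> s - 1))"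
  by (auto simp: algebra_simps)

text \<open>For an odd variable this is the derivation of degree \<open>- d s\<close> with value 1
  on z_s. By the sign rule it sends an odd power of z_s to the power below and kills even powers, so
  the result can be nonzero only where \<open>\<alpha> s\<close> is even.\<close>

lift_definition deriv_op :: "('g::ab_group_add \<Rightarrow> 'g \<Rightarrow> 'k::field) \<Rightarrow> (nat \<Rightarrow> 'g) \<Rightarrow> nat \<Rightarrow> (nat \<Rightarrow> nat, 'k) lin_op"
  is "\<lambda>\<epsilon> d s f \<alpha>. if odd (\<alpha> s) then 0 else \<epsilon> (- d s) (weight d s \<alpha>) * f (\<alpha>(s := Suc (\<alpha> s)))"
  by (auto simp: algebra_simps)

lemma lin_op_eqI: "(\<And>f x. Rep_lin_op S f x = Rep_lin_op T f x) \<Longrightarrow> S = T"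
  by (metis Rep_lin_op_inject ext)

context skew_bicharacter
begin

lemma mult_op_comm_less:
  assumes "r < s"
  shows "color_comm (d s) (d r) (mult_op \<epsilon> d s) (mult_op \<epsilon> d r)"
  unfolding color_comm_def
proof (rule lin_op_eqI)
  fix f :: "(nat \<Rightarrow> nat) \<Rightarrow> 'k" and \<alpha>
  \<comment> \<open>The weight below s sees the exponent of r, but not conversely; removing one z_r
    changes it by \<open>d r\<close>, and this produces the factor \<epsilon>.\<close>
  have *: "\<alpha> r \<noteq> 0 \<Longrightarrow> weight d s \<alpha> = weight d s (\<alpha>(r := \<alpha> r - 1)) + d r"
    using weight_upd_less[OF assms, of d \<alpha> "\<alpha> r - 1"] by simp
  show "Rep_lin_op (mult_op \<epsilon> d s * mult_op \<epsilon> d r) f \<alpha> =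
      Rep_lin_op (\<epsilon> (d s) (d r) *\<^sub>o (mult_op \<epsilon> d r * mult_op \<epsilon> d s)) f \<alpha>"
    using assms * by (auto simp: Rep_lin_op_simps mult_op.rep_eq weight_upd_ge add_right fun_upd_twist mult_ac)
qed

lemma mult_op_comm: "s \<noteq> r \<Longrightarrow> color_comm (d s) (d r) (mult_op \<epsilon> d s) (mult_op \<epsilon> d r)"
  using mult_op_comm_less[of r s d] mult_op_comm_less[of s r d] color_comm_sym
  by (cases "r < s") (auto simp: not_less_iff_gr_or_eq)

lemma deriv_op_comm_less:
  assumes "r < s"
  shows "color_comm (- d s) (- d r) (deriv_op \<epsilon> d s) (deriv_op \<epsilon> d r)"
  unfolding color_comm_def
proof (rule lin_op_eqI)
  fix f :: "(nat \<Rightarrow> nat) \<Rightarrow> 'k" and \<alpha>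
  have *: "weight d s (\<alpha>(r := Suc (\<alpha> r))) = weight d s \<alpha> + d r"
    using weight_upd_less[OF assms, of d \<alpha> "\<alpha> r"] by simp
  show "Rep_lin_op (deriv_op \<epsilon> d s * deriv_op \<epsilon> d r) f \<alpha> =
      Rep_lin_op (\<epsilon> (- d s) (- d r) *\<^sub>o (deriv_op \<epsilon> d r * deriv_op \<epsilon> d s)) f \<alpha>"
    using assms nonzero
    by (auto simp: Rep_lin_op_simps deriv_op.rep_eq weight_upd_ge * add_right add_left minus_left minus_right
        fun_upd_twist mult_ac)
qed

lemma deriv_op_comm: "s \<noteq> r \<Longrightarrow> color_comm (- d s) (- d r) (deriv_op \<epsilon> d s) (deriv_op \<epsilon> d r)"
  using deriv_op_comm_less[of r s d] deriv_op_comm_less[of s r d] color_comm_sym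
  by (cases "r < s") (auto simp: not_less_iff_gr_or_eq)

lemma deriv_op_square: "deriv_op \<epsilon> d s * deriv_op \<epsilon> d s = 0"
  by (rule lin_op_eqI) (simp add: Rep_lin_op_simps deriv_op.rep_eq)

lemma deriv_mult_op_comm:
  assumes "s \<noteq> r"
  shows "color_comm (- d s) (d r) (deriv_op \<epsilon> d s) (mult_op \<epsilon> d r)"
  unfolding color_comm_def
proof (rule lin_op_eqI)
  fix f :: "(nat \<Rightarrow> nat) \<Rightarrow> 'k" and \<alpha>
  consider "r < s" | "s < r" using assms by linarith
  then show "Rep_lin_op (deriv_op \<epsilon> d s * mult_op \<epsilon> d r) f \<alpha> =
      Rep_lin_op (\<epsilon> (- d s) (d r) *\<^sub>o (mult_op \<epsilon> d r * deriv_op \<epsilon> d s)) f \<alpha>"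
  proof cases
    case 1
    have *: "\<alpha> r \<noteq> 0 \<Longrightarrow> weight d s \<alpha> = weight d s (\<alpha>(r := \<alpha> r - 1)) + d r"
      using weight_upd_less[OF 1, of d \<alpha> "\<alpha> r - 1"] by simp
    show ?thesis using 1 *
      by (auto simp: Rep_lin_op_simps deriv_op.rep_eq mult_op.rep_eq weight_upd_ge add_right fun_upd_twist mult_ac)
  next
    case 2
    have *: "weight d r (\<alpha>(s := Suc (\<alpha> s))) = weight d r \<alpha> + d s"
      using weight_upd_less[OF 2, of d \<alpha> "\<alpha> s"] by simp
    have **: "\<epsilon> (- d s) (d r) = \<epsilon> (d r) (d s)"
      using skew_inverse[of "d s" "d r"] minus_left by simp
    show ?thesis using 2 **
      by (auto simp: Rep_lin_op_simps deriv_op.rep_eq mult_op.rep_eq weight_upd_ge * add_right fun_upd_twist mult_ac)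
  qed
qed

text \<open>For each parity of \<open>\<alpha> s\<close> exactly one of the two summands survives,
  and its two color factors are inverse to each other.\<close>

lemma deriv_mult_op_self:
  "deriv_op \<epsilon> d s * mult_op \<epsilon> d s + mult_op \<epsilon> d s * deriv_op \<epsilon> d s = 1"
proof (rule lin_op_eqI)
  fix f :: "(nat \<Rightarrow> nat) \<Rightarrow> 'k" and \<alpha>
  show "Rep_lin_op (deriv_op \<epsilon> d s * mult_op \<epsilon> d s + mult_op \<epsilon> d s * deriv_op \<epsilon> d s) f \<alpha> = Rep_lin_op 1 f \<alpha>"
    using nonzero[of "d s" "weight d s \<alpha>"] fun_upd_idem[of \<alpha> s 0]
    by (auto simp: Rep_lin_op_simps deriv_op.rep_eq mult_op.rep_eq weight_upd_ge minus_left)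
qed

end

section \<open>The triangular numbering of pairs\<close>

lemma triangle_Suc: "Suc j * (Suc j - 1) div 2 = j * (j - 1) div 2 + j"
proof -
  have "Suc j * (Suc j - 1) = j * (j - 1) + 2 * j" by (cases j) auto
  then show ?thesis by simp
qed

text \<open>Pairs are numbered column by column, column j filling the j numbers after j (j - 1) / 2,
  and the diagonal pair is the last of its column. Thus x_j comes directly after the brackets
  [x_i, x_j] with i < j.\<close>

lemma pair_index_less:
  assumes "i \<le> j" "j < j'" "1 \<le> i'"
  shows "pair_index i j < pair_index i' j'"
proof -
  have "Suc j * (Suc j - 1) div 2 \<le> j' * (j' - 1) div 2"
    using assms by (intro div_le_mono mult_le_mono) auto
  then show ?thesis using assms by (simp only: triangle_Suc pair_index_def)
qed

lemma pair_index_eq_iff: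
  assumes "1 \<le> i" "i \<le> j" "1 \<le> i'" "i' \<le> j'"
  shows "pair_index i j = pair_index i' j' \<longleftrightarrow> i = i' \<and> j = j'"
proof -
  consider "j < j'" | "j' < j" | "j = j'" by linarith
  then show ?thesis
    by cases (use pair_index_less[of i j j' i'] pair_index_less[of i' j' j i] assms in
      \<open>auto simp: pair_index_def\<close>)
qed

lemma pair_index_image:
  "(\<lambda>(i, j). pair_index i j) ` {(i, j). 1 \<le> i \<and> i \<le> j \<and> j \<le> m} = {1..m * (m + 1) div 2}"
proof (induction m)
  case 0
  then show ?case by auto
next
  case (Suc m)
  have tri: "Suc m * (Suc m + 1) div 2 = m * (m + 1) div 2 + Suc m"
    using triangle_Suc[of "Suc m"] by (simp add: algebra_simps)
  have "{(i, j). 1 \<le> i \<and> i \<le> j \<and> j \<le> Suc m} =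
      {(i, j). 1 \<le> i \<and> i \<le> j \<and> j \<le> m} \<union> (\<lambda>i. (i, Suc m)) ` {1..Suc m}"
    by (auto simp: le_Suc_eq)
  moreover have "(\<lambda>(i, j). pair_index i j) ` (\<lambda>i. (i, Suc m)) ` {1..Suc m} =
      (\<lambda>i. m * (m + 1) div 2 + i) ` {1..Suc m}"
    unfolding image_image by (intro image_cong) (auto simp: pair_index_def mult.commute)
  ultimately have "(\<lambda>(i, j). pair_index i j) ` {(i, j). 1 \<le> i \<and> i \<le> j \<and> j \<le> Suc m} =
      {1..m * (m + 1) div 2} \<union> {m * (m + 1) div 2 + 1..m * (m + 1) div 2 + Suc m}"
    using Suc by (simp add: image_Un image_add_atLeastAtMost add.commute)
  also have "\<dots> = {1..m * (m + 1) div 2 + Suc m}" by auto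
  finally show ?case using tri by simp
qed

lemma pair_index_bij:
  "bij_betw (\<lambda>(i, j). pair_index i j) {(i, j). 1 \<le> i \<and> i \<le> j \<and> j \<le> m} {1..m * (m + 1) div 2}"
  unfolding bij_betw_def pair_index_image by (auto simp: inj_on_def pair_index_eq_iff)

section \<open>Operators for the generators of a generic algebra\<close>

locale generic_ops = skew_bicharacter \<epsilon> for \<epsilon> :: "'g::ab_group_add \<Rightarrow> 'g \<Rightarrow> 'k::field" +
  fixes gx d :: "nat \<Rightarrow> 'g" and m :: nat
  assumes gx_odd: "i \<in> {1..m} \<Longrightarrow> \<epsilon> (gx i) (gx i) = - 1"
    and d_pair: "\<lbrakk>1 \<le> i; i \<le> j; j \<le> m\<rbrakk> \<Longrightarrow> d (pair_index i j) = (if i = j then gx j else gx i + gx j)"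
begin

definition M where "M j = mult_op \<epsilon> d (pair_index j j)"
definition Y where "Y i j = mult_op \<epsilon> d (pair_index i j)"
definition D where "D j = deriv_op \<epsilon> d (pair_index j j)"
definition Q where "Q i j = Y i j * D i"
text \<open>The coefficients are forced: moving \<open>Q i j\<close> past \<open>M i\<close> leaves
  one copy of \<open>Y i j\<close>, and the value \<open>- \<epsilon> (gx j) (gx i)\<close> is the
  one for which the color commutator of \<open>X i\<close> and \<open>X j\<close> contains
  \<open>Y i j\<close> with coefficient 1. \<open>Q i j\<close> has degree \<open>gx j\<close>, so
  all summands of \<open>X j\<close> have the same degree.\<close>

definition X where "X j = M j + (\<Sum>i\<in>{1..<j}. (- \<epsilon> (gx j) (gx i)) *\<^sub>o Q i j)"

lemma Y_M:
  assumes "1 \<le> i" "i < j" "j \<le> m" "l \<in> {1..m}"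
  shows "color_comm (gx i + gx j) (gx l) (Y i j) (M l)"
  using mult_op_comm[of "pair_index i j" "pair_index l l" d] assms
  by (simp add: Y_def M_def pair_index_eq_iff d_pair)

lemma Y_D:
  assumes "1 \<le> i" "i < j" "j \<le> m" "l \<in> {1..m}"
  shows "color_comm (gx i + gx j) (- gx l) (Y i j) (D l)"
  using deriv_mult_op_comm[of "pair_index l l" "pair_index i j" d, THEN color_comm_sym] assms
  by (simp add: Y_def D_def pair_index_eq_iff d_pair)

text \<open>Distinct brackets are multiplications by different variables; for equal ones the degree
  is even, so the scalar is 1.\<close>

lemma Y_Y:
  assumes "1 \<le> i" "i < j" "j \<le> m" "1 \<le> i'" "i' < j'" "j' \<le> m"
  shows "color_comm (gx i + gx j) (gx i' + gx j') (Y i j) (Y i' j')"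
proof (cases "i = i' \<and> j = j'")
  case True
  then show ?thesis using assms pair_plus[OF gx_odd gx_odd, of i j]
    by (simp add: color_comm_def op_smult_simps)
next
  case False
  then show ?thesis using mult_op_comm[of "pair_index i j" "pair_index i' j'" d] assms
    by (simp add: Y_def pair_index_eq_iff d_pair)
qed

lemma Y_Q:
  assumes "1 \<le> i" "i < j" "j \<le> m" "1 \<le> a" "a < l" "l \<le> m"
  shows "color_comm (gx i + gx j) (gx l) (Y i j) (Q a l)"
  using color_comm_mult_right[OF Y_Y[OF assms] Y_D[OF assms(1-3), of a]] assms
  by (simp add: Q_def)

lemma Y_X:
  assumes "1 \<le> i" "i < j" "j \<le> m" "l \<in> {1..m}"
  shows "color_comm (gx i + gx j) (gx l) (Y i j) (X l)"
  unfolding X_def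
  by (intro color_comm_add_right color_comm_sum_right color_comm_smult_right Y_M[OF assms] Y_Q)
    (use assms in auto)

lemma M_M: "i \<in> {1..m} \<Longrightarrow> j \<in> {1..m} \<Longrightarrow> i \<noteq> j \<Longrightarrow> color_comm (gx j) (gx i) (M j) (M i)"
  using mult_op_comm[of "pair_index j j" "pair_index i i" d]
  by (simp add: M_def pair_index_eq_iff d_pair)

lemma D_M: "i \<in> {1..m} \<Longrightarrow> j \<in> {1..m} \<Longrightarrow> i \<noteq> j \<Longrightarrow> color_comm (- gx j) (gx i) (D j) (M i)"
  using deriv_mult_op_comm[of "pair_index j j" "pair_index i i" d]
  by (simp add: M_def D_def pair_index_eq_iff d_pair)

lemma D_D: "i \<in> {1..m} \<Longrightarrow> j \<in> {1..m} \<Longrightarrow> i \<noteq> j \<Longrightarrow> color_comm (- gx j) (- gx i) (D j) (D i)"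
  using deriv_op_comm[of "pair_index j j" "pair_index i i" d]
  by (simp add: D_def pair_index_eq_iff d_pair)

lemma Q_M:
  assumes "1 \<le> a" "a < j" "j \<le> m" "i \<in> {1..m}" "a \<noteq> i"
  shows "color_comm (gx j) (gx i) (Q a j) (M i)"
  using color_comm_mult_left[OF Y_M[OF assms(1-4)] D_M[of i a]] assms
  by (simp add: Q_def)

lemma Q_D:
  assumes "1 \<le> a" "a < j" "j \<le> m" "i \<in> {1..m}" "a \<noteq> i"
  shows "color_comm (gx j) (- gx i) (Q a j) (D i)"
  using color_comm_mult_left[OF Y_D[OF assms(1-4)] D_D[of i a]] assms
  by (simp add: Q_def)

text \<open>The relation between multiplication and derivation in the same variable yields the extra
  \<open>Y i j\<close>; the sign that it leaves behind is absorbed by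
  \<open>\<epsilon> (gx i) (gx i) = - 1\<close>.\<close>

lemma Q_M_self:
  assumes "1 \<le> i" "i < j" "j \<le> m"
  shows "Q i j * M i = Y i j + \<epsilon> (gx j) (gx i) *\<^sub>o (M i * Q i j)"
proof -
  have "D i * M i = 1 - M i * D i"
    using deriv_mult_op_self[of d "pair_index i i"] by (simp add: D_def M_def algebra_simps)
  then have "Q i j * M i = Y i j - (Y i j * M i) * D i"
    by (simp add: Q_def mult.assoc right_diff_distrib)
  also have "Y i j * M i = \<epsilon> (gx i + gx j) (gx i) *\<^sub>o (M i * Y i j)"
    using Y_M[OF assms, of i] assms by (simp add: color_comm_def)
  also have "\<epsilon> (gx i + gx j) (gx i) = - \<epsilon> (gx j) (gx i)"
    using gx_odd[of i] assms by (simp add: add_left)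
  finally show ?thesis by (simp add: op_smult_simps Q_def mult.assoc)
qed

text \<open>With different derivations the factors color commute one by one. With the same
  derivation both products vanish, because its square is zero.\<close>

lemma Q_Q:
  assumes "1 \<le> a" "a < j" "j \<le> m" "1 \<le> b" "b < i" "i \<le> m"
  shows "color_comm (gx j) (gx i) (Q a j) (Q b i)"
proof (cases "a = b")
  case False
  have "color_comm (gx j) (gx b + gx i) (Q a j) (Y b i)"
    using Y_Q[OF assms(4-6) assms(1-3)] color_comm_sym by blast
  moreover have "color_comm (gx j) (- gx b) (Q a j) (D b)"
    using Q_D[OF assms(1-3), of b] False assms by simp
  ultimately show ?thesis
    using color_comm_mult_right by (fastforce simp: Q_def)
next
  case True
  have QQ: "Q a l * Q a l' = 0" if "a < l" "a < l'" "l \<le> m" "l' \<le> m" for l l'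
  proof -
    have "color_comm (gx a + gx l') (- gx a) (Y a l') (D a)"
      using Y_D[of a l' a] that assms by auto
    then obtain c where c: "D a * Y a l' = c *\<^sub>o (Y a l' * D a)"
      using color_comm_sym unfolding color_comm_def by blast
    have "Q a l * Q a l' = Y a l * (D a * Y a l') * D a"
      by (simp add: Q_def mult.assoc)
    also have "\<dots> = c *\<^sub>o (Y a l * Y a l' * (D a * D a))"
      unfolding c by (simp add: op_smult_simps mult.assoc)
    finally show ?thesis by (simp add: D_def deriv_op_square op_smult_simps)
  qed
  show ?thesis using True assms QQ[of j i] QQ[of i j] by (simp add: color_comm_def op_smult_simps)
qed

text \<open>All pairs of summands of \<open>X j\<close> and \<open>X i\<close> color commute except
  \<open>Q i j\<close> with \<open>M i\<close>; P is the part of \<open>X j\<close> without that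
  exceptional summand.\<close>

lemma X_X:
  assumes "1 \<le> i" "i < j" "j \<le> m"
  shows "X j * X i = \<epsilon> (gx j) (gx i) *\<^sub>o (X i * X j) - \<epsilon> (gx j) (gx i) *\<^sub>o Y i j"
proof -
  define P where "P = M j + (\<Sum>a\<in>{1..<j} - {i}. (- \<epsilon> (gx j) (gx a)) *\<^sub>o Q a j)"
  define S where "S = (\<Sum>b\<in>{1..<i}. (- \<epsilon> (gx i) (gx b)) *\<^sub>o Q b i)"
  define e where "e = \<epsilon> (gx j) (gx i)"
  have Xj: "X j = P - e *\<^sub>o Q i j"
    unfolding X_def P_def e_def using assms
    by (subst sum.remove[of "{1..<j}" i]) (auto simp: op_smult_simps)
  have Xi: "X i = M i + S" by (simp add: X_def S_def)
  have S: "color_comm (gx i) (gx j) S (M j)" "\<And>a. 1 \<le> a \<Longrightarrow> a < j \<Longrightarrow> color_comm (gx i) (gx j) S (Q a j)"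
    unfolding S_def
    by (rule color_comm_sym, intro color_comm_sum_right color_comm_smult_right,
        (rule color_comm_sym[OF Q_M] | rule Q_Q); use assms in auto)+
  have "color_comm (gx i) (gx j) (X i) P"
    unfolding P_def
  proof (intro color_comm_add_right color_comm_sum_right color_comm_smult_right)
    show "color_comm (gx i) (gx j) (X i) (M j)"
      unfolding Xi by (rule color_comm_sym, intro color_comm_add_right color_comm_sym[OF S(1)] M_M) (use assms in auto)
    fix a assume a: "a \<in> {1..<j} - {i}"
    show "color_comm (gx i) (gx j) (X i) (Q a j)"
      unfolding Xi by (rule color_comm_sym, intro color_comm_add_right color_comm_sym[OF S(2)] Q_M) (use assms a in auto)
  qed
  then have P: "P * X i = e *\<^sub>o (X i * P)"
    using color_comm_sym unfolding color_comm_def e_def by blast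
  have "Q i j * S = e *\<^sub>o (S * Q i j)"
    using color_comm_sym[OF S(2)[of i]] assms unfolding color_comm_def e_def by simp
  then have Q: "Q i j * X i = Y i j + e *\<^sub>o (X i * Q i j)"
    using Q_M_self[OF assms] by (simp add: Xi algebra_simps op_smult_simps e_def)
  have "X j * X i = P * X i - e *\<^sub>o (Q i j * X i)"
    by (simp add: Xj algebra_simps op_smult_simps)
  also have "\<dots> = e *\<^sub>o (X i * X j) - e *\<^sub>o Y i j"
  proof -
    have minus: "e *\<^sub>o (A - B) = e *\<^sub>o A - e *\<^sub>o B" for A B :: "(nat \<Rightarrow> nat, 'k) lin_op"
      using op_smult_simps(7)[of e A "- B"] by (simp add: op_smult_simps)
    show ?thesis unfolding P Q by (simp add: Xj algebra_simps op_smult_simps minus)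
  qed
  finally show ?thesis by (simp add: e_def)
qed

lemma X_X':
  assumes "1 \<le> i" "i < j" "j \<le> m"
  shows "X i * X j = \<epsilon> (gx i) (gx j) *\<^sub>o (X j * X i) + Y i j"
proof -
  have minus: "e *\<^sub>o (A - B) = e *\<^sub>o A - e *\<^sub>o B" for e and A B :: "(nat \<Rightarrow> nat, 'k) lin_op"
    using op_smult_simps(7)[of e A "- B"] by (simp add: op_smult_simps)
  show ?thesis unfolding X_X[OF assms] by (simp add: minus op_smult_simps skew)
qed

text \<open>Needed because [x_j, x_j] = 2 x_j^2 has to be represented by a color central operator.
  Moving \<open>X j\<close> past \<open>X l\<close> twice gives two corrections, which cancel since
  \<open>\<epsilon> (gx j) (gx j) = - 1\<close>.\<close>

lemma X_square_X:
  assumes "j \<in> {1..m}" "l \<in> {1..m}"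
  shows "color_comm (gx j + gx j) (gx l) (X j * X j) (X l)"
proof (cases "j = l")
  case True
  then show ?thesis using gx_odd[OF assms(1)]
    by (simp add: color_comm_def add_left op_smult_simps mult.assoc)
next
  case False
  \<comment> \<open>In either order of j and l the correction is a multiple of a bracket operator;
    what matters below is how it color commutes with \<open>X j\<close>.\<close>
  obtain c Z where c: "X j * X l = \<epsilon> (gx j) (gx l) *\<^sub>o (X l * X j) + c *\<^sub>o Z"
    and Z: "color_comm (gx j + gx l) (gx j) Z (X j)"
  proof (cases "j < l")
    case True
    then show ?thesis
      using that[of 1 "Y j l"] X_X'[of j l] Y_X[of j l j] assms by (auto simp: op_smult_simps)
  next
    case f: False
    then show ?thesis
      using that[of "- \<epsilon> (gx j) (gx l)" "Y l j"] X_X[of l j] Y_X[of l j j] assms False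
      by (auto simp: op_smult_simps add.commute)
  qed
  let ?e = "\<epsilon> (gx j) (gx l)"
  have "X j * Z = \<epsilon> (gx j) (gx j + gx l) *\<^sub>o (Z * X j)"
    using color_comm_sym[OF Z] by (simp add: color_comm_def)
  then have XZ: "X j * Z = - (?e *\<^sub>o (Z * X j))"
    using gx_odd[OF assms(1)] by (simp add: add_right op_smult_simps)
  have "X j * X j * X l = X j * (?e *\<^sub>o (X l * X j) + c *\<^sub>o Z)"
    by (simp only: mult.assoc[of "X j" "X j"] c)
  also have "\<dots> = ?e *\<^sub>o ((X j * X l) * X j) + c *\<^sub>o (X j * Z)"
    by (simp only: distrib_left op_smult_simps mult.assoc)
  also have "\<dots> = (?e * ?e) *\<^sub>o (X l * (X j * X j))"
  proof -
    have "(X j * X l) * X j = ?e *\<^sub>o (X l * (X j * X j)) + c *\<^sub>o (Z * X j)"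
      by (simp only: c distrib_right op_smult_simps mult.assoc)
    then show ?thesis unfolding XZ by (simp only: op_smult_simps) (simp add: mult.commute)
  qed
  finally show ?thesis by (simp add: color_comm_def add_left)
qed

text \<open>The images of the basis: the index \<open>(0, j)\<close> stands for \<open>x\<^sub>j\<close> and \<open>(i, j)\<close> with
  \<open>i \<noteq> 0\<close> for the bracket of \<open>x\<^sub>i\<close> and \<open>x\<^sub>j\<close>.\<close>

definition basis_op :: "nat \<times> nat \<Rightarrow> (nat \<Rightarrow> nat, 'k) lin_op" where
  "basis_op = (\<lambda>(i, j). if i = 0 then X j else if i = j then 2 *\<^sub>o (X j * X j) else Y i j)"

lemma basis_op_X:
  assumes "1 \<le> i" "i \<le> j" "j \<le> m" "l \<in> {1..m}"
  shows "color_comm (gx i + gx j) (gx l) (basis_op (i, j)) (X l)"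
proof (cases "i = j")
  case True
  then show ?thesis
    using assms color_comm_sym[OF color_comm_smult_right[OF color_comm_sym[OF X_square_X[of j l]]]]
    by (auto simp: basis_op_def)
next
  case False
  then show ?thesis using assms Y_X[of i j l] by (auto simp: basis_op_def)
qed

lemma basis_op_basis_op:
  assumes "1 \<le> i" "i \<le> j" "j \<le> m" "1 \<le> i'" "i' \<le> j'" "j' \<le> m"
  shows "color_comm (gx i + gx j) (gx i' + gx j') (basis_op (i, j)) (basis_op (i', j'))"
proof -
  have square: "color_comm (gx a + gx b) (gx l + gx l) (basis_op (a, b)) (basis_op (l, l))"
    if "1 \<le> a" "a \<le> b" "b \<le> m" "l \<in> {1..m}" for a b l
    using color_comm_mult_right[OF basis_op_X[OF that] basis_op_X[OF that]] that
    by (auto simp: basis_op_def[of] intro!: color_comm_smult_right split: if_splits)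
  consider "i' = j'" | "i = j" | "i < j" "i' < j'" using assms by linarith
  then show ?thesis
    using square[of i j j'] color_comm_sym[OF square[of i' j' j]] assms Y_Y[of i j i' j']
    by cases (auto simp: basis_op_def)
qed

end

section \<open>Finite linear combinations\<close>

locale kvec =
  fixes V :: "('k::field, 'v, 'c) module_scheme" (structure)
  assumes vectorspace_V: "vectorspace class_ring V"
begin

sublocale abelian_group V
proof -
  interpret vs: vectorspace class_ring V by (rule vectorspace_V)
  show "abelian_group V" by (rule vs.M.abelian_group_axioms)
qed

lemma vec_smult_closed [simp, intro]: "v \<in> carrier V \<Longrightarrow> c \<odot> v \<in> carrier V"
  and vec_smult_add_left: "v \<in> carrier V \<Longrightarrow> (c + c') \<odot> v = c \<odot> v \<oplus> c' \<odot> v"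
  and vec_smult_add_right: "v \<in> carrier V \<Longrightarrow> w \<in> carrier V \<Longrightarrow> c \<odot> (v \<oplus> w) = c \<odot> v \<oplus> c \<odot> w"
  and vec_smult_smult: "v \<in> carrier V \<Longrightarrow> c \<odot> (c' \<odot> v) = (c * c') \<odot> v"
  and vec_smult_one [simp]: "v \<in> carrier V \<Longrightarrow> 1 \<odot> v = v"
proof -
  interpret vs: vectorspace class_ring V by (rule vectorspace_V)
  show "v \<in> carrier V \<Longrightarrow> c \<odot> v \<in> carrier V"
    "v \<in> carrier V \<Longrightarrow> (c + c') \<odot> v = c \<odot> v \<oplus> c' \<odot> v"
    "v \<in> carrier V \<Longrightarrow> w \<in> carrier V \<Longrightarrow> c \<odot> (v \<oplus> w) = c \<odot> v \<oplus> c \<odot> w"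
    "v \<in> carrier V \<Longrightarrow> c \<odot> (c' \<odot> v) = (c * c') \<odot> v"
    "v \<in> carrier V \<Longrightarrow> 1 \<odot> v = v"
  using vs.smult_closed[of c v] vs.smult_l_distr[of c c' v] vs.smult_r_distr[of c v w]
    vs.smult_assoc1[of c c' v] vs.smult_one[of v]
  by (simp_all add: class_ring_simps)
qed

lemma vec_smult_zero_left [simp]: "v \<in> carrier V \<Longrightarrow> 0 \<odot> v = \<zero>"
  using vec_smult_add_left[of v 0 0] by (metis add.l_cancel_one add_0 vec_smult_closed)

lemma vec_smult_zero_right [simp]: "c \<odot> \<zero> = \<zero>"
  using vec_smult_add_right[of \<zero> \<zero> c] by (metis add.l_cancel_one l_zero vec_smult_closed zero_closed)

lemma vec_minus_eq: "v \<in> carrier V \<Longrightarrow> \<ominus> v = (- 1) \<odot> v"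
  using vec_smult_add_left[of v 1 "- 1"] by (simp add: minus_equality a_comm)

text \<open>Combinations are taken over indexed families rather than sets of vectors, since the
  families below are indexed by numbers, pairs and exponents.\<close>

definition comb :: "'i set \<Rightarrow> ('i \<Rightarrow> 'v) \<Rightarrow> ('i \<Rightarrow> 'k) \<Rightarrow> 'v" where
  "comb J b c = (\<Oplus>j\<in>J. c j \<odot> b j)"

definition indep :: "'i set \<Rightarrow> ('i \<Rightarrow> 'v) \<Rightarrow> bool" where
  "indep J b \<longleftrightarrow> (\<forall>c. comb J b c = \<zero> \<longrightarrow> (\<forall>j\<in>J. c j = 0))"

lemma comb_closed [simp, intro]: "b \<in> J \<rightarrow> carrier V \<Longrightarrow> comb J b c \<in> carrier V"
  unfolding comb_def by (rule finsum_closed) auto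

lemma comb_empty [simp]: "comb {} b c = \<zero>"
  by (simp add: comb_def)

lemma comb_insert:
  "finite J \<Longrightarrow> j \<notin> J \<Longrightarrow> b \<in> insert j J \<rightarrow> carrier V \<Longrightarrow> comb (insert j J) b c = c j \<odot> b j \<oplus> comb J b c"
  unfolding comb_def by (subst finsum_insert) auto

lemma comb_cong:
  "b \<in> J \<rightarrow> carrier V \<Longrightarrow> (\<And>j. j \<in> J \<Longrightarrow> c j = c' j) \<Longrightarrow> comb J b c = comb J b c'"
  unfolding comb_def by (rule finsum_cong') auto

lemma comb_zero: "b \<in> J \<rightarrow> carrier V \<Longrightarrow> (\<And>j. j \<in> J \<Longrightarrow> c j = 0) \<Longrightarrow> comb J b c = \<zero>"
  unfolding comb_def by (rule add.finprod_one_eqI) (auto simp: Pi_iff)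

lemma comb_add:
  assumes "b \<in> J \<rightarrow> carrier V"
  shows "comb J b (\<lambda>j. c j + c' j) = comb J b c \<oplus> comb J b c'"
proof -
  have "comb J b (\<lambda>j. c j + c' j) = (\<Oplus>j\<in>J. c j \<odot> b j \<oplus> c' j \<odot> b j)"
    unfolding comb_def by (rule finsum_cong') (use assms in \<open>auto simp: vec_smult_add_left Pi_iff\<close>)
  also have "\<dots> = comb J b c \<oplus> comb J b c'"
    unfolding comb_def by (rule finsum_addf) (use assms in auto)
  finally show ?thesis .
qed

lemma comb_smult:
  assumes "finite J" "b \<in> J \<rightarrow> carrier V"
  shows "comb J b (\<lambda>j. a * c j) = a \<odot> comb J b c"
  using assms
proof (induction J)
  case (insert j J)
  then have "b j \<in> carrier V" "b \<in> J \<rightarrow> carrier V" by auto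
  then show ?case using insert by (simp add: comb_insert vec_smult_add_right vec_smult_smult)
qed simp

lemma comb_superset:
  assumes "finite J'" "J \<subseteq> J'" "b \<in> J' \<rightarrow> carrier V" "\<And>j. j \<in> J' - J \<Longrightarrow> c j = 0"
  shows "comb J b c = comb J' b c"
  unfolding comb_def by (rule add.finprod_mono_neutral_cong_left) (use assms in \<open>auto simp: Pi_iff subset_iff\<close>)

lemma comb_single:
  assumes "finite J" "b \<in> J \<rightarrow> carrier V" "j \<in> J"
  shows "comb J b (\<lambda>i. if i = j then c else 0) = c \<odot> b j"
proof -
  have "comb {j} b (\<lambda>i. if i = j then c else 0) = comb J b (\<lambda>i. if i = j then c else 0)"
    by (rule comb_superset) (use assms in auto)
  then show ?thesis using assms by (auto simp: comb_insert Pi_iff)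
qed

text \<open>Serves as an induction principle for linear combinations, with W the set of vectors that
  have the property in question.\<close>

lemma comb_in_subset:
  assumes "finite J" "b \<in> J \<rightarrow> carrier V" "\<zero> \<in> W"
    and "\<And>v w. v \<in> W \<Longrightarrow> v \<in> carrier V \<Longrightarrow> w \<in> carrier V \<Longrightarrow> w \<in> W \<Longrightarrow> v \<oplus> w \<in> W"
    and "\<And>j. j \<in> J \<Longrightarrow> c j \<noteq> 0 \<Longrightarrow> c j \<odot> b j \<in> W"
  shows "comb J b c \<in> W"
  using assms(1,2,5)
proof (induction J)
  case (insert j J)
  then have b: "b j \<in> carrier V" "b \<in> J \<rightarrow> carrier V" by auto
  then have "comb J b c \<in> W" using insert by auto
  moreover have "c j \<odot> b j \<in> W" using insert.prems(2)[of j] b assms(3) by (cases "c j = 0") auto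
  ultimately show ?case using insert b assms(4) by (simp add: comb_insert)
qed (use assms(3) in auto)

interpretation vs: vectorspace class_ring V by (rule vectorspace_V)

lemma span_image:
  assumes "finite J" "b \<in> J \<rightarrow> carrier V"
  shows "LinearCombinations.module.span class_ring V (b ` J) = range (comb J b)"
proof
  have sub: "submodule class_ring (range (comb J b)) V"
  proof (unfold_locales, goal_cases)
    case 1
    then show ?case using assms by auto
  next
    case (2 v w)
    then obtain c d where "v = comb J b c" "w = comb J b d" by auto
    then have "v \<oplus> w = comb J b (\<lambda>j. c j + d j)" using comb_add[OF assms(2)] by simp
    then show ?case by (simp only: rangeI)
  next
    case 3
    have "\<zero> = comb J b (\<lambda>j. 0)" using comb_zero[OF assms(2), of "\<lambda>j. 0"] by simp
    then show ?case by (simp only: rangeI)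
  next
    case (4 c v)
    then obtain d where "v = comb J b d" by auto
    then have "c \<odot> v = comb J b (\<lambda>j. c * d j)" using comb_smult[OF assms] by simp
    then show ?case by (simp only: rangeI)
  qed
  show "vs.span (b ` J) \<subseteq> range (comb J b)"
  proof (rule vs.span_is_subset[OF _ sub])
    show "b ` J \<subseteq> range (comb J b)"
    proof
      fix v assume "v \<in> b ` J"
      then obtain j where j: "j \<in> J" "v = b j" by auto
      then have "v = comb J b (\<lambda>i. if i = j then 1 else 0)" using comb_single[OF assms j(1), of 1] funcset_mem[OF assms(2) j(1)] by simp
      then show "v \<in> range (comb J b)" by blast
    qed
  qed
  have bc: "b ` J \<subseteq> carrier V" using assms by auto
  interpret sp: submodule class_ring "vs.span (b ` J)" V by (rule vs.span_is_submodule[OF bc])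
  show "range (comb J b) \<subseteq> vs.span (b ` J)"
  proof
    fix v assume "v \<in> range (comb J b)"
    then obtain c where v: "v = comb J b c" by auto
    show "v \<in> vs.span (b ` J)" unfolding v
    proof (rule comb_in_subset[OF assms])
      fix j assume "j \<in> J"
      then have "b j \<in> vs.span (b ` J)" using vs.in_own_span[OF bc] by blast
      then show "c j \<odot> b j \<in> vs.span (b ` J)" by auto
    qed auto
  qed
qed

lemma lincomb_image:
  assumes "inj_on b J" "b \<in> J \<rightarrow> carrier V"
  shows "vs.lincomb a (b ` J) = comb J b (\<lambda>j. a (b j))"
  unfolding vs.lincomb_def comb_def
  by (rule finsum_reindex) (use assms in auto)

lemma indep_image:
  assumes "finite J" "inj_on b J" "b \<in> J \<rightarrow> carrier V"
  shows "LinearCombinations.module.lin_dep class_ring V (b ` J) \<longleftrightarrow> \<not> indep J b"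
proof
  assume "vs.lin_dep (b ` J)"
  then obtain a v where "vs.lincomb a (b ` J) = \<zero>" "v \<in> b ` J" "a v \<noteq> 0"
    using vs.finite_lin_dep[of "b ` J"] assms by (auto simp: class_ring_simps)
  then show "\<not> indep J b"
    unfolding indep_def using lincomb_image[OF assms(2,3)] by fastforce
next
  assume "\<not> indep J b"
  then obtain c j where c: "comb J b c = \<zero>" "j \<in> J" "c j \<noteq> 0" by (auto simp: indep_def)
  \<comment> \<open>The coefficients are moved from indices to vectors along the inverse of b, which
    exists because b is injective on J.\<close>
  let ?a = "\<lambda>v. c (the_inv_into J b v)"
  have "vs.lincomb ?a (b ` J) = comb J b c"
    unfolding lincomb_image[OF assms(2,3)]
    by (rule comb_cong) (use assms in \<open>auto simp: the_inv_into_f_f\<close>)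
  then show "vs.lin_dep (b ` J)"
    using c assms by (intro vs.lin_dep_crit[of "b ` J" "b ` J" ?a "b j"]) (auto simp: the_inv_into_f_f class_ring_simps)
qed

lemma indepD: "indep J b \<Longrightarrow> comb J b c = \<zero> \<Longrightarrow> j \<in> J \<Longrightarrow> c j = 0"
  by (auto simp: indep_def)

lemma indep_unique:
  assumes "indep J b" "finite J" "b \<in> J \<rightarrow> carrier V" "comb J b c = comb J b c'" "j \<in> J"
  shows "c j = c' j"
proof -
  have "comb J b (\<lambda>j. c j + (-1) * c' j) = comb J b c \<oplus> (-1) \<odot> comb J b c'"
    by (simp only: comb_add[OF assms(3)] comb_smult[OF assms(2,3)])
  also have "\<dots> = \<zero>" using assms by (simp add: r_neg flip: vec_minus_eq)
  finally show ?thesis using indepD[OF assms(1) _ assms(5)] by fastforce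
qed

lemma basis_subspace_image:
  assumes "VectorSpace.subspace class_ring W V" "finite J" "inj_on b J"
    and "vectorspace.basis class_ring (V\<lparr>carrier := W\<rparr>) (b ` J)"
  shows "W = range (comb J b)" "indep J b" "b \<in> J \<rightarrow> W"
proof -
  have sub: "submodule class_ring W V" using assms(1) vs.is_module by blast
  interpret W: vectorspace class_ring "V\<lparr>carrier := W\<rparr>" by (rule vs.subspace_is_vs[OF assms(1)])
  have *: "W.lin_indpt (b ` J)" "W.gen_set (b ` J)" "b ` J \<subseteq> W"
    using assms(4) unfolding W.basis_def by auto
  then show bW: "b \<in> J \<rightarrow> W" by auto
  have WV: "W \<subseteq> carrier V" using sub submodule.subset by blast
  then have bV: "b \<in> J \<rightarrow> carrier V" using bW by auto
  show "indep J b"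
    using vs.span_li_not_depend(2)[OF *(3) sub] * indep_image[OF assms(2,3) bV] by simp
  show "W = range (comb J b)"
    using vs.span_li_not_depend(1)[OF *(3) sub] * span_image[OF assms(2) bV] by simp
qed

end

lemma (in assoc_alg) kvec: "kvec A"
proof (rule kvec.intro)
  have "module class_ring A"
    by (intro moduleI class_cring.cring_axioms abelian_group_axioms)
      (simp_all add: smult_add_left smult_add_right smult_smult)
  then show "vectorspace class_ring A"
    by (intro vectorspace.intro class_field)
qed

section \<open>Bases of generic Lie color algebras\<close>

context lie_color_algebra
begin

sublocale kvec L by (rule kvec.intro[OF vectorspace])

lemma homog_closed: "x \<in> homog L g \<Longrightarrow> x \<in> carrier L"
  and homog_add: "x \<in> homog L g \<Longrightarrow> y \<in> homog L g \<Longrightarrow> x \<oplus> y \<in> homog L g"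
  and homog_smult: "x \<in> homog L g \<Longrightarrow> c \<odot> x \<in> homog L g"
  and homog_zero: "\<zero> \<in> homog L g"
proof -
  interpret s: submodule class_ring "homog L g" L
    using homog_subspace by (rule subspace.submod)
  show "x \<in> homog L g \<Longrightarrow> x \<in> carrier L" "x \<in> homog L g \<Longrightarrow> y \<in> homog L g \<Longrightarrow> x \<oplus> y \<in> homog L g"
    "x \<in> homog L g \<Longrightarrow> c \<odot> x \<in> homog L g" "\<zero> \<in> homog L g"
    using s.subset s.smult_closed[of c x] by auto
qed

definition comp :: "'v \<Rightarrow> 'g \<Rightarrow> 'v" where
  "comp v = (THE c. (\<forall>g. c g \<in> homog L g) \<and> finite {g. c g \<noteq> \<zero>} \<and> v = finsum L c {g. c g \<noteq> \<zero>})"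

lemma comp_props:
  assumes "v \<in> carrier L"
  shows "comp v g \<in> homog L g" "finite {g. comp v g \<noteq> \<zero>}" "v = finsum L (comp v) {g. comp v g \<noteq> \<zero>}"
  using theI'[OF homog_direct_sum[OF assms]] unfolding comp_def by blast+

text \<open>Lets components be computed from any decomposition over a finite set of degrees
  containing the support, so that sums need no exact knowledge of supports.\<close>

lemma comp_unique:
  assumes "\<And>g. c g \<in> homog L g" "finite S" "\<And>g. g \<notin> S \<Longrightarrow> c g = \<zero>" "v = finsum L c S"
  shows "comp v g = c g"
proof -
  have sub: "{g. c g \<noteq> \<zero>} \<subseteq> S" using assms(3) by auto
  then have fin: "finite {g. c g \<noteq> \<zero>}" using assms(2) finite_subset by blast
  have cc: "c g \<in> carrier L" for g using homog_closed[OF assms(1)] .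
  have "finsum L c {g. c g \<noteq> \<zero>} = finsum L c S"
    by (rule add.finprod_mono_neutral_cong_left) (use sub assms(2) cc in auto)
  then have *: "(\<forall>g. c g \<in> homog L g) \<and> finite {g. c g \<noteq> \<zero>} \<and> v = finsum L c {g. c g \<noteq> \<zero>}"
    using assms(1,4) fin by auto
  have v: "v \<in> carrier L" unfolding assms(4) using cc by auto
  have "comp v = c" unfolding comp_def
    using the1_equality[OF homog_direct_sum[OF v], of c] * by blast
  then show ?thesis by simp
qed

lemma comp_homog: "x \<in> homog L h \<Longrightarrow> comp x g = (if g = h then x else \<zero>)"
  by (rule comp_unique[of _ "{h}"]) (auto simp: homog_zero homog_closed)

lemma comp_superset:
  assumes "v \<in> carrier L" "finite S" "{g. comp v g \<noteq> \<zero>} \<subseteq> S"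
  shows "v = finsum L (comp v) S"
proof -
  have "finsum L (comp v) {g. comp v g \<noteq> \<zero>} = finsum L (comp v) S"
    by (rule add.finprod_mono_neutral_cong_left)
      (use assms homog_closed[OF comp_props(1)[OF assms(1)]] in auto)
  then show ?thesis using comp_props(3)[OF assms(1)] by simp
qed

lemma comp_add:
  assumes "v \<in> carrier L" "w \<in> carrier L"
  shows "comp (v \<oplus> w) g = comp v g \<oplus> comp w g"
proof -
  let ?S = "{g. comp v g \<noteq> \<zero>} \<union> {g. comp w g \<noteq> \<zero>}"
  have S: "finite ?S" using comp_props(2) assms by auto
  have c: "comp v h \<in> carrier L" "comp w h \<in> carrier L" for h
    using homog_closed comp_props(1) assms by blast+
  have "v \<oplus> w = finsum L (comp v) ?S \<oplus> finsum L (comp w) ?S"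
    using comp_superset[OF assms(1) S] comp_superset[OF assms(2) S] by simp
  also have "\<dots> = finsum L (\<lambda>h. comp v h \<oplus> comp w h) ?S"
    by (rule finsum_addf[symmetric]) (use c in auto)
  finally show ?thesis
    by (intro comp_unique[OF _ S]) (auto intro: homog_add comp_props(1) assms)
qed

lemma comp_smult:
  assumes "v \<in> carrier L"
  shows "comp (c \<odot> v) g = c \<odot> comp v g"
proof -
  let ?S = "{g. comp v g \<noteq> \<zero>}"
  have cl: "comp v h \<in> carrier L" for h
    using homog_closed comp_props(1) assms by blast
  have "c \<odot> finsum L (comp v) S = finsum L (\<lambda>h. c \<odot> comp v h) S" if "finite S" for S
    using that by (induction S) (auto simp: cl vec_smult_add_right)
  then have "c \<odot> v = finsum L (\<lambda>h. c \<odot> comp v h) ?S"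
    using comp_props(2,3)[OF assms] by metis
  then show ?thesis
    by (intro comp_unique[OF _ comp_props(2)[OF assms]]) (auto intro: homog_smult comp_props(1) assms)
qed

text \<open>Taking components is linear, and a homogeneous vector has at most one nonzero
  component.\<close>

lemma comp_comb:
  assumes "finite J" "\<And>j. j \<in> J \<Longrightarrow> b j \<in> homog L (e j)"
  shows "comp (comb J b c) g = comb J b (\<lambda>j. if e j = g then c j else 0)"
  using assms
proof (induction J)
  case empty
  then show ?case using comp_homog[OF homog_zero] by simp
next
  case (insert j J)
  have b: "b j \<in> carrier L" "b \<in> J \<rightarrow> carrier L" "b \<in> insert j J \<rightarrow> carrier L"
    using insert.prems homog_closed by auto
  have "comp (comb (insert j J) b c) g = c j \<odot> comp (b j) g \<oplus> comp (comb J b c) g"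
    using insert.hyps b by (simp add: comb_insert comp_add comp_smult)
  then show ?case
    using insert b comp_homog[OF insert.prems[of j]] by (auto simp: comb_insert)
qed

lemma comp_eq_zero_subspace: "submodule class_ring {v \<in> carrier L. \<forall>g\<in>T. comp v g = \<zero>} L"
proof -
  interpret vs: vectorspace class_ring L by (rule vectorspace)
  have z: "comp \<zero> g = \<zero>" for g using comp_homog[OF homog_zero] by simp
  show ?thesis
    by (rule submodule.intro[OF vs.module_axioms])
      (simp_all add: comp_add comp_smult z subset_iff)
qed

text \<open>The vectors whose components outside T vanish form a subspace that contains every
  homogeneous component with degree in T.\<close>

lemma span_homog_comp:
  assumes "v \<in> LinearCombinations.module.span class_ring L (\<Union>g\<in>T. homog L g)" "g \<notin> T"
  shows "comp v g = \<zero>"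
proof -
  interpret vs: vectorspace class_ring L by (rule vectorspace)
  have "vs.span (\<Union>g\<in>T. homog L g) \<subseteq> {v \<in> carrier L. \<forall>g\<in>-T. comp v g = \<zero>}"
    by (rule vs.span_is_subset[OF _ comp_eq_zero_subspace]) (auto simp: comp_homog homog_closed)
  then show ?thesis using assms by auto
qed

lemma homog_subset_parts: "x \<in> homog L g \<Longrightarrow> \<epsilon> g g = 1 \<Longrightarrow> x \<in> plus_part \<epsilon> L"
  "x \<in> homog L g \<Longrightarrow> \<epsilon> g g = - 1 \<Longrightarrow> x \<in> minus_part \<epsilon> L"
proof -
  interpret vs: vectorspace class_ring L by (rule vectorspace)
  have *: "(\<Union>g\<in>T. homog L g) \<subseteq> vs.span (\<Union>g\<in>T. homog L g)" for T
    by (rule vs.in_own_span) (auto simp: homog_closed)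
  show "x \<in> homog L g \<Longrightarrow> \<epsilon> g g = 1 \<Longrightarrow> x \<in> plus_part \<epsilon> L"
    unfolding plus_part_def using *[of "{g. \<epsilon> g g = 1}"] by blast
  show "x \<in> homog L g \<Longrightarrow> \<epsilon> g g = - 1 \<Longrightarrow> x \<in> minus_part \<epsilon> L"
    unfolding minus_part_def using *[of "{g. \<epsilon> g g = - 1}"] by blast
qed

lemma parts_subspace: "VectorSpace.subspace class_ring (plus_part \<epsilon> L) L"
  "VectorSpace.subspace class_ring (minus_part \<epsilon> L) L"
proof -
  interpret vs: vectorspace class_ring L by (rule vectorspace)
  have "(\<Union>g\<in>T. homog L g) \<subseteq> carrier L" for T by (auto simp: homog_closed)
  then show "VectorSpace.subspace class_ring (plus_part \<epsilon> L) L"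
    "VectorSpace.subspace class_ring (minus_part \<epsilon> L) L"
    unfolding plus_part_def minus_part_def by (auto intro: vs.span_is_subspace)
qed

lemma subspace_closed:
  assumes "VectorSpace.subspace class_ring W L"
  shows "W \<subseteq> carrier L" "\<zero> \<in> W" "v \<in> W \<Longrightarrow> w \<in> W \<Longrightarrow> v \<oplus> w \<in> W" "v \<in> W \<Longrightarrow> c \<odot> v \<in> W"
proof -
  interpret s: submodule class_ring W L using assms by (rule subspace.submod)
  show "W \<subseteq> carrier L" "\<zero> \<in> W" "v \<in> W \<Longrightarrow> w \<in> W \<Longrightarrow> v \<oplus> w \<in> W" "v \<in> W \<Longrightarrow> c \<odot> v \<in> W"
    using s.subset s.smult_closed[of c v] by auto
qed

lemma bracket_zero_left: "y \<in> carrier L \<Longrightarrow> bracket L \<zero> y = \<zero>"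
  using bracket_smult_left[of "\<zero>" y 0] bracket_closed[of "\<zero>" y] by simp

lemma bracket_zero_right: "y \<in> carrier L \<Longrightarrow> bracket L y \<zero> = \<zero>"
  using bracket_smult_right[of y "\<zero>" 0] bracket_closed[of y "\<zero>"] by simp

lemma bracket_closed_env: "bracket_closed L"
  by unfold_locales (auto intro: homog_closed bracket_closed)

end

section \<open>The homogeneous basis of the x_j and their brackets\<close>

locale generic_basis = generic_lie_color_algebra \<epsilon> L
  for \<epsilon> :: "'g::ab_group_add \<Rightarrow> 'g \<Rightarrow> 'k::field" and L :: "('k, 'v, 'g) color_alg" (structure) +
  fixes x :: "nat \<Rightarrow> 'v" and m :: nat
  assumes char: "CHAR('k) \<noteq> 2"
    and basis: "homogeneous_basis L (minus_part \<epsilon> L) m x"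
begin

text \<open>If 2 were 0, the characteristic would divide 2, and a field does not have characteristic
  1.\<close>

lemma two_neq_zero: "(2::'k) \<noteq> 0"
proof
  assume "(2::'k) = 0"
  then have "of_nat 2 = (0::'k)" by simp
  then have "CHAR('k) dvd 2" by (simp only: of_nat_eq_0_iff_char_dvd)
  then have "CHAR('k) = 1 \<or> CHAR('k) = 2"
    using two_is_prime_nat unfolding prime_nat_iff by blast
  then show False using char CHAR_not_1' by auto
qed

lemma one_neq_minus_one: "(1::'k) \<noteq> - 1"
proof
  assume "(1::'k) = - 1"
  then have "(1::'k) + 1 = 0" by (simp add: eq_neg_iff_add_eq_0)
  then show False using two_neq_zero by simp
qed

lemma x_range: "minus_part \<epsilon> L = range (comb {1..m} x)"
  and x_indep: "indep {1..m} x"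
  and x_minus: "x \<in> {1..m} \<rightarrow> minus_part \<epsilon> L"
  using basis_subspace_image[OF parts_subspace(2), of "{1..m}" x] basis
  by (auto simp: homogeneous_basis_def)

lemma x_closed: "x \<in> {1..m} \<rightarrow> carrier L"
  using x_minus subspace_closed(1)[OF parts_subspace(2)] by auto

definition gx :: "nat \<Rightarrow> 'g" where "gx i = (SOME g. x i \<in> homog L g)"

lemma x_homog: "i \<in> {1..m} \<Longrightarrow> x i \<in> homog L (gx i)"
  unfolding gx_def using basis by (auto simp: homogeneous_basis_def intro: someI_ex)

lemma x_nonzero: "i \<in> {1..m} \<Longrightarrow> x i \<noteq> \<zero>"
  using indepD[OF x_indep, of "\<lambda>j. if j = i then 1 else 0" i] comb_single[OF _ x_closed, of i 1] by auto

text \<open>An element of the minus part has zero components in all degrees with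
  \<open>\<epsilon> g g \<noteq> - 1\<close>, whereas the nonzero vector \<open>x i\<close> is its
  own component of degree \<open>gx i\<close>.\<close>

lemma gx_odd:
  assumes "i \<in> {1..m}"
  shows "\<epsilon> (gx i) (gx i) = - 1"
proof -
  have "x i \<in> minus_part \<epsilon> L" using funcset_mem[OF x_minus assms] .
  moreover have "comp (x i) (gx i) \<noteq> \<zero>" using comp_homog[OF x_homog[OF assms]] x_nonzero[OF assms] by simp
  ultimately show ?thesis
    using span_homog_comp[of "x i" "{g. \<epsilon> g g = - 1}" "gx i"] by (auto simp: minus_part_def)
qed

definition pairs :: "(nat \<times> nat) set" where "pairs = {(i, j). 1 \<le> i \<and> i \<le> j \<and> j \<le> m}"

lemma finite_pairs: "finite pairs"
  by (rule finite_subset[of _ "{1..m} \<times> {1..m}"]) (auto simp: pairs_def)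

lemma card_pairs: "card pairs = m * (m + 1) div 2"
  using bij_betw_same_card[OF pair_index_bij[of m]] by (simp add: pairs_def)

definition y :: "nat \<times> nat \<Rightarrow> 'v" where "y = (\<lambda>(i, j). bracket L (x i) (x j))"

lemma y_homog: "(i, j) \<in> pairs \<Longrightarrow> y (i, j) \<in> homog L (gx i + gx j)"
  unfolding y_def using bracket_graded[OF x_homog x_homog, of i j] by (auto simp: pairs_def)

lemma y_plus: "y \<in> pairs \<rightarrow> plus_part \<epsilon> L"
  using y_homog homog_subset_parts(1) pair_plus[OF gx_odd gx_odd] by (fastforce simp: pairs_def)

lemma y_closed: "y \<in> pairs \<rightarrow> carrier L"
  using y_plus subspace_closed(1)[OF parts_subspace(1)] by auto

lemma bracket_x_in: 
  assumes "i \<in> {1..m}" "j \<in> {1..m}"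
  shows "bracket L (x i) (x j) \<in> range (comb pairs y)"
proof -
  have *: "c \<odot> y q \<in> range (comb pairs y)" if "q \<in> pairs" for q c
    using comb_single[OF finite_pairs y_closed that] by (metis rangeI)
  show ?thesis
  proof (cases "i \<le> j")
    case True
    then have q: "(i, j) \<in> pairs" using assms by (auto simp: pairs_def)
    have "y (i, j) \<in> carrier L" using q y_closed by auto
    then show ?thesis using *[OF q, of 1] by (simp add: y_def)
  next
    case False
    then have q: "(j, i) \<in> pairs" using assms by (auto simp: pairs_def)
    have c: "y (j, i) \<in> carrier L" using q y_closed by auto
    have "bracket L (x i) (x j) = \<ominus> (\<epsilon> (gx i) (gx j) \<odot> y (j, i))"
      unfolding y_def using color_skew[OF x_homog[OF assms(1)] x_homog[OF assms(2)]] by simp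
    also have "\<dots> = (- \<epsilon> (gx i) (gx j)) \<odot> y (j, i)"
      using c by (simp add: vec_minus_eq vec_smult_smult)
    finally show ?thesis using *[OF q] by simp
  qed
qed

text \<open>By bilinearity brackets of the minus part reduce to brackets of the x_i, and skew
  symmetry leaves those with i \<le> j.\<close>

lemma y_span: "plus_part \<epsilon> L = LinearCombinations.module.span class_ring L (y ` pairs)"
proof -
  interpret vs: vectorspace class_ring L by (rule vectorspace)
  let ?S = "vs.span (y ` pairs)"
  have S: "VectorSpace.subspace class_ring ?S L"
    by (rule vs.span_is_subspace) (use y_closed in auto)
  note Sc = subspace_closed[OF S]
  have xx: "bracket L (x i) (x j) \<in> ?S" if "i \<in> {1..m}" "j \<in> {1..m}" for i j
    using bracket_x_in[OF that] span_image[OF finite_pairs y_closed] by simp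
  have xv: "bracket L (x i) v \<in> ?S" if i: "i \<in> {1..m}" and v: "v \<in> minus_part \<epsilon> L" for i v
  proof -
    obtain c where v: "v = comb {1..m} x c" using v x_range by auto
    have xi: "x i \<in> carrier L" using i x_closed by auto
    have "v \<in> {v \<in> carrier L. bracket L (x i) v \<in> ?S}" unfolding v
      by (rule comb_in_subset[OF _ x_closed])
        (use Sc xi xx[OF i] x_closed in \<open>auto simp: bracket_add_right bracket_smult_right bracket_zero_right Pi_iff\<close>)
    then show ?thesis by simp
  qed
  have uv: "bracket L u v \<in> ?S" if u: "u \<in> minus_part \<epsilon> L" and v: "v \<in> minus_part \<epsilon> L" for u v
  proof -
    obtain c where u: "u = comb {1..m} x c" using u x_range by auto
    have vc: "v \<in> carrier L" using v subspace_closed(1)[OF parts_subspace(2)] by auto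
    have "u \<in> {u \<in> carrier L. bracket L u v \<in> ?S}" unfolding u
      by (rule comb_in_subset[OF _ x_closed])
        (use Sc vc xv[OF _ v] x_closed in \<open>auto simp: bracket_add_left bracket_smult_left bracket_zero_left Pi_iff\<close>)
    then show ?thesis by simp
  qed
  show ?thesis
  proof
    show "plus_part \<epsilon> L \<subseteq> ?S"
      unfolding plus_eq_brackets
      by (rule vs.span_is_subset[OF _ subspace.submod[OF S]]) (use uv in auto)
    show "?S \<subseteq> plus_part \<epsilon> L"
      by (rule vs.span_is_subset[OF _ subspace.submod[OF parts_subspace(1)]]) (use y_plus in auto)
  qed
qed

text \<open>The dimension condition enters here: m (m + 1) / 2 brackets span a space of that
  dimension, hence they are distinct and form a basis.\<close>

lemma y_basis: "inj_on y pairs" "vectorspace.basis class_ring (L\<lparr>carrier := plus_part \<epsilon> L\<rparr>) (y ` pairs)"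
proof -
  interpret vs: vectorspace class_ring L by (rule vectorspace)
  interpret W: vectorspace class_ring "L\<lparr>carrier := plus_part \<epsilon> L\<rparr>"
    by (rule vs.subspace_is_vs[OF parts_subspace(1)])
  interpret W': vectorspace class_ring "L\<lparr>carrier := minus_part \<epsilon> L\<rparr>"
    by (rule vs.subspace_is_vs[OF parts_subspace(2)])
  have "W'.dim = card (x ` {1..m})"
    by (rule W'.dim_basis) (use basis in \<open>auto simp: homogeneous_basis_def\<close>)
  also have "\<dots> = m" using basis card_image[of x "{1..m}"] by (simp add: homogeneous_basis_def)
  finally have dim: "W.dim = card pairs" using dim_plus card_pairs by simp
  have sub: "y ` pairs \<subseteq> plus_part \<epsilon> L" using y_plus by auto
  have gen: "W.gen_set (y ` pairs)"
    using vs.span_li_not_depend(1)[OF sub subspace.submod[OF parts_subspace(1)]] y_span by simp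
  have "card pairs \<le> card (y ` pairs)"
    using W.gen_ge_dim[of "y ` pairs"] finite_pairs sub gen dim by simp
  then show "inj_on y pairs"
    using finite_pairs card_image_le eq_card_imp_inj_on le_antisym by metis
  show "W.basis (y ` pairs)"
    by (rule W.dim_gen_is_basis) (use finite_pairs sub gen dim card_image_le[OF finite_pairs] in auto)
qed

lemma y_range: "plus_part \<epsilon> L = range (comb pairs y)" and y_indep: "indep pairs y"
  using basis_subspace_image[OF parts_subspace(1) finite_pairs y_basis] by auto

text \<open>The labels (0, j) stand for x_j and the pairs for the brackets, including [x_j, x_j].
  The list of the t_s is shorter: there the diagonal place is taken by x_j.\<close>

definition index :: "(nat \<times> nat) set" where "index = {0} \<times> {1..m} \<union> pairs"
definition b :: "nat \<times> nat \<Rightarrow> 'v" where "b = (\<lambda>(i, j). if i = 0 then x j else y (i, j))"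
definition deg :: "nat \<times> nat \<Rightarrow> 'g" where "deg = (\<lambda>(i, j). if i = 0 then gx j else gx i + gx j)"

lemma finite_index: "finite index"
  by (simp add: index_def finite_pairs)

lemma b_homog: "q \<in> index \<Longrightarrow> b q \<in> homog L (deg q)"
  using x_homog y_homog by (auto simp: index_def b_def deg_def pairs_def)

lemma b_closed: "b \<in> index \<rightarrow> carrier L"
  using b_homog homog_closed by blast

lemma comb_x: "comb {1..m} x c = comb index b (\<lambda>(i, j). if i = 0 then c j else 0)"
proof -
  have "comb index b (\<lambda>(i, j). if i = 0 then c j else 0) = comb ({0} \<times> {1..m}) b (\<lambda>(i, j). if i = 0 then c j else 0)"
    by (rule comb_superset[symmetric, OF finite_index _ b_closed]) (auto simp: index_def pairs_def)
  also have "\<dots> = (\<Oplus>q\<in>Pair (0::nat) ` {1..m}. c (snd q) \<odot> x (snd q))"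
    unfolding comb_def by (rule finsum_cong') (use x_closed in \<open>auto simp: b_def Pi_iff\<close>)
  also have "\<dots> = comb {1..m} x c"
    unfolding comb_def by (subst finsum_reindex) (use x_closed in \<open>auto simp: inj_on_def Pi_iff\<close>)
  finally show ?thesis by simp
qed

lemma comb_y: "comb pairs y c = comb index b (\<lambda>(i, j). if i = 0 then 0 else c (i, j))"
proof -
  have "comb index b (\<lambda>(i, j). if i = 0 then 0 else c (i, j)) = comb pairs b (\<lambda>(i, j). if i = 0 then 0 else c (i, j))"
    by (rule comb_superset[symmetric, OF finite_index _ b_closed]) (auto simp: index_def pairs_def)
  also have "\<dots> = comb pairs y c"
    unfolding comb_def by (rule finsum_cong') (use y_closed in \<open>auto simp: b_def pairs_def Pi_iff\<close>)
  finally show ?thesis by simp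
qed

text \<open>Every degree is even or odd, so each homogeneous component of a vector lies in the plus
  or in the minus part.\<close>

lemma b_range: "carrier L = range (comb index b)"
proof
  show "range (comb index b) \<subseteq> carrier L" using b_closed by auto
  have minus: "minus_part \<epsilon> L \<subseteq> range (comb index b)" unfolding x_range using comb_x by auto
  have plus: "plus_part \<epsilon> L \<subseteq> range (comb index b)" unfolding y_range using comb_y by auto
  have homog: "homog L g \<subseteq> range (comb index b)" for g
    using self_cases[of g]
  proof
    assume "\<epsilon> g g = 1"
    then show ?thesis using homog_subset_parts(1) plus by (metis subsetI subsetD)
  next
    assume "\<epsilon> g g = - 1"
    then show ?thesis using homog_subset_parts(2) minus by (metis subsetI subsetD)
  qed
  show "carrier L \<subseteq> range (comb index b)"
  proof
    fix v assume v: "v \<in> carrier L"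
    have *: "finsum L (comp v) S \<in> range (comb index b)" if "finite S" for S
      using that
    proof (induction S)
      case empty
      have "comb index b (\<lambda>_. 0) = \<zero>" by (rule comb_zero[OF b_closed]) simp
      then show ?case by (metis finsum_empty rangeI)
    next
      case (insert g S)
      obtain c where c: "comp v g = comb index b c"
        using homog comp_props(1)[OF v, of g] by blast
      obtain c' where c': "finsum L (comp v) S = comb index b c'" using insert by auto
      have "finsum L (comp v) (insert g S) = comp v g \<oplus> finsum L (comp v) S"
        by (rule finsum_insert) (use insert homog_closed[OF comp_props(1)[OF v]] in auto)
      also have "\<dots> = comb index b (\<lambda>q. c q + c' q)"
        unfolding c c' by (rule comb_add[OF b_closed, symmetric])
      finally show ?case by simp
    qed
    then show "v \<in> range (comb index b)" using comp_props(2,3)[OF v] by metis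
  qed
qed

text \<open>A linear relation splits into homogeneous components. Since 1 \<noteq> -1, a single
  degree involves either the x_j or the brackets but not both, so the independence of each of the
  two families suffices.\<close>

lemma b_indep: "indep index b"
  unfolding indep_def
proof (intro allI impI ballI)
  fix c q assume c: "comb index b c = \<zero>" and q: "q \<in> index"
  let ?c = "\<lambda>r. if deg r = deg q then c r else 0"
  have z: "comb index b ?c = \<zero>"
    using comp_comb[OF finite_index, of b deg c "deg q"] b_homog c comp_homog[OF homog_zero] by simp
  have odd: "\<epsilon> (deg (0, j)) (deg (0, j)) = - 1" if "j \<in> {1..m}" for j
    using gx_odd that by (simp add: deg_def)
  have even: "\<epsilon> (deg (i, j)) (deg (i, j)) = 1" if "(i, j) \<in> pairs" for i j
    using pair_plus[OF gx_odd gx_odd, of i j] that by (auto simp: deg_def pairs_def)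
  consider j where "q = (0, j)" "j \<in> {1..m}" | i j where "q = (i, j)" "(i, j) \<in> pairs"
    using q by (cases q) (auto simp: index_def)
  then show "c q = 0"
  proof cases
    case 1
    have "comb {1..m} x (\<lambda>j. ?c (0, j)) = comb index b ?c"
      unfolding comb_x
    proof (rule comb_cong[OF b_closed])
      fix r assume r: "r \<in> index"
      obtain i' j' where r': "r = (i', j')" by fastforce
      show "(case r of (i, j) \<Rightarrow> if i = 0 then ?c (0, j) else 0) = ?c r"
        using r r' odd[OF 1(2)] even[of i' j'] one_neq_minus_one 1 by (auto simp: index_def)
    qed
    then show ?thesis using indepD[OF x_indep _ 1(2), where c = "\<lambda>j. ?c (0, j)"] z 1 by simp
  next
    case 2
    have "comb pairs y ?c = comb index b ?c"
      unfolding comb_y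
    proof (rule comb_cong[OF b_closed])
      fix r assume r: "r \<in> index"
      obtain i' j' where r': "r = (i', j')" by fastforce
      show "(case r of (i, j) \<Rightarrow> if i = 0 then 0 else ?c (i, j)) = ?c r"
        using r r' odd[of j'] even[OF 2(2)] one_neq_minus_one 2 by (auto simp: index_def pairs_def)
    qed
    then show ?thesis using y_indep z 2 unfolding indep_def by fastforce
  qed
qed

end

subsection \<open>The representation of the enveloping algebra\<close>

definition unit_fun :: "(nat \<Rightarrow> nat) \<Rightarrow> (nat \<Rightarrow> nat) \<Rightarrow> 'k::field" where
  "unit_fun \<alpha> = (\<lambda>\<beta>. if \<beta> = \<alpha> then 1 else 0)"

lemma weight_zero: "(\<And>r. r < s \<Longrightarrow> \<alpha> r = 0) \<Longrightarrow> weight d s \<alpha> = 0"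
  by (simp add: weight_def)

lemma (in skew_bicharacter) mult_op_unit:
  assumes "\<And>r. r < s \<Longrightarrow> \<alpha> r = 0"
  shows "Rep_lin_op (mult_op \<epsilon> d s) (unit_fun \<alpha>) = unit_fun (\<alpha>(s := Suc (\<alpha> s)))"
proof
  fix \<beta>
  have *: "\<beta> s \<noteq> 0 \<and> \<beta>(s := \<beta> s - 1) = \<alpha> \<longleftrightarrow> \<beta> = \<alpha>(s := Suc (\<alpha> s))"
    by (auto simp: fun_eq_iff)
  have "weight d s \<beta> = 0" if "\<beta> = \<alpha>(s := Suc (\<alpha> s))"
    using weight_zero[of s \<beta> d] assms that by auto
  then show "Rep_lin_op (mult_op \<epsilon> d s) (unit_fun \<alpha>) \<beta> = unit_fun (\<alpha>(s := Suc (\<alpha> s))) \<beta>"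
    using * by (auto simp: mult_op.rep_eq unit_fun_def)
qed

lemma (in skew_bicharacter) deriv_op_unit:
  assumes "\<alpha> s = 0"
  shows "Rep_lin_op (deriv_op \<epsilon> d s) (unit_fun \<alpha>) = (\<lambda>\<beta>. 0)"
  using assms by (auto simp: deriv_op.rep_eq unit_fun_def fun_eq_iff)

lemma Rep_lin_op_zero: "Rep_lin_op T (\<lambda>x. 0) = (\<lambda>x. 0)"
  using Rep_lin_op_smult[of T 0 "\<lambda>x. 0"] by simp

text \<open>If all exponents below the index of x_j vanish, the derivations in \<open>X j\<close>
  act on absent variables and give 0, since their diagonal indices belong to earlier columns. What
  remains is multiplication by one variable, with trivial color factor.\<close>

lemma (in generic_ops) X_unit:
  assumes "1 \<le> j" "\<And>r. r < pair_index j j \<Longrightarrow> \<alpha> r = 0"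
  shows "Rep_lin_op (X j) (unit_fun \<alpha>) = unit_fun (\<alpha>(pair_index j j := Suc (\<alpha> (pair_index j j))))"
proof
  fix \<beta>
  have "Rep_lin_op (Q i j) (unit_fun \<alpha>) = (\<lambda>\<beta>. 0)" if "i \<in> {1..<j}" for i
  proof -
    have "\<alpha> (pair_index i i) = 0" using that pair_index_less[of i i j j] assms by auto
    then show ?thesis by (simp add: Q_def D_def Rep_lin_op_simps deriv_op_unit Rep_lin_op_zero)
  qed
  then show "Rep_lin_op (X j) (unit_fun \<alpha>) \<beta> = unit_fun (\<alpha>(pair_index j j := Suc (\<alpha> (pair_index j j)))) \<beta>"
    by (simp add: X_def Rep_lin_op_simps Rep_lin_op_sum M_def mult_op_unit[OF assms(2)])
qed

lemma (in assoc_alg) pow_closed: "x \<in> carrier A \<Longrightarrow> x [^] (n::nat) \<in> carrier A"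
  by simp

context lie_color_algebra
begin

sublocale E: bracket_closed \<epsilon> L by (rule bracket_closed_env)

abbreviation env_mult (infixl "\<otimes>\<^sub>U" 70) where "u \<otimes>\<^sub>U v \<equiv> u \<otimes>\<^bsub>E.U\<^esub> v"
abbreviation env_add (infixl "\<oplus>\<^sub>U" 65) where "u \<oplus>\<^sub>U v \<equiv> u \<oplus>\<^bsub>E.U\<^esub> v"
abbreviation env_smult (infixl "\<odot>\<^sub>U" 70) where "c \<odot>\<^sub>U v \<equiv> c \<odot>\<^bsub>E.U\<^esub> v"
abbreviation env_one ("\<one>\<^sub>U") where "\<one>\<^sub>U \<equiv> \<one>\<^bsub>E.U\<^esub>"
abbreviation env_zero ("\<zero>\<^sub>U") where "\<zero>\<^sub>U \<equiv> \<zero>\<^bsub>E.U\<^esub>"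

lemma inc_closed: "v \<in> carrier L \<Longrightarrow> E.inc v \<in> carrier E.U"
  using E.inc_relation_preserving unfolding relation_preserving_def by auto

lemma inc_add: "v \<in> carrier L \<Longrightarrow> w \<in> carrier L \<Longrightarrow> E.inc (v \<oplus> w) = E.inc v \<oplus>\<^sub>U E.inc w"
  and inc_smult: "v \<in> carrier L \<Longrightarrow> E.inc (c \<odot> v) = c \<odot>\<^sub>U E.inc v"
  and inc_relation: "v \<in> homog L g \<Longrightarrow> w \<in> homog L h \<Longrightarrow>
    E.inc v \<otimes>\<^sub>U E.inc w = \<epsilon> g h \<odot>\<^sub>U (E.inc w \<otimes>\<^sub>U E.inc v) \<oplus>\<^sub>U E.inc (bracket L v w)"
  using E.inc_relation_preserving unfolding relation_preserving_def by blast+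

lemma inc_zero: "E.inc \<zero> = \<zero>\<^sub>U"
  using inc_smult[of \<zero> 0] inc_closed[of \<zero>] by simp

end

context generic_basis
begin

text \<open>Independence of b determines the values on \<open>index\<close>; elsewhere they are
  arbitrary.\<close>

definition coord :: "'v \<Rightarrow> nat \<times> nat \<Rightarrow> 'k" where
  "coord v = (SOME c. v = comb index b c)"

lemma coord_comb: "q \<in> index \<Longrightarrow> coord (comb index b c) q = c q"
proof -
  assume q: "q \<in> index"
  have "comb index b c = comb index b (coord (comb index b c))"
    unfolding coord_def by (rule someI[of "\<lambda>c'. comb index b c = comb index b c'" c]) simp
  then show ?thesis using indep_unique[OF b_indep finite_index b_closed _ q] by metis
qed

text \<open>The degree of t_s. On the diagonal it is \<open>gx j\<close>, since t_s is x_j there, in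
  contrast to \<open>deg (j, j)\<close>, which belongs to [x_j, x_j].\<close>

definition d :: "nat \<Rightarrow> 'g" where
  "d s = (case the_inv_into pairs (\<lambda>(i, j). pair_index i j) s of (i, j) \<Rightarrow> if i = j then gx j else gx i + gx j)"

sublocale G: generic_ops \<epsilon> gx d m
proof
  fix i j assume "1 \<le> i" "i \<le> j" "j \<le> m"
  then have "(i, j) \<in> pairs" by (simp add: pairs_def)
  then have "the_inv_into pairs (\<lambda>(i, j). pair_index i j) (pair_index i j) = (i, j)"
    using the_inv_into_f_f[of "\<lambda>(i, j). pair_index i j" pairs "(i, j)"] pair_index_bij[of m]
    by (simp add: bij_betw_def pairs_def)
  then show "d (pair_index i j) = (if i = j then gx j else gx i + gx j)"
    by (simp add: d_def)
qed (rule gx_odd)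

definition rep :: "'v \<Rightarrow> (nat \<Rightarrow> nat, 'k) lin_op" where
  "rep v = (\<Sum>q\<in>index. coord v q *\<^sub>o G.basis_op q)"

lemma rep_comb: "rep (comb index b c) = (\<Sum>q\<in>index. c q *\<^sub>o G.basis_op q)"
  unfolding rep_def by (rule sum.cong) (simp_all add: coord_comb)

lemma rep_add: "v \<in> carrier L \<Longrightarrow> w \<in> carrier L \<Longrightarrow> rep (v \<oplus> w) = rep v + rep w"
proof -
  assume "v \<in> carrier L" "w \<in> carrier L"
  then obtain c c' where "v = comb index b c" "w = comb index b c'" unfolding b_range by blast
  then show ?thesis
    by (simp add: rep_comb op_smult_simps sum.distrib flip: comb_add[OF b_closed])
qed

lemma rep_smult: "v \<in> carrier L \<Longrightarrow> rep (a \<odot> v) = a *\<^sub>o rep v"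
proof -
  assume "v \<in> carrier L"
  then obtain c where "v = comb index b c" unfolding b_range by blast
  then show ?thesis
    by (simp add: rep_comb op_smult_simps op_smult_sum flip: comb_smult[OF finite_index b_closed])
qed

lemma rep_zero: "rep \<zero> = 0"
  using rep_smult[of \<zero> 0] by (simp add: op_smult_simps)

lemma rep_b:
  assumes "q \<in> index"
  shows "rep (b q) = G.basis_op q"
proof -
  have "b q \<in> carrier L" using assms b_closed by auto
  then have "b q = comb index b (\<lambda>r. if r = q then 1 else 0)"
    using comb_single[OF finite_index b_closed assms, of 1] by simp
  then have "rep (b q) = (\<Sum>r\<in>index. (if r = q then 1 else 0) *\<^sub>o G.basis_op r)"
    by (simp only: rep_comb)
  also have "\<dots> = (\<Sum>r\<in>index. if r = q then G.basis_op r else 0)"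
    by (rule sum.cong) (auto simp: op_smult_simps)
  also have "\<dots> = G.basis_op q" using assms finite_index by simp
  finally show ?thesis .
qed

lemma rep_relation_x_x:
  assumes i: "i \<in> {1..m}" and j: "j \<in> {1..m}"
  shows "G.X i * G.X j = \<epsilon> (gx i) (gx j) *\<^sub>o (G.X j * G.X i) + rep (bracket L (x i) (x j))"
proof -
  have y: "rep (bracket L (x i) (x j)) = G.basis_op (i, j)" if "i \<le> j" "i \<in> {1..m}" "j \<in> {1..m}" for i j
    using rep_b[of "(i, j)"] that by (auto simp: b_def y_def index_def pairs_def)
  consider "i < j" | "i = j" | "j < i" by linarith
  then show ?thesis
  proof cases
    case 1
    then show ?thesis using y[OF _ i j] G.X_X'[of i j] i j by (simp add: G.basis_op_def)
  next
    case 2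
    \<comment> \<open>Here \<epsilon> is -1 and the relation reads X^2 = -X^2 + 2 X^2; this is why
      the diagonal bracket is represented by twice the square.\<close>
    have "(2::'k) *\<^sub>o (G.X j * G.X j) = G.X j * G.X j + G.X j * G.X j"
      using op_smult_simps(8)[of "1::'k" 1 "G.X j * G.X j"] by (simp add: op_smult_simps)
    then show ?thesis using 2 y[OF _ i j] i gx_odd[OF i] by (simp add: G.basis_op_def op_smult_simps)
  next
    case 3
    have c: "bracket L (x j) (x i) \<in> carrier L"
      using bracket_closed funcset_mem[OF x_closed] i j by blast
    have "bracket L (x i) (x j) = (- \<epsilon> (gx i) (gx j)) \<odot> bracket L (x j) (x i)"
      using color_skew[OF x_homog[OF i] x_homog[OF j]] c by (simp add: vec_minus_eq vec_smult_smult)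
    then have "rep (bracket L (x i) (x j)) = (- \<epsilon> (gx i) (gx j)) *\<^sub>o G.Y j i"
      using rep_smult[OF c] y[OF _ j i] 3 j by (simp add: G.basis_op_def)
    then show ?thesis using G.X_X[of j i] 3 i j by (simp add: op_smult_simps)
  qed
qed

lemma bracket_plus_zero:
  assumes "q \<in> pairs" "r \<in> index"
  shows "bracket L (b q) (b r) = \<zero>" "bracket L (b r) (b q) = \<zero>"
proof -
  have q: "b q \<in> plus_part \<epsilon> L" "q \<in> index"
    using assms(1) funcset_mem[OF y_plus assms(1)] by (auto simp: b_def pairs_def index_def)
  then show *: "bracket L (b q) (b r) = \<zero>"
    using color_central funcset_mem[OF b_closed assms(2)] by blast
  show "bracket L (b r) (b q) = \<zero>"
    using color_skew[OF b_homog[OF assms(2)] b_homog[OF q(2)]] * by (simp add: minus_zero)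
qed

text \<open>If one of the two is a bracket, the bracket term vanishes by centrality and the
  operators color commute; what is left is the relation among the \<open>X j\<close>.\<close>

lemma rep_relation_basis:
  assumes "q \<in> index" "r \<in> index"
  shows "G.basis_op q * G.basis_op r = \<epsilon> (deg q) (deg r) *\<^sub>o (G.basis_op r * G.basis_op q) + rep (bracket L (b q) (b r))"
proof -
  have plus_any: "color_comm (deg q) (deg r) (G.basis_op q) (G.basis_op r)" if qr: "q \<in> pairs" "r \<in> index" for q r
  proof -
    obtain i j where q: "q = (i, j)" "1 \<le> i" "i \<le> j" "j \<le> m" using qr by (auto simp: pairs_def)
    obtain i' j' where r: "r = (i', j')" by fastforce
    show ?thesis
    proof (cases "i' = 0")
      case True
      then have "j' \<in> {1..m}" using qr r by (auto simp: index_def pairs_def)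
      then show ?thesis using G.basis_op_X[OF q(2-4), of j'] True
          G.basis_op_def[THEN fun_cong, of "(0, j')"] q
        by (simp add: r deg_def)
    next
      case False
      then have "1 \<le> i'" "i' \<le> j'" "j' \<le> m" using qr r by (auto simp: index_def pairs_def)
      then show ?thesis using G.basis_op_basis_op[OF q(2-4), of i' j'] q r by (simp add: deg_def)
    qed
  qed
  consider "q \<in> pairs" | "r \<in> pairs" | i j where "q = (0, i)" "i \<in> {1..m}" "r = (0, j)" "j \<in> {1..m}"
    using assms unfolding index_def by blast
  then show ?thesis
  proof cases
    case 1
    then show ?thesis using plus_any[OF 1 assms(2)] bracket_plus_zero(1)[OF 1 assms(2)]
      by (simp add: color_comm_def rep_zero)
  next
    case 2
    then show ?thesis using color_comm_sym[OF plus_any[OF 2 assms(1)]] bracket_plus_zero(2)[OF 2 assms(1)]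
      by (simp add: color_comm_def rep_zero)
  next
    case 3
    then show ?thesis using rep_relation_x_x[of i j] by (simp add: G.basis_op_def b_def deg_def)
  qed
qed

text \<open>The scalar \<open>\<epsilon> g h\<close> in the relations belongs to fixed degrees, so
  an induction over a homogeneous vector must stay within its degree; the basis vectors of that
  degree suffice.\<close>

lemma homog_in_subset:
  assumes u: "u \<in> homog L g" and "\<zero> \<in> W"
    and "\<And>v w. v \<in> W \<Longrightarrow> v \<in> carrier L \<Longrightarrow> w \<in> carrier L \<Longrightarrow> w \<in> W \<Longrightarrow> v \<oplus> w \<in> W"
    and "\<And>q c. q \<in> index \<Longrightarrow> deg q = g \<Longrightarrow> c \<odot> b q \<in> W"
  shows "u \<in> W"
proof -
  obtain c where c: "u = comb index b c" using homog_closed[OF u] unfolding b_range by blast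
  have "u = comp u g" using comp_homog[OF u] by simp
  also have "\<dots> = comb index b (\<lambda>q. if deg q = g then c q else 0)"
    unfolding c by (rule comp_comb[OF finite_index b_homog])
  also have "\<dots> \<in> W"
    by (rule comb_in_subset[OF finite_index b_closed]) (use assms in \<open>auto split: if_splits\<close>)
  finally show ?thesis .
qed

lemma rep_relation:
  assumes u: "u \<in> homog L g" and w: "w \<in> homog L h"
  shows "rep u * rep w = \<epsilon> g h *\<^sub>o (rep w * rep u) + rep (bracket L u w)"
proof -
  let ?P = "\<lambda>g h u w. rep u * rep w = \<epsilon> g h *\<^sub>o (rep w * rep u) + rep (bracket L u w)"
  have bc: "q \<in> index \<Longrightarrow> b q \<in> carrier L" for q using b_closed by auto
  have 1: "?P (deg q) h (b q) w" if q: "q \<in> index" for q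
  proof -
    have "w \<in> {w \<in> carrier L. ?P (deg q) h (b q) w}"
    proof (rule homog_in_subset[OF w], goal_cases)
      case 1
      then show ?case using bc[OF q] by (simp add: rep_zero bracket_zero_right op_smult_simps)
    next
      case (2 v w)
      then show ?case using bc[OF q]
        by (simp add: rep_add bracket_add_right bracket_closed op_smult_simps algebra_simps)
    next
      case (3 r c)
      then show ?case using bc[OF q] bc[of r] rep_relation_basis[OF q, of r]
        by (simp add: rep_smult bracket_smult_right bracket_closed op_smult_simps rep_b q mult.commute)
    qed
    then show ?thesis by simp
  qed
  have wc: "w \<in> carrier L" using homog_closed[OF w] .
  have "u \<in> {u \<in> carrier L. ?P g h u w}"
  proof (rule homog_in_subset[OF u], goal_cases)
    case 1
    then show ?case using wc by (simp add: rep_zero bracket_zero_left op_smult_simps)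
  next
    case (2 v w')
    then show ?case using wc
      by (simp add: rep_add bracket_add_left bracket_closed op_smult_simps algebra_simps)
  next
    case (3 r c)
    then show ?case using bc[of r] 1[of r] wc
      by (simp add: rep_smult bracket_smult_left bracket_closed op_smult_simps mult.commute)
  qed
  then show ?thesis by simp
qed

lemma rep_relation_preserving: "relation_preserving \<epsilon> L op_alg rep"
  unfolding relation_preserving_def
proof (intro conjI ballI allI)
  fix g h u w assume "u \<in> homog L g" "w \<in> homog L h"
  then show "rep u \<otimes>\<^bsub>op_alg\<^esub> rep w =
      \<epsilon> g h \<odot>\<^bsub>op_alg\<^esub> (rep w \<otimes>\<^bsub>op_alg\<^esub> rep u) \<oplus>\<^bsub>op_alg\<^esub> rep (bracket L u w)"
    unfolding op_alg_simps by (rule rep_relation)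
qed (simp_all add: rep_add rep_smult)

definition \<Phi> where "\<Phi> = (SOME h. h \<in> alg_homs E.U op_alg \<and> (\<forall>v\<in>carrier L. h (E.inc v) = rep v))"

lemma \<Phi>_hom: "\<Phi> \<in> alg_homs E.U op_alg" and \<Phi>_inc: "v \<in> carrier L \<Longrightarrow> \<Phi> (E.inc v) = rep v"
proof -
  have "\<exists>h. h \<in> alg_homs E.U op_alg \<and> (\<forall>v\<in>carrier L. h (E.inc v) = rep v)"
    using E.env_alg_universal[OF assoc_alg_op_alg rep_relation_preserving] by blast
  from someI_ex[OF this] show "\<Phi> \<in> alg_homs E.U op_alg" "v \<in> carrier L \<Longrightarrow> \<Phi> (E.inc v) = rep v"
    unfolding \<Phi>_def by blast+
qed

end

section \<open>The action of ordered monomials\<close>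

locale generic_gens = generic_basis \<epsilon> L x m
  for \<epsilon> :: "'g::ab_group_add \<Rightarrow> 'g \<Rightarrow> 'k::field" and L :: "('k, 'v, 'g) color_alg" (structure) and x m +
  fixes t :: "nat \<Rightarrow> 'v" and p :: nat
  assumes p: "p = m * (m + 1) div 2"
    and t_diag: "\<And>j. \<lbrakk>1 \<le> j; j \<le> m\<rbrakk> \<Longrightarrow> t (pair_index j j) = x j"
    and t_off_diag: "\<And>i j. \<lbrakk>1 \<le> i; i < j; j \<le> m\<rbrakk> \<Longrightarrow> t (pair_index i j) = bracket L (x i) (x j)"
begin

lemma index_pair_cases:
  assumes "s \<in> {1..p}"
  obtains i j where "1 \<le> i" "i \<le> j" "j \<le> m" "s = pair_index i j"
proof -
  have "s \<in> (\<lambda>(i, j). pair_index i j) ` {(i, j). 1 \<le> i \<and> i \<le> j \<and> j \<le> m}"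
    using assms unfolding pair_index_image p .
  then obtain q where q: "q \<in> {(i, j). 1 \<le> i \<and> i \<le> j \<and> j \<le> m}" "s = (\<lambda>(i, j). pair_index i j) q"
    by (elim imageE)
  show thesis by (rule that[of "fst q" "snd q"]) (use q in \<open>auto split: prod.splits\<close>)
qed

lemma t_pair: "\<lbrakk>1 \<le> i; i \<le> j; j \<le> m\<rbrakk> \<Longrightarrow>
    t (pair_index i j) = b (if i = j then (0, j) else (i, j))"
  using t_diag[of j] t_off_diag[of i j] by (auto simp: b_def y_def)

lemma t_closed: "s \<in> {1..p} \<Longrightarrow> t s \<in> carrier L"
proof -
  assume "s \<in> {1..p}"
  then obtain i j where ij: "1 \<le> i" "i \<le> j" "j \<le> m" "s = pair_index i j"
    by (rule index_pair_cases)
  then have "(if i = j then (0, j) else (i, j)) \<in> index" by (auto simp: index_def pairs_def)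
  then show ?thesis unfolding ij(4) t_pair[OF ij(1-3)] by (rule funcset_mem[OF b_closed])
qed

definition \<tau> where "\<tau> = E.inc \<circ> t"

lemma \<tau>_apply: "\<tau> s = E.inc (t s)"
  by (simp add: \<tau>_def)

lemma \<tau>_closed: "s \<in> {1..p} \<Longrightarrow> \<tau> s \<in> carrier E.U"
  using inc_closed t_closed by (simp add: \<tau>_apply)

lemma \<Phi>_\<tau>:
  assumes "s \<in> {1..p}" "\<And>r. r < s \<Longrightarrow> \<alpha> r = 0"
  shows "Rep_lin_op (\<Phi> (\<tau> s)) (unit_fun \<alpha>) = unit_fun (\<alpha>(s := Suc (\<alpha> s)))"
proof -
  obtain i j where ij: "1 \<le> i" "i \<le> j" "j \<le> m" "s = pair_index i j"
    using index_pair_cases[OF assms(1)] .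
  have "\<Phi> (\<tau> s) = rep (t s)" using \<Phi>_inc[OF t_closed[OF assms(1)]] by (simp add: \<tau>_apply)
  also have "\<dots> = G.basis_op (if i = j then (0, j) else (i, j))"
    unfolding ij(4) t_pair[OF ij(1-3)] using ij by (intro rep_b) (auto simp: index_def pairs_def)
  finally show ?thesis using assms(2) ij G.X_unit[of j \<alpha>] mult_op_unit[of s \<alpha> d]
    by (auto simp: G.basis_op_def G.Y_def split: if_splits)
qed

lemma \<Phi>_\<tau>_pow:
  assumes "s \<in> {1..p}" "\<And>r. r < s \<Longrightarrow> \<alpha> r = 0"
  shows "Rep_lin_op (\<Phi> (\<tau> s [^]\<^bsub>E.U\<^esub> (k::nat))) (unit_fun \<alpha>) = unit_fun (\<alpha>(s := \<alpha> s + k))"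
  using assms(2)
proof (induction k arbitrary: \<alpha>)
  case 0
  then show ?case using alg_homs_one[OF \<Phi>_hom] by (simp add: Rep_lin_op_simps)
next
  case (Suc k)
  have "\<Phi> (\<tau> s [^]\<^bsub>E.U\<^esub> Suc k) = \<Phi> (\<tau> s [^]\<^bsub>E.U\<^esub> k) * \<Phi> (\<tau> s)"
    using alg_homs_mult[OF \<Phi>_hom E.U.pow_closed[OF \<tau>_closed[OF assms(1)]] \<tau>_closed[OF assms(1)]] by simp
  moreover have "Rep_lin_op (\<Phi> (\<tau> s [^]\<^bsub>E.U\<^esub> k)) (unit_fun (\<alpha>(s := Suc (\<alpha> s)))) =
      unit_fun ((\<alpha>(s := Suc (\<alpha> s)))(s := (\<alpha>(s := Suc (\<alpha> s))) s + k))"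
    by (rule Suc.IH) (use Suc.prems in auto)
  ultimately show ?case using \<Phi>_\<tau>[OF assms(1), of \<alpha>] Suc.prems
    by (simp only: Rep_lin_op_simps fun_upd_same fun_upd_upd add_Suc add_Suc_right)
qed

abbreviation mon where "mon \<equiv> monomial E.U \<tau>"

lemma mon_closed: "n \<le> p \<Longrightarrow> mon n \<alpha> \<in> carrier E.U"
  by (induction n) (use \<tau>_closed in \<open>auto intro!: E.U.m_closed E.U.pow_closed\<close>)

text \<open>The last factor acts first, and at that moment the exponents of all lower variables are
  still 0; this is the situation in which \<open>\<Phi>_\<tau>_pow\<close> produces no color
  factor.\<close>

lemma \<Phi>_mon:
  assumes "n \<le> p" "\<And>r. r \<le> n \<Longrightarrow> \<beta> r = 0"
  shows "Rep_lin_op (\<Phi> (mon n \<alpha>)) (unit_fun \<beta>) = unit_fun (\<lambda>i. \<beta> i + (if i \<in> {1..n} then \<alpha> i else 0))"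
  using assms
proof (induction n arbitrary: \<beta>)
  case 0
  then show ?case using alg_homs_one[OF \<Phi>_hom] by (simp add: Rep_lin_op_simps)
next
  case (Suc n)
  have s: "Suc n \<in> {1..p}" using Suc.prems by simp
  have "\<Phi> (mon (Suc n) \<alpha>) = \<Phi> (mon n \<alpha>) * \<Phi> (\<tau> (Suc n) [^]\<^bsub>E.U\<^esub> \<alpha> (Suc n))"
    using alg_homs_mult[OF \<Phi>_hom mon_closed E.U.pow_closed[OF \<tau>_closed[OF s]], of n] Suc.prems by simp
  then have "Rep_lin_op (\<Phi> (mon (Suc n) \<alpha>)) (unit_fun \<beta>) =
      Rep_lin_op (\<Phi> (mon n \<alpha>)) (unit_fun (\<beta>(Suc n := \<beta> (Suc n) + \<alpha> (Suc n))))"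
    using \<Phi>_\<tau>_pow[OF s, of \<beta> "\<alpha> (Suc n)"] Suc.prems by (simp add: Rep_lin_op_simps)
  also have "\<dots> = unit_fun (\<lambda>i. (\<beta>(Suc n := \<beta> (Suc n) + \<alpha> (Suc n))) i + (if i \<in> {1..n} then \<alpha> i else 0))"
    using Suc.prems by (intro Suc.IH) auto
  also have "(\<lambda>i. (\<beta>(Suc n := \<beta> (Suc n) + \<alpha> (Suc n))) i + (if i \<in> {1..n} then \<alpha> i else 0)) =
      (\<lambda>i. \<beta> i + (if i \<in> {1..Suc n} then \<alpha> i else 0))"
    by (auto simp: fun_eq_iff)
  finally show ?case .
qed

text \<open>Applying the representation to the unit vector at \<open>0\<close> reads off the coefficients.\<close>

definition co where "co u = Rep_lin_op (\<Phi> u) (unit_fun (\<lambda>i. 0))"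

lemma co_mon: "\<alpha> \<in> nat_pow p \<Longrightarrow> co (mon p \<alpha>) = unit_fun \<alpha>"
proof -
  assume "\<alpha> \<in> nat_pow p"
  then have "(\<lambda>i. if i \<in> {1..p} then \<alpha> i else 0) = \<alpha>" by (auto simp: nat_pow_def fun_eq_iff)
  then show ?thesis unfolding co_def using \<Phi>_mon[of p "\<lambda>i. 0" \<alpha>] by simp
qed

lemma co_add: "u \<in> carrier E.U \<Longrightarrow> v \<in> carrier E.U \<Longrightarrow> co (u \<oplus>\<^sub>U v) \<alpha> = co u \<alpha> + co v \<alpha>"
  and co_smult: "u \<in> carrier E.U \<Longrightarrow> co (c \<odot>\<^sub>U u) \<alpha> = c * co u \<alpha>"
  by (simp_all add: co_def alg_homs_add[OF \<Phi>_hom] alg_homs_smult[OF \<Phi>_hom] Rep_lin_op_simps)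

end

subsection \<open>Ordered monomials form a basis\<close>

context generic_gens
begin

text \<open>A correction arises only between two of the x_j. Their bracket sits in the column of the
  later one, which is t_n, and before it in that column, so its index is smaller than n.\<close>

lemma \<tau>_swap:
  assumes "s \<in> {1..<n}" "n \<le> p"
  shows "\<exists>q c s'. q \<noteq> 0 \<and> s' \<in> {1..<n} \<and>
    \<tau> n \<otimes>\<^sub>U \<tau> s = q \<odot>\<^sub>U (\<tau> s \<otimes>\<^sub>U \<tau> n) \<oplus>\<^sub>U c \<odot>\<^sub>U \<tau> s'"
proof -
  obtain i j where n: "1 \<le> i" "i \<le> j" "j \<le> m" "n = pair_index i j"
    using index_pair_cases[of n] assms by auto
  obtain i' j' where s: "1 \<le> i'" "i' \<le> j'" "j' \<le> m" "s = pair_index i' j'"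
    using index_pair_cases[of s] assms by auto
  define qn where "qn = (if i = j then (0, j) else (i, j))"
  define qs where "qs = (if i' = j' then (0, j') else (i', j'))"
  have tn: "t n = b qn" "qn \<in> index" unfolding n(4) t_pair[OF n(1-3)] qn_def
    using n by (auto simp: index_def pairs_def)
  have ts: "t s = b qs" "qs \<in> index" unfolding s(4) t_pair[OF s(1-3)] qs_def
    using s by (auto simp: index_def pairs_def)
  have cl: "\<tau> s \<in> carrier E.U" "\<tau> n \<in> carrier E.U" using \<tau>_closed assms by auto
  have rel: "\<tau> n \<otimes>\<^sub>U \<tau> s = \<epsilon> (deg qn) (deg qs) \<odot>\<^sub>U (\<tau> s \<otimes>\<^sub>U \<tau> n)
      \<oplus>\<^sub>U E.inc (bracket L (b qn) (b qs))"
    using inc_relation[OF b_homog[OF tn(2)] b_homog[OF ts(2)]] tn ts by (simp add: \<tau>_apply)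
  show ?thesis
  proof (cases "i = j \<and> i' = j'")
    case False
    then have "qn \<in> pairs \<or> qs \<in> pairs" using n s by (auto simp: qn_def qs_def pairs_def)
    then have "bracket L (b qn) (b qs) = \<zero>" using bracket_plus_zero tn ts by blast
    \<comment> \<open>There is no correction; an index below n is named with coefficient 0.\<close>
    then have "\<tau> n \<otimes>\<^sub>U \<tau> s = \<epsilon> (deg qn) (deg qs) \<odot>\<^sub>U (\<tau> s \<otimes>\<^sub>U \<tau> n)
      \<oplus>\<^sub>U 0 \<odot>\<^sub>U \<tau> s"
      using rel cl by (simp add: inc_zero)
    then show ?thesis using nonzero assms by blast
  next
    case True
    have "\<not> j < j'" using pair_index_less[of j j j' j'] True n s assms by auto
    moreover have "j \<noteq> j'" using True n s assms by auto
    ultimately have lt: "j' < j" by linarith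
    have x: "x j \<in> homog L (gx j)" "x j' \<in> homog L (gx j')" using x_homog n s by auto
    then have c: "bracket L (x j') (x j) \<in> carrier L" using homog_closed bracket_closed by blast
    have "bracket L (b qn) (b qs) = (- \<epsilon> (gx j) (gx j')) \<odot> bracket L (x j') (x j)"
      using color_skew[OF x] c True by (simp add: qn_def qs_def b_def vec_minus_eq vec_smult_smult)
    also have "bracket L (x j') (x j) = t (pair_index j' j)"
      using t_off_diag[of j' j] lt n s by simp
    finally have "E.inc (bracket L (b qn) (b qs)) = (- \<epsilon> (gx j) (gx j')) \<odot>\<^sub>U \<tau> (pair_index j' j)"
      using inc_smult[OF c] t_off_diag[of j' j] lt n s by (simp add: \<tau>_apply)
    moreover have "pair_index j' j \<in> {1..<n}" using lt n s True by (simp add: pair_index_def)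
    ultimately show ?thesis using rel nonzero by metis
  qed
qed

sublocale UV: kvec E.U by (rule E.U.kvec)

section \<open>The filtration by total degree\<close>

definition size_upto :: "nat \<Rightarrow> (nat \<Rightarrow> nat) \<Rightarrow> nat" where "size_upto n \<alpha> = (\<Sum>i\<in>{1..n}. \<alpha> i)"

text \<open>The span of the ordered monomials in the first n generators of total degree less than k.
  With the strict bound a leading monomial of degree k has its remainder in \<open>filt n k\<close>.
  Values of \<alpha> outside {1..n} do not affect \<open>mon n \<alpha>\<close>, so \<alpha> ranges
  over all functions.\<close>

inductive_set filt :: "nat \<Rightarrow> nat \<Rightarrow> ('v list \<Rightarrow> 'k) set set set" for n k where
  filt_zero: "\<zero>\<^sub>U \<in> filt n k"
| filt_add: "u \<in> filt n k \<Longrightarrow> size_upto n \<alpha> < k \<Longrightarrow> c \<odot>\<^sub>U mon n \<alpha> \<oplus>\<^sub>U u \<in> filt n k"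

lemma mon_cong: "(\<And>i. i \<in> {1..n} \<Longrightarrow> \<alpha> i = \<beta> i) \<Longrightarrow> mon n \<alpha> = mon n \<beta>"
  by (induction n) auto

lemma filt_carrier: "n \<le> p \<Longrightarrow> u \<in> filt n k \<Longrightarrow> u \<in> carrier E.U"
  by (rotate_tac, induction rule: filt.induct) (auto simp: mon_closed)

lemma filt_mon: "n \<le> p \<Longrightarrow> size_upto n \<alpha> < k \<Longrightarrow> c \<odot>\<^sub>U mon n \<alpha> \<in> filt n k"
  using filt_add[OF filt_zero, of n \<alpha> k c] by (simp add: mon_closed)

lemma filt_plus:
  assumes "n \<le> p" "u \<in> filt n k" "v \<in> filt n k"
  shows "u \<oplus>\<^sub>U v \<in> filt n k"
  using assms(2)
proof induction
  case filt_zero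
  then show ?case using assms filt_carrier by simp
next
  case (filt_add u \<alpha> c)
  then show ?case
    using filt.filt_add[OF filt_add(3,2), of c] assms filt_carrier[OF assms(1)]
    by (simp add: E.U.a_assoc mon_closed)
qed

lemma filt_smult:
  assumes "n \<le> p" "u \<in> filt n k"
  shows "a \<odot>\<^sub>U u \<in> filt n k"
  using assms(2)
proof induction
  case filt_zero
  then show ?case using filt.filt_zero by simp
next
  case (filt_add u \<alpha> c)
  then show ?case
    using filt.filt_add[OF filt_add(3,2), of "a * c"] assms filt_carrier[OF assms(1) filt_add(1)]
    by (simp add: E.U.smult_add_right E.U.smult_smult mon_closed)
qed

lemma filt_mono: "u \<in> filt n k \<Longrightarrow> k \<le> k' \<Longrightarrow> u \<in> filt n k'"
  by (induction rule: filt.induct) (auto intro: filt.intros)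

text \<open>Right multiplication is linear, so its effect on the filtration is determined on
  monomials.\<close>

lemma filt_linear:
  assumes "n \<le> p" "u \<in> filt n k" "v \<in> carrier E.U"
    and "\<And>\<alpha>. size_upto n \<alpha> < k \<Longrightarrow> mon n \<alpha> \<otimes>\<^sub>U v \<in> filt n' k'" "n' \<le> p"
  shows "u \<otimes>\<^sub>U v \<in> filt n' k'"
  using assms(2)
proof induction
  case filt_zero
  then show ?case using assms filt.filt_zero by simp
next
  case (filt_add u \<alpha> c)
  have "(c \<odot>\<^sub>U mon n \<alpha> \<oplus>\<^sub>U u) \<otimes>\<^sub>U v =
      c \<odot>\<^sub>U (mon n \<alpha> \<otimes>\<^sub>U v) \<oplus>\<^sub>U u \<otimes>\<^sub>U v"
    using mon_closed[OF assms(1)] filt_carrier[OF assms(1) filt_add(1)] assms(3)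
    by (simp add: E.U.l_distr E.U.smult_mult_left)
  then show ?case using filt_plus filt_smult assms(4,5) filt_add by simp
qed

lemma size_upto_Suc: "size_upto (Suc n) \<alpha> = size_upto n \<alpha> + \<alpha> (Suc n)"
  by (simp add: size_upto_def)

lemma size_upto_cong: "(\<And>i. i \<in> {1..n} \<Longrightarrow> \<alpha> i = \<beta> i) \<Longrightarrow> size_upto n \<alpha> = size_upto n \<beta>"
  unfolding size_upto_def by (rule sum.cong) auto

lemma size_upto_upd: "s \<in> {1..n} \<Longrightarrow> size_upto n (\<alpha>(s := Suc (\<alpha> s))) = Suc (size_upto n \<alpha>)"
  unfolding size_upto_def by (subst (1 2) sum.remove[of _ s]) (auto intro: sum.cong)

lemma mon_pow: "mon n \<alpha> \<otimes>\<^sub>U \<tau> (Suc n) [^]\<^bsub>E.U\<^esub> k = mon (Suc n) (\<alpha>(Suc n := k))"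
  using mon_cong[of n \<alpha> "\<alpha>(Suc n := k)"] by simp

lemma filt_pow:
  assumes "Suc n \<le> p" "u \<in> filt n k"
  shows "u \<otimes>\<^sub>U \<tau> (Suc n) [^]\<^bsub>E.U\<^esub> (j::nat) \<in> filt (Suc n) (k + j)"
proof (rule filt_linear[OF _ assms(2)])
  have \<tau>: "\<tau> (Suc n) \<in> carrier E.U" by (rule \<tau>_closed) (use assms in auto)
  then show "\<tau> (Suc n) [^]\<^bsub>E.U\<^esub> j \<in> carrier E.U" by (rule E.U.pow_closed)
  fix \<alpha> assume "size_upto n \<alpha> < k"
  then have "size_upto (Suc n) (\<alpha>(Suc n := j)) < k + j"
    using size_upto_cong[of n "\<alpha>(Suc n := j)" \<alpha>] by (simp add: size_upto_Suc)
  then show "mon n \<alpha> \<otimes>\<^sub>U \<tau> (Suc n) [^]\<^bsub>E.U\<^esub> j \<in> filt (Suc n) (k + j)"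
    using filt_mon[OF assms(1), of "\<alpha>(Suc n := j)" _ 1] mon_closed[OF assms(1)] unfolding mon_pow
    by (simp del: monomial.simps)
qed (use assms in auto)

lemma mon_last: "Suc n \<le> p \<Longrightarrow> mon (Suc n) \<alpha> \<otimes>\<^sub>U \<tau> (Suc n) = mon (Suc n) (\<alpha>(Suc n := Suc (\<alpha> (Suc n))))"
  using mon_cong[of n "\<alpha>(Suc n := Suc (\<alpha> (Suc n)))" \<alpha>] mon_closed[of n] \<tau>_closed[of "Suc n"]
  by (simp add: E.U.m_assoc)

lemma filt_last:
  assumes "Suc n \<le> p" "u \<in> filt (Suc n) k"
  shows "u \<otimes>\<^sub>U \<tau> (Suc n) \<in> filt (Suc n) (Suc k)"
proof (rule filt_linear[OF _ assms(2)])
  fix \<alpha> assume "size_upto (Suc n) \<alpha> < k"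
  then show "mon (Suc n) \<alpha> \<otimes>\<^sub>U \<tau> (Suc n) \<in> filt (Suc n) (Suc k)"
    using filt_mon[OF assms(1), of "\<alpha>(Suc n := Suc (\<alpha> (Suc n)))" "Suc k" 1] mon_closed[OF assms(1)]
    unfolding mon_last[OF assms(1)] by (simp add: size_upto_upd del: monomial.simps)
qed (use assms \<tau>_closed in auto)

text \<open>The scalar q collects color factors; that it is nonzero is all that is recorded about
  it.\<close>

definition mult_leading where
  "mult_leading n k u v \<alpha> \<longleftrightarrow> (\<exists>q w. q \<noteq> 0 \<and> w \<in> filt n k \<and>
     u \<otimes>\<^sub>U v = q \<odot>\<^sub>U mon n \<alpha> \<oplus>\<^sub>U w)"

lemma mult_leadingI:
  "u \<otimes>\<^sub>U v = q \<odot>\<^sub>U mon n \<alpha> \<oplus>\<^sub>U w \<Longrightarrow> w \<in> filt n k \<Longrightarrow> q \<noteq> 0 \<Longrightarrow> mult_leading n k u v \<alpha>"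
  unfolding mult_leading_def by blast

lemma mult_leading_filt:
  assumes "mult_leading n k u v \<alpha>" "n \<le> p" "k \<le> k'" "size_upto n \<alpha> < k'"
  shows "u \<otimes>\<^sub>U v \<in> filt n k'"
proof -
  obtain q w where qw: "w \<in> filt n k" "u \<otimes>\<^sub>U v = q \<odot>\<^sub>U mon n \<alpha> \<oplus>\<^sub>U w"
    using assms(1) unfolding mult_leading_def by blast
  show ?thesis unfolding qw(2) by (rule filt.filt_add[OF filt_mono[OF qw(1) assms(3)] assms(4)])
qed

text \<open>The two nested inductions move \<open>t\<^sub>s\<close> to the left through the powers of \<open>t\<^sub>n\<close>, for
  \<open>n\<close> decreasing.  The correction term of a swap is a generator of index below \<open>n\<close>.\<close>

lemma mon_\<tau>:
  assumes "n \<le> p" "s \<in> {1..n}"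
  shows "mult_leading n (Suc (size_upto n \<alpha>)) (mon n \<alpha>) (\<tau> s) (\<alpha>(s := Suc (\<alpha> s)))"
  using assms
proof (induction n arbitrary: s \<alpha>)
  case 0
  then show ?case by simp
next
  case (Suc n)
  let ?\<tau> = "\<tau> (Suc n)"
  have \<tau>: "?\<tau> \<in> carrier E.U" using \<tau>_closed[of "Suc n"] Suc.prems by simp
  have n: "n \<le> p" using Suc.prems by simp
  note mc = mon_closed[OF n] mon_closed[OF Suc.prems(1)]
  have main: "mult_leading (Suc n) (Suc (size_upto n \<alpha> + k)) (mon n \<alpha> \<otimes>\<^sub>U ?\<tau> [^]\<^bsub>E.U\<^esub> k) (\<tau> s)
      (\<alpha>(s := Suc (\<alpha> s), Suc n := k))" if "s \<in> {1..n}" for s k and \<alpha> :: "nat \<Rightarrow> nat"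
    using that
  proof (induction k arbitrary: s)
    case 0
    obtain q w where qw: "q \<noteq> 0" "w \<in> filt n (Suc (size_upto n \<alpha>))"
      "mon n \<alpha> \<otimes>\<^sub>U \<tau> s = q \<odot>\<^sub>U mon n (\<alpha>(s := Suc (\<alpha> s))) \<oplus>\<^sub>U w"
      using Suc.IH[OF n 0, of \<alpha>] unfolding mult_leading_def by blast
    have wc: "w \<in> carrier E.U" using filt_carrier[OF n qw(2)] .
    have "w \<in> filt (Suc n) (Suc (size_upto n \<alpha>))"
      using filt_pow[OF Suc.prems(1) qw(2), of 0] wc by simp
    moreover have "mon n (\<alpha>(s := Suc (\<alpha> s))) = mon (Suc n) (\<alpha>(s := Suc (\<alpha> s), Suc n := 0))"
      using mon_pow[of n "\<alpha>(s := Suc (\<alpha> s))" 0] mc by (simp del: monomial.simps)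
    moreover have "mon n \<alpha> \<otimes>\<^sub>U ?\<tau> [^]\<^bsub>E.U\<^esub> (0::nat) \<otimes>\<^sub>U \<tau> s = mon n \<alpha> \<otimes>\<^sub>U \<tau> s"
      using mc by simp
    ultimately show ?case using qw(1,3) unfolding mult_leading_def
      by (metis add_0_right)
  next
    case (Suc k)
    let ?P = "mon n \<alpha> \<otimes>\<^sub>U ?\<tau> [^]\<^bsub>E.U\<^esub> k"
    have P: "?P \<in> carrier E.U" using mc \<tau> by simp
    have s: "\<tau> s \<in> carrier E.U" using Suc.prems n by (intro \<tau>_closed) auto
    obtain q c s' where swap: "q \<noteq> 0" "s' \<in> {1..<Suc n}"
      "?\<tau> \<otimes>\<^sub>U \<tau> s = q \<odot>\<^sub>U (\<tau> s \<otimes>\<^sub>U ?\<tau>) \<oplus>\<^sub>U c \<odot>\<^sub>U \<tau> s'"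
      using \<tau>_swap[of s "Suc n"] Suc.prems \<open>Suc n \<le> p\<close> by auto
    have s'n: "s' \<in> {1..n}" using swap(2) by auto
    have s': "\<tau> s' \<in> carrier E.U" using s'n n by (intro \<tau>_closed) auto
    obtain q2 w2 where 2: "q2 \<noteq> 0" "w2 \<in> filt (Suc n) (Suc (size_upto n \<alpha> + k))"
      "?P \<otimes>\<^sub>U \<tau> s = q2 \<odot>\<^sub>U mon (Suc n) (\<alpha>(s := Suc (\<alpha> s), Suc n := k)) \<oplus>\<^sub>U w2"
      using Suc.IH[OF Suc.prems] unfolding mult_leading_def by blast
    have w2: "w2 \<in> carrier E.U" using filt_carrier[OF \<open>Suc n \<le> p\<close> 2(2)] .
    have sz: "size_upto (Suc n) (\<alpha>(s' := Suc (\<alpha> s'), Suc n := k)) = Suc (size_upto n \<alpha> + k)"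
      using size_upto_cong[of n "\<alpha>(s' := Suc (\<alpha> s'), Suc n := k)" "\<alpha>(s' := Suc (\<alpha> s'))"] size_upto_upd[OF s'n, of \<alpha>]
      by (simp add: size_upto_Suc)
    \<comment> \<open>The correction term has one factor \<open>\<tau> (Suc n)\<close> less, so even
      its leading monomial has lower degree than the one sought and counts as remainder.\<close>
    have 3: "?P \<otimes>\<^sub>U \<tau> s' \<in> filt (Suc n) (Suc (size_upto n \<alpha> + Suc k))"
      by (rule mult_leading_filt[OF Suc.IH[OF s'n] \<open>Suc n \<le> p\<close>]) (simp, unfold sz, simp)
    let ?w = "(q \<odot>\<^sub>U (w2 \<otimes>\<^sub>U ?\<tau>)) \<oplus>\<^sub>U c \<odot>\<^sub>U (?P \<otimes>\<^sub>U \<tau> s')"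
    have "w2 \<otimes>\<^sub>U ?\<tau> \<in> filt (Suc n) (Suc (size_upto n \<alpha> + Suc k))"
      using filt_last[OF \<open>Suc n \<le> p\<close> 2(2)] by simp
    then have w: "?w \<in> filt (Suc n) (Suc (size_upto n \<alpha> + Suc k))"
      using 3 filt_plus filt_smult \<open>Suc n \<le> p\<close> by simp
    have "mon n \<alpha> \<otimes>\<^sub>U ?\<tau> [^]\<^bsub>E.U\<^esub> Suc k \<otimes>\<^sub>U \<tau> s = ?P \<otimes>\<^sub>U (?\<tau> \<otimes>\<^sub>U \<tau> s)"
      using mc \<tau> s by (simp add: E.U.m_assoc)
    also have "\<dots> = q \<odot>\<^sub>U ((?P \<otimes>\<^sub>U \<tau> s) \<otimes>\<^sub>U ?\<tau>) \<oplus>\<^sub>U c \<odot>\<^sub>U (?P \<otimes>\<^sub>U \<tau> s')"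
      unfolding swap(3) using P \<tau> s s'
      by (simp only: E.U.r_distr E.U.smult_closed E.U.m_closed E.U.smult_mult_right E.U.m_assoc)
    also have "(?P \<otimes>\<^sub>U \<tau> s) \<otimes>\<^sub>U ?\<tau> =
        q2 \<odot>\<^sub>U mon (Suc n) (\<alpha>(s := Suc (\<alpha> s), Suc n := Suc k)) \<oplus>\<^sub>U w2 \<otimes>\<^sub>U ?\<tau>"
      unfolding 2(3) using mon_last[OF \<open>Suc n \<le> p\<close>, of "\<alpha>(s := Suc (\<alpha> s), Suc n := k)"] mc w2 \<tau>
      by (simp only: E.U.l_distr E.U.smult_closed E.U.m_closed E.U.smult_mult_left fun_upd_same fun_upd_upd)
    also have "q \<odot>\<^sub>U (q2 \<odot>\<^sub>U mon (Suc n) (\<alpha>(s := Suc (\<alpha> s), Suc n := Suc k)) \<oplus>\<^sub>U w2 \<otimes>\<^sub>U ?\<tau>)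
        \<oplus>\<^sub>U c \<odot>\<^sub>U (?P \<otimes>\<^sub>U \<tau> s') =
        (q * q2) \<odot>\<^sub>U mon (Suc n) (\<alpha>(s := Suc (\<alpha> s), Suc n := Suc k)) \<oplus>\<^sub>U ?w"
      using mc w2 \<tau> P s'
      by (simp only: E.U.smult_add_right E.U.smult_smult E.U.smult_closed E.U.m_closed E.U.a_assoc)
    finally show ?case by (rule mult_leadingI[OF _ w]) (use swap(1) 2(1) in simp)
  qed
  show ?case
  proof (cases "s = Suc n")
    case True
    have *: "mon (Suc n) \<alpha> \<otimes>\<^sub>U \<tau> s = 1 \<odot>\<^sub>U mon (Suc n) (\<alpha>(s := Suc (\<alpha> s))) \<oplus>\<^sub>U \<zero>\<^sub>U"
      using mon_last[OF Suc.prems(1), of \<alpha>] mc True by (simp del: monomial.simps)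
    show ?thesis by (rule mult_leadingI[OF * filt.filt_zero]) simp
  next
    case False
    then have "s \<in> {1..n}" using Suc.prems by auto
    moreover have "\<alpha>(s := Suc (\<alpha> s), Suc n := \<alpha> (Suc n)) = \<alpha>(s := Suc (\<alpha> s))" using False by auto
    ultimately show ?thesis using main[of s \<alpha> "\<alpha> (Suc n)"]
      by (simp only: size_upto_Suc monomial.simps)
  qed
qed

lemma filt_\<tau>:
  assumes "u \<in> filt p k" "s \<in> {1..p}"
  shows "u \<otimes>\<^sub>U \<tau> s \<in> filt p (Suc k)"
  by (rule filt_linear[OF _ assms(1)])
    (use assms \<tau>_closed mult_leading_filt[OF mon_\<tau>] in \<open>auto simp: size_upto_upd\<close>)

lemma filt_\<tau>_pow:
  assumes "u \<in> filt p k" "s \<in> {1..p}"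
  shows "u \<otimes>\<^sub>U \<tau> s [^]\<^bsub>E.U\<^esub> (j::nat) \<in> filt p (k + j)"
proof (induction j)
  case 0
  then show ?case using assms filt_carrier[OF order_refl assms(1)] by simp
next
  case (Suc j)
  show ?case using filt_\<tau>[OF Suc assms(2)] filt_carrier[OF _ assms(1)] \<tau>_closed[OF assms(2)]
    by (simp add: E.U.m_assoc)
qed

lemma mon_\<tau>_pow:
  assumes s: "s \<in> {1..p}"
  shows "mult_leading p (size_upto p \<alpha> + j) (mon p \<alpha>) (\<tau> s [^]\<^bsub>E.U\<^esub> (j::nat)) (\<alpha>(s := \<alpha> s + j))"
proof (induction j)
  case 0
  have *: "mon p \<alpha> \<otimes>\<^sub>U \<tau> s [^]\<^bsub>E.U\<^esub> (0::nat) = 1 \<odot>\<^sub>U mon p \<alpha> \<oplus>\<^sub>U \<zero>\<^sub>U"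
    using mon_closed by simp
  show ?case unfolding add_0_right fun_upd_triv by (rule mult_leadingI[OF * filt.filt_zero]) simp
next
  case (Suc j)
  obtain q w where 1: "q \<noteq> 0" "w \<in> filt p (size_upto p \<alpha> + j)"
    "mon p \<alpha> \<otimes>\<^sub>U \<tau> s [^]\<^bsub>E.U\<^esub> j = q \<odot>\<^sub>U mon p (\<alpha>(s := \<alpha> s + j)) \<oplus>\<^sub>U w"
    using Suc unfolding mult_leading_def by blast
  have sz: "size_upto p (\<alpha>(s := \<alpha> s + j)) = size_upto p \<alpha> + j"
    unfolding size_upto_def using s by (subst (1 2) sum.remove[of _ s]) (auto intro: sum.cong)
  obtain q' w' where 2: "q' \<noteq> 0" "w' \<in> filt p (Suc (size_upto p \<alpha> + j))"
    "mon p (\<alpha>(s := \<alpha> s + j)) \<otimes>\<^sub>U \<tau> s = q' \<odot>\<^sub>U mon p (\<alpha>(s := \<alpha> s + Suc j)) \<oplus>\<^sub>U w'"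
    using mon_\<tau>[OF _ s, of "\<alpha>(s := \<alpha> s + j)"] unfolding mult_leading_def by (auto simp: sz)
  have c: "w \<in> carrier E.U" "w' \<in> carrier E.U" "\<tau> s \<in> carrier E.U"
    using filt_carrier 1(2) 2(2) \<tau>_closed[OF s] by blast+
  note mc = mon_closed[OF order_refl]
  let ?w = "q \<odot>\<^sub>U w' \<oplus>\<^sub>U w \<otimes>\<^sub>U \<tau> s"
  have "mon p \<alpha> \<otimes>\<^sub>U \<tau> s [^]\<^bsub>E.U\<^esub> Suc j = (mon p \<alpha> \<otimes>\<^sub>U \<tau> s [^]\<^bsub>E.U\<^esub> j) \<otimes>\<^sub>U \<tau> s"
    using mc c(3) by (simp add: E.U.m_assoc)
  also have "\<dots> = q \<odot>\<^sub>U (mon p (\<alpha>(s := \<alpha> s + j)) \<otimes>\<^sub>U \<tau> s) \<oplus>\<^sub>U w \<otimes>\<^sub>U \<tau> s"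
    unfolding 1(3) using mc c by (simp only: E.U.l_distr E.U.smult_closed E.U.smult_mult_left)
  also have "\<dots> = (q * q') \<odot>\<^sub>U mon p (\<alpha>(s := \<alpha> s + Suc j)) \<oplus>\<^sub>U ?w"
    unfolding 2(3) using mc c
    by (simp only: E.U.smult_add_right E.U.smult_smult E.U.smult_closed E.U.m_closed E.U.a_assoc)
  finally have eq: "mon p \<alpha> \<otimes>\<^sub>U \<tau> s [^]\<^bsub>E.U\<^esub> Suc j =
      (q * q') \<odot>\<^sub>U mon p (\<alpha>(s := \<alpha> s + Suc j)) \<oplus>\<^sub>U ?w" .
  have w: "?w \<in> filt p (size_upto p \<alpha> + Suc j)"
    using filt_plus filt_smult 2(2) filt_\<tau>[OF 1(2) s] by simp
  show ?case by (rule mult_leadingI[OF eq w]) (use 1(1) 2(1) in simp)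
qed

text \<open>The right monomial is multiplied in one generator power at a time; total degrees add, so
  the remainders stay below the degree of the leading monomial.\<close>

lemma mon_mon:
  assumes "n \<le> p"
  shows "mult_leading p (size_upto p \<alpha> + size_upto n \<beta>) (mon p \<alpha>) (mon n \<beta>)
    (\<lambda>i. \<alpha> i + (if i \<in> {1..n} then \<beta> i else 0))"
  using assms
proof (induction n)
  case 0
  have *: "mon p \<alpha> \<otimes>\<^sub>U mon 0 \<beta> = 1 \<odot>\<^sub>U mon p \<alpha> \<oplus>\<^sub>U \<zero>\<^sub>U"
    using mon_closed by simp
  have eq: "(\<lambda>i. \<alpha> i + (if i \<in> {1..0} then \<beta> i else 0)) = \<alpha>" by auto
  show ?case unfolding eq by (rule mult_leadingI[OF * filt.filt_zero]) simp
next
  case (Suc n)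
  have s: "Suc n \<in> {1..p}" using Suc.prems by simp
  let ?\<gamma> = "\<lambda>i. \<alpha> i + (if i \<in> {1..n} then \<beta> i else 0)"
  let ?\<gamma>' = "\<lambda>i. \<alpha> i + (if i \<in> {1..Suc n} then \<beta> i else 0)"
  let ?T = "\<tau> (Suc n) [^]\<^bsub>E.U\<^esub> \<beta> (Suc n)"
  obtain q w where 1: "q \<noteq> 0" "w \<in> filt p (size_upto p \<alpha> + size_upto n \<beta>)"
    "mon p \<alpha> \<otimes>\<^sub>U mon n \<beta> = q \<odot>\<^sub>U mon p ?\<gamma> \<oplus>\<^sub>U w"
    using Suc unfolding mult_leading_def by auto
  have sz: "size_upto p ?\<gamma> = size_upto p \<alpha> + size_upto n \<beta>"
  proof -
    have "(\<Sum>i\<in>{1..p}. if i \<in> {1..n} then \<beta> i else 0) = (\<Sum>i\<in>{1..n}. \<beta> i)"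
      using Suc.prems by (intro sum.mono_neutral_cong_right) auto
    then show ?thesis by (simp add: size_upto_def sum.distrib)
  qed
  have \<gamma>': "?\<gamma>(Suc n := ?\<gamma> (Suc n) + \<beta> (Suc n)) = ?\<gamma>'" by (auto simp: fun_eq_iff)
  obtain q' w' where 2: "q' \<noteq> 0" "w' \<in> filt p (size_upto p \<alpha> + size_upto n \<beta> + \<beta> (Suc n))"
    "mon p ?\<gamma> \<otimes>\<^sub>U ?T = q' \<odot>\<^sub>U mon p ?\<gamma>' \<oplus>\<^sub>U w'"
    using mon_\<tau>_pow[OF s, of ?\<gamma> "\<beta> (Suc n)"] unfolding mult_leading_def sz \<gamma>' by blast
  have T: "?T \<in> carrier E.U" by (rule E.U.pow_closed[OF \<tau>_closed[OF s]])
  have c: "w \<in> carrier E.U" "w' \<in> carrier E.U" using filt_carrier 1(2) 2(2) by blast+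
  note mc = mon_closed[OF order_refl]
  let ?w = "q \<odot>\<^sub>U w' \<oplus>\<^sub>U w \<otimes>\<^sub>U ?T"
  have "mon p \<alpha> \<otimes>\<^sub>U mon (Suc n) \<beta> = (mon p \<alpha> \<otimes>\<^sub>U mon n \<beta>) \<otimes>\<^sub>U ?T"
    using mc mon_closed[of n] T Suc.prems by (simp add: E.U.m_assoc)
  also have "\<dots> = q \<odot>\<^sub>U (mon p ?\<gamma> \<otimes>\<^sub>U ?T) \<oplus>\<^sub>U w \<otimes>\<^sub>U ?T"
    unfolding 1(3) using mc c T by (simp only: E.U.l_distr E.U.smult_closed E.U.smult_mult_left)
  also have "\<dots> = (q * q') \<odot>\<^sub>U mon p ?\<gamma>' \<oplus>\<^sub>U ?w"
    unfolding 2(3) using mc c T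
    by (simp only: E.U.smult_add_right E.U.smult_smult E.U.smult_closed E.U.m_closed E.U.a_assoc)
  finally have eq: "mon p \<alpha> \<otimes>\<^sub>U mon (Suc n) \<beta> =
      (q * q') \<odot>\<^sub>U mon p ?\<gamma>' \<oplus>\<^sub>U ?w" .
  have w: "?w \<in> filt p (size_upto p \<alpha> + size_upto (Suc n) \<beta>)"
    using filt_plus filt_smult 2(2) filt_\<tau>_pow[OF 1(2) s, of "\<beta> (Suc n)"]
    by (simp add: size_upto_Suc add.assoc)
  show ?case by (rule mult_leadingI[OF eq w]) (use 1(1) 2(1) in simp)
qed

section \<open>Coefficients with respect to the ordered monomials\<close>

lemma mon_restrict:
  obtains \<beta> where "\<beta> \<in> nat_pow p" "mon p \<alpha> = mon p \<beta>" "size_upto p \<beta> = size_upto p \<alpha>"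
proof (rule that[of "\<lambda>i. if i \<in> {1..p} then \<alpha> i else 0"])
  show "mon p \<alpha> = mon p (\<lambda>i. if i \<in> {1..p} then \<alpha> i else 0)"
    by (rule mon_cong) simp
  show "size_upto p (\<lambda>i. if i \<in> {1..p} then \<alpha> i else 0) = size_upto p \<alpha>"
    by (rule size_upto_cong) simp
qed (simp add: nat_pow_def)

lemma co_zero: "co \<zero>\<^sub>U = (\<lambda>\<alpha>. 0)"
  using co_smult[of "\<zero>\<^sub>U" 0] by (auto simp: fun_eq_iff)

lemma co_filt:
  assumes "u \<in> filt p k" "size_upto p \<gamma> \<ge> k"
  shows "co u \<gamma> = 0"
  using assms(1)
proof induction
  case (filt_add u \<alpha> c)
  obtain \<beta> where \<beta>: "\<beta> \<in> nat_pow p" "mon p \<alpha> = mon p \<beta>" "size_upto p \<beta> = size_upto p \<alpha>"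
    by (rule mon_restrict)
  then have "\<gamma> \<noteq> \<beta>" using filt_add assms by auto
  then show ?case
    using filt_add \<beta> filt_carrier[OF _ filt_add(1)] mon_closed[of p]
    by (simp add: co_add co_smult co_mon unit_fun_def)
qed (simp add: co_zero)

text \<open>The remainder has too small a total degree to reach \<alpha> + \<beta>, so the
  coefficient there is the nonzero scalar of the leading monomial. In particular the product is
  nonzero, which the \<open>THE\<close> in \<open>exponent\<close> presupposes.\<close>

lemma co_mon_mon:
  assumes "\<alpha> \<in> nat_pow p" "\<beta> \<in> nat_pow p"
  shows "co (mon p \<alpha> \<otimes>\<^sub>U mon p \<beta>) (exp_plus \<alpha> \<beta>) \<noteq> 0"
proof -
  have e: "(\<lambda>i. \<alpha> i + (if i \<in> {1..p} then \<beta> i else 0)) = exp_plus \<alpha> \<beta>"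
    using assms by (auto simp: exp_plus_def nat_pow_def fun_eq_iff)
  have s: "size_upto p (exp_plus \<alpha> \<beta>) = size_upto p \<alpha> + size_upto p \<beta>"
    by (simp add: size_upto_def exp_plus_def sum.distrib)
  have n: "exp_plus \<alpha> \<beta> \<in> nat_pow p" using assms by (simp add: exp_plus_def nat_pow_def)
  obtain q w where qw: "q \<noteq> 0" "w \<in> filt p (size_upto p \<alpha> + size_upto p \<beta>)"
    "mon p \<alpha> \<otimes>\<^sub>U mon p \<beta> = q \<odot>\<^sub>U mon p (exp_plus \<alpha> \<beta>) \<oplus>\<^sub>U w"
    using mon_mon[OF order_refl, of \<alpha> \<beta>] unfolding mult_leading_def e by blast
  show ?thesis unfolding qw(3)
    using qw(1) co_filt[OF qw(2)] s n filt_carrier[OF _ qw(2)] mon_closed[of p]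
    by (simp add: co_add co_smult co_mon unit_fun_def)
qed

text \<open>The relation of x_j with itself has \<epsilon> = -1 and reads x^2 = -x^2 + [x, x]. It
  expresses the one kind of basis vector of L that is not among the t_s.\<close>

lemma inc_bracket_self:
  assumes j: "j \<in> {1..m}"
  shows "E.inc (bracket L (x j) (x j)) = E.inc (x j) \<otimes>\<^sub>U E.inc (x j) \<oplus>\<^sub>U E.inc (x j) \<otimes>\<^sub>U E.inc (x j)"
proof -
  have c: "x j \<in> homog L (gx j)" by (rule x_homog[OF j])
  have xj: "x j \<in> carrier L" using homog_closed[OF c] .
  let ?x = "E.inc (x j)" and ?y = "E.inc (bracket L (x j) (x j))"
  have xc: "?x \<in> carrier E.U" "?y \<in> carrier E.U" using inc_closed xj bracket_closed[OF xj xj] by auto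
  have "?x \<otimes>\<^sub>U ?x = (- 1) \<odot>\<^sub>U (?x \<otimes>\<^sub>U ?x) \<oplus>\<^sub>U ?y"
    using inc_relation[OF c c] gx_odd[OF j] by simp
  then have "?x \<otimes>\<^sub>U ?x \<oplus>\<^sub>U ?x \<otimes>\<^sub>U ?x =
      ?x \<otimes>\<^sub>U ?x \<oplus>\<^sub>U ((- 1) \<odot>\<^sub>U (?x \<otimes>\<^sub>U ?x) \<oplus>\<^sub>U ?y)"
    by (rule arg_cong)
  also have "\<dots> = ?y"
    using xc by (simp add: E.U.smult_minus_one E.U.r_neg2)
  finally show ?thesis ..
qed

text \<open>The inductive property is that right multiplication by u maps ordered combinations to
  ordered combinations; unlike membership itself it is visibly closed under products. Applying it to
  1 gives the claim.\<close>

lemma env_alg_filt: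
  assumes "u \<in> carrier E.U"
  shows "\<exists>k. u \<in> filt p k"
proof -
  define P where "P u \<longleftrightarrow> (\<forall>k. \<forall>v\<in>filt p k. \<exists>k'. v \<otimes>\<^sub>U u \<in> filt p k')" for u
  have fc: "v \<in> filt p k \<Longrightarrow> v \<in> carrier E.U" for v k using filt_carrier by blast
  have plus: "\<exists>k. u \<oplus>\<^sub>U v \<in> filt p k" if "u \<in> filt p k" "v \<in> filt p k'" for u v k k'
    using filt_plus[of p u "max k k'" v] filt_mono[OF that(1)] filt_mono[OF that(2)] by auto
  have P_add: "P (u \<oplus>\<^sub>U v)" if uv: "u \<in> carrier E.U" "v \<in> carrier E.U" "P u" "P v" for u v
    unfolding P_def
  proof (intro allI ballI)
    fix k w assume w: "w \<in> filt p k"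
    obtain k1 k2 where "w \<otimes>\<^sub>U u \<in> filt p k1" "w \<otimes>\<^sub>U v \<in> filt p k2"
      using uv(3,4) w unfolding P_def by blast
    then show "\<exists>k'. w \<otimes>\<^sub>U (u \<oplus>\<^sub>U v) \<in> filt p k'"
      unfolding E.U.r_distr[OF uv(1,2) fc[OF w]] by (rule plus)
  qed
  have P_mult: "P (u \<otimes>\<^sub>U v)" if uv: "u \<in> carrier E.U" "v \<in> carrier E.U" "P u" "P v" for u v
    unfolding P_def
  proof (intro allI ballI)
    fix k w assume w: "w \<in> filt p k"
    obtain k1 where "w \<otimes>\<^sub>U u \<in> filt p k1" using uv(3) w unfolding P_def by blast
    then have "\<exists>k'. (w \<otimes>\<^sub>U u) \<otimes>\<^sub>U v \<in> filt p k'" using uv(4) unfolding P_def by blast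
    then show "\<exists>k'. w \<otimes>\<^sub>U (u \<otimes>\<^sub>U v) \<in> filt p k'"
      by (simp only: E.U.m_assoc[OF fc[OF w] uv(1,2)])
  qed
  have P_smult: "P (c \<odot>\<^sub>U u)" if u: "u \<in> carrier E.U" "P u" for c u
    unfolding P_def
  proof (intro allI ballI)
    fix k w assume w: "w \<in> filt p k"
    obtain k1 where "w \<otimes>\<^sub>U u \<in> filt p k1" using u(2) w unfolding P_def by blast
    then have "c \<odot>\<^sub>U (w \<otimes>\<^sub>U u) \<in> filt p k1" by (rule filt_smult[OF order_refl])
    then show "\<exists>k'. w \<otimes>\<^sub>U (c \<odot>\<^sub>U u) \<in> filt p k'"
      unfolding E.U.smult_mult_right[OF fc[OF w] u(1)] by blast
  qed
  have P_one: "P \<one>\<^sub>U"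
    unfolding P_def
  proof (intro allI ballI)
    fix k w assume w: "w \<in> filt p k"
    then show "\<exists>k'. w \<otimes>\<^sub>U \<one>\<^sub>U \<in> filt p k'"
      unfolding E.U.r_one[OF fc[OF w]] by blast
  qed
  have P_\<tau>: "P (\<tau> s)" if "s \<in> {1..p}" for s unfolding P_def using filt_\<tau> that by blast
  have P_b: "P (E.inc (b q))" if q: "q \<in> index" for q
  proof -
    consider j where "q = (0, j)" "j \<in> {1..m}" | i j where "q = (i, j)" "1 \<le> i" "i \<le> j" "j \<le> m"
      using q by (cases q) (auto simp: index_def pairs_def)
    then show ?thesis
    proof cases
      case 1
      have "pair_index j j \<in> {1..p}" unfolding p pair_index_image[symmetric] using 1 by auto
      then show ?thesis using P_\<tau>[of "pair_index j j"] 1 by (simp add: t_diag b_def \<tau>_apply)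
    next
      case 2
      have s: "pair_index i j \<in> {1..p}" unfolding p pair_index_image[symmetric] using 2 by auto
      show ?thesis
      proof (cases "i = j")
        case False
        then show ?thesis using P_\<tau>[OF s] t_pair[OF 2(2-4)] 2 by (simp add: \<tau>_apply)
      next
        case True
        let ?x = "E.inc (x j)" and ?y = "E.inc (bracket L (x j) (x j))"
        have "?x \<in> carrier E.U" using inc_closed funcset_mem[OF x_closed, of j] 2 by simp
        moreover have "?y = ?x \<otimes>\<^sub>U ?x \<oplus>\<^sub>U ?x \<otimes>\<^sub>U ?x" using inc_bracket_self[of j] 2 by simp
        moreover have "P ?x" using P_\<tau>[OF s] t_diag[of j] 2 True by (simp add: \<tau>_apply)
        ultimately show ?thesis using P_add P_mult 2 True by (simp add: b_def y_def)
      qed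
    qed
  qed
  have P_inc: "P (E.inc v)" if v: "v \<in> carrier L" for v
  proof -
    obtain c where v: "v = comb index b c" using v unfolding b_range by blast
    have "v \<in> {v \<in> carrier L. P (E.inc v)}" unfolding v
    proof (rule comb_in_subset[OF finite_index b_closed], goal_cases)
      case 1
      have "E.inc \<zero> = 0 \<odot>\<^sub>U \<one>\<^sub>U" by (simp add: inc_zero)
      then show ?case using P_smult[OF E.U.one_closed P_one, of 0] by simp
    next
      case (2 v w)
      then show ?case using P_add inc_closed by (simp add: inc_add)
    next
      case (3 q)
      have "b q \<in> carrier L" using 3 b_closed by auto
      then show ?case using P_smult P_b[OF 3(1)] inc_closed by (simp add: inc_smult)
    qed
    then show ?thesis by simp
  qed
  have "P u" using assms
    by (induction rule: E.env_alg_generated) (use P_one P_inc P_add P_mult P_smult in auto)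
  moreover have "\<one>\<^sub>U \<in> filt p 1"
  proof -
    have "mon n (\<lambda>i. 0) = \<one>\<^sub>U" for n
      by (induction n) auto
    then show ?thesis using filt_mon[of p "\<lambda>i. 0" 1 1] by (simp add: size_upto_def)
  qed
  ultimately show ?thesis unfolding P_def using assms E.U.l_one by metis
qed

lemma co_expansion:
  assumes "u \<in> carrier E.U"
  shows "finite {\<alpha>. co u \<alpha> \<noteq> 0}" "{\<alpha>. co u \<alpha> \<noteq> 0} \<subseteq> nat_pow p"
    "u = UV.comb {\<alpha>. co u \<alpha> \<noteq> 0} (mon p) (co u)"
proof -
  note mc = mon_closed[OF order_refl]
  have mP: "mon p \<in> T \<rightarrow> carrier E.U" for T using mc by auto
  obtain k where "u \<in> filt p k" using env_alg_filt[OF assms] by blast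
  \<comment> \<open>T is only required to contain the support, because coefficients may cancel when
    a monomial is added; it is cut down to the support at the end.\<close>
  then have "\<exists>T. finite T \<and> T \<subseteq> nat_pow p \<and> {\<alpha>. co u \<alpha> \<noteq> 0} \<subseteq> T \<and> u = UV.comb T (mon p) (co u)"
  proof induction
    case filt_zero
    then show ?case by (intro exI[of _ "{}"]) (simp add: co_zero)
  next
    case (filt_add u \<alpha> c)
    obtain T where T: "finite T" "T \<subseteq> nat_pow p" "{\<alpha>. co u \<alpha> \<noteq> 0} \<subseteq> T" "u = UV.comb T (mon p) (co u)"
      using filt_add by blast
    have uc: "u \<in> carrier E.U" using filt_carrier filt_add by blast
    obtain \<beta> where \<beta>: "\<beta> \<in> nat_pow p" "mon p \<alpha> = mon p \<beta>" by (rule mon_restrict)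
    let ?T = "insert \<beta> T" and ?v = "c \<odot>\<^sub>U mon p \<alpha> \<oplus>\<^sub>U u"
    have co: "co ?v \<gamma> = (if \<gamma> = \<beta> then c else 0) + co u \<gamma>" for \<gamma>
      using uc mc \<beta> by (simp add: co_add co_smult co_mon unit_fun_def)
    have "UV.comb ?T (mon p) (co ?v) = UV.comb ?T (mon p) (\<lambda>\<gamma>. (if \<gamma> = \<beta> then c else 0) + co u \<gamma>)"
      by (rule UV.comb_cong[OF mP co])
    also have "\<dots> = UV.comb ?T (mon p) (\<lambda>\<gamma>. if \<gamma> = \<beta> then c else 0) \<oplus>\<^sub>U UV.comb ?T (mon p) (co u)"
      by (rule UV.comb_add[OF mP])
    also have "UV.comb ?T (mon p) (\<lambda>\<gamma>. if \<gamma> = \<beta> then c else 0) = c \<odot>\<^sub>U mon p \<alpha>"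
      unfolding \<beta>(2) by (rule UV.comb_single[OF _ mP]) (use T in auto)
    also have "UV.comb ?T (mon p) (co u) = UV.comb T (mon p) (co u)"
      by (rule UV.comb_superset[symmetric, OF _ _ mP]) (use T in auto)
    finally have "?v = UV.comb ?T (mon p) (co ?v)" using T(4) by simp
    moreover have "{\<alpha>. co ?v \<alpha> \<noteq> 0} \<subseteq> ?T" using T(3) by (auto simp: co split: if_splits)
    ultimately show ?case using T \<beta>(1) by (intro exI[of _ ?T]) simp
  qed
  then obtain T where T: "finite T" "T \<subseteq> nat_pow p" "{\<alpha>. co u \<alpha> \<noteq> 0} \<subseteq> T" "u = UV.comb T (mon p) (co u)"
    by blast
  then show "finite {\<alpha>. co u \<alpha> \<noteq> 0}" "{\<alpha>. co u \<alpha> \<noteq> 0} \<subseteq> nat_pow p"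
    using finite_subset by blast+
  have "UV.comb {\<alpha>. co u \<alpha> \<noteq> 0} (mon p) (co u) = UV.comb T (mon p) (co u)"
    by (rule UV.comb_superset[OF T(1,3) mP]) auto
  then show "u = UV.comb {\<alpha>. co u \<alpha> \<noteq> 0} (mon p) (co u)" using T(4) by simp
qed

lemma co_comb:
  assumes "finite T" "T \<subseteq> nat_pow p"
  shows "co (UV.comb T (mon p) c) = (\<lambda>\<alpha>. if \<alpha> \<in> T then c \<alpha> else 0)"
  using assms
proof (induction T)
  case empty
  then show ?case by (simp add: co_zero)
next
  case (insert \<alpha> T)
  have mP: "mon p \<in> T \<rightarrow> carrier E.U" for T using mon_closed by auto
  show ?case
  proof (rule ext)
    fix \<beta>
    show "co (UV.comb (insert \<alpha> T) (mon p) c) \<beta> = (if \<beta> \<in> insert \<alpha> T then c \<beta> else 0)"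
      using insert mP mon_closed[of p]
      by (cases "\<beta> = \<alpha>") (simp_all add: UV.comb_insert co_add co_smult co_mon unit_fun_def)
  qed
qed

text \<open>Existence of the expansion is spanning; uniqueness is \<open>co_comb\<close>, which
  contains the linear independence of the ordered monomials.\<close>

lemma coeffs_eq_co:
  assumes "u \<in> carrier E.U"
  shows "coeffs E.U \<tau> p u = co u"
  unfolding coeffs_def
proof (rule the_equality)
  show "finite {\<alpha>. co u \<alpha> \<noteq> 0} \<and> {\<alpha>. co u \<alpha> \<noteq> 0} \<subseteq> nat_pow p \<and>
      u = (\<Oplus>\<^bsub>E.U\<^esub>\<alpha>\<in>{\<alpha>. co u \<alpha> \<noteq> 0}. co u \<alpha> \<odot>\<^sub>U mon p \<alpha>)"
    using co_expansion[OF assms] by (simp add: UV.comb_def)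
  fix c assume c: "finite {\<alpha>. c \<alpha> \<noteq> 0} \<and> {\<alpha>. c \<alpha> \<noteq> 0} \<subseteq> nat_pow p \<and>
      u = (\<Oplus>\<^bsub>E.U\<^esub>\<alpha>\<in>{\<alpha>. c \<alpha> \<noteq> 0}. c \<alpha> \<odot>\<^sub>U mon p \<alpha>)"
  then have "u = UV.comb {\<alpha>. c \<alpha> \<noteq> 0} (mon p) c" by (simp add: UV.comb_def)
  then show "c = co u" using co_comb[of "{\<alpha>. c \<alpha> \<noteq> 0}" c] c by (auto simp: fun_eq_iff)
qed

lemma newton_diagram_eq: "u \<in> carrier E.U \<Longrightarrow> newton_diagram E.U \<tau> p u = {\<alpha>. co u \<alpha> \<noteq> 0}"
  by (simp add: newton_diagram_def coeffs_eq_co)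

lemma co_eq_zero_iff: "u \<in> carrier E.U \<Longrightarrow> (\<forall>\<alpha>. co u \<alpha> = 0) \<longleftrightarrow> u = \<zero>\<^sub>U"
  using co_expansion(3)[of u] by (auto simp: co_zero)

end

section \<open>The quotient by a color central subspace\<close>

lemma (in lie_color_algebra) carrier_induct:
  assumes y: "y \<in> carrier L" and "\<And>g y. y \<in> homog L g \<Longrightarrow> P y"
    and "\<And>u v. u \<in> carrier L \<Longrightarrow> v \<in> carrier L \<Longrightarrow> P u \<Longrightarrow> P v \<Longrightarrow> P (u \<oplus> v)"
  shows "P y"
proof -
  have c: "comp y h \<in> carrier L" for h using homog_closed comp_props(1)[OF y] .
  have "P (finsum L (comp y) S)" if "finite S" for S
    using that
  proof (induction S)
    case empty
    then show ?case using assms(2)[OF homog_zero] by simp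
  next
    case (insert g S)
    have "finsum L (comp y) (insert g S) = comp y g \<oplus> finsum L (comp y) S"
      by (rule finsum_insert) (use insert c in auto)
    then show ?case using assms(3)[OF c _ assms(2)[OF comp_props(1)[OF y]] insert.IH] c by auto
  qed
  from this[OF comp_props(2)[OF y]] show ?thesis unfolding comp_props(3)[OF y, symmetric] .
qed

text \<open>Centrality is given with the plus part on the left. Skew symmetry exchanges the sides
  for homogeneous elements, so both arguments are first reduced to homogeneous ones.\<close>

lemma (in generic_lie_color_algebra) color_central_right:
  assumes k: "k \<in> plus_part \<epsilon> L" and y: "y \<in> carrier L"
  shows "bracket L y k = \<zero>"
proof -
  have kc: "k \<in> carrier L" using k subspace_closed(1)[OF parts_subspace(1)] by blast
  interpret vs: vectorspace class_ring L by (rule vectorspace)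
  have 1: "bracket L v k = \<zero>" if v: "v \<in> homog L h" for v h
  proof -
    have vc: "v \<in> carrier L" using homog_closed[OF v] .
    have "vs.span (\<Union>g\<in>{g. \<epsilon> g g = 1}. homog L g) \<subseteq> {w \<in> carrier L. bracket L v w = \<zero>}"
    proof (rule vs.span_is_subset)
      show "(\<Union>g\<in>{g. \<epsilon> g g = 1}. homog L g) \<subseteq> {w \<in> carrier L. bracket L v w = \<zero>}"
      proof
        fix w assume "w \<in> (\<Union>g\<in>{g. \<epsilon> g g = 1}. homog L g)"
        then obtain g where g: "\<epsilon> g g = 1" "w \<in> homog L g" by auto
        then have "bracket L w v = \<zero>" using color_central[OF homog_subset_parts(1) vc] by blast
        then have "bracket L v w = \<zero>" using color_skew[OF v g(2)] by (simp add: minus_zero)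
        then show "w \<in> {w \<in> carrier L. bracket L v w = \<zero>}" using homog_closed[OF g(2)] by simp
      qed
      show "submodule class_ring {w \<in> carrier L. bracket L v w = \<zero>} L"
        by (rule submodule.intro[OF vs.module_axioms])
          (use vc in \<open>auto simp: bracket_add_right bracket_smult_right bracket_zero_right\<close>)
    qed
    then show ?thesis using k unfolding plus_part_def by auto
  qed
  show ?thesis using y
    by (rule carrier_induct) (use 1 kc in \<open>auto simp: bracket_add_left\<close>)
qed

section \<open>Left multiples of a color central subspace\<close>

locale central_subspace = generic_lie_color_algebra \<epsilon> L
  for \<epsilon> :: "'g::ab_group_add \<Rightarrow> 'g \<Rightarrow> 'k::field" and L :: "('k, 'v, 'g) color_alg" (structure) +
  fixes K :: "'v set"
  assumes graded: "graded_subspace L K" and sub_plus: "K \<subseteq> plus_part \<epsilon> L"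
begin

lemma K_subspace: "VectorSpace.subspace class_ring K L"
  using graded by (simp add: graded_subspace_def)

lemmas K_closed = subspace_closed[OF K_subspace]

lemma K_carrier: "k \<in> K \<Longrightarrow> k \<in> carrier L"
  using K_closed(1) by blast

lemma inc_K_closed: "E.inc ` K \<subseteq> carrier E.U"
  using inc_closed K_carrier by auto

lemma K_induct:
  assumes k: "k \<in> K" and "\<And>g k. k \<in> K \<Longrightarrow> k \<in> homog L g \<Longrightarrow> P k" "P \<zero>"
    and "\<And>u v. u \<in> carrier L \<Longrightarrow> v \<in> carrier L \<Longrightarrow> P u \<Longrightarrow> P v \<Longrightarrow> P (u \<oplus> v)"
    and "\<And>c u. u \<in> carrier L \<Longrightarrow> P u \<Longrightarrow> P (c \<odot> u)"
  shows "P k"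
proof -
  interpret vs: vectorspace class_ring L by (rule vectorspace)
  have "vs.span (\<Union>g. K \<inter> homog L g) \<subseteq> {k \<in> carrier L. P k}"
  proof (rule vs.span_is_subset)
    show "(\<Union>g. K \<inter> homog L g) \<subseteq> {k \<in> carrier L. P k}" using assms(2) homog_closed by blast
    show "submodule class_ring {k \<in> carrier L. P k} L"
      by (rule submodule.intro[OF vs.module_axioms]) (use assms in auto)
  qed
  moreover have "K = vs.span (\<Union>g. K \<inter> homog L g)" using graded unfolding graded_subspace_def by blast
  ultimately show ?thesis using k by auto
qed

text \<open>\<open>ideal_prod\<close> is the additive closure of the products of two sets; with the
  whole algebra on the left and the image of K on the right it is U(X)K.\<close>

abbreviation P where "P \<equiv> ideal_prod E.U (carrier E.U) (E.inc ` K)"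

lemma P_closed: "z \<in> P \<Longrightarrow> z \<in> carrier E.U"
  by (induction rule: ideal_prod.induct) (use inc_K_closed in auto)

lemma P_prod: "a \<in> carrier E.U \<Longrightarrow> k \<in> K \<Longrightarrow> a \<otimes>\<^sub>U E.inc k \<in> P"
  by (intro ideal_prod.prod) auto

lemma P_left: 
  assumes "z \<in> P" "a \<in> carrier E.U"
  shows "a \<otimes>\<^sub>U z \<in> P"
  using assms(1)
proof (induction rule: ideal_prod.induct)
  case (prod i j)
  then have "a \<otimes>\<^sub>U (i \<otimes>\<^sub>U j) = (a \<otimes>\<^sub>U i) \<otimes>\<^sub>U j"
    using assms inc_K_closed by (subst E.U.m_assoc) auto
  then show ?case using prod assms by (auto intro!: ideal_prod.prod)
next
  case (sum s1 s2)
  then show ?case using assms P_closed by (simp add: E.U.r_distr ideal_prod.sum)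
qed

lemma P_smult: "z \<in> P \<Longrightarrow> c \<odot>\<^sub>U z \<in> P"
  using P_left[of z "c \<odot>\<^sub>U \<one>\<^sub>U"] P_closed[of z] by (simp add: E.U.smult_mult_left)

lemma P_zero: "\<zero>\<^sub>U \<in> P"
  using P_prod[of "\<one>\<^sub>U" \<zero>] K_closed(2) by (simp add: inc_zero)

lemma inc_K_comm:
  assumes "k \<in> plus_part \<epsilon> L" "k \<in> homog L g" "y \<in> homog L h"
  shows "E.inc k \<otimes>\<^sub>U E.inc y = \<epsilon> g h \<odot>\<^sub>U (E.inc y \<otimes>\<^sub>U E.inc k)"
  using inc_relation[OF assms(2,3)] color_central[OF assms(1) homog_closed[OF assms(3)]]
    inc_closed[OF homog_closed[OF assms(2)]] inc_closed[OF homog_closed[OF assms(3)]]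
  by (simp add: inc_zero)

text \<open>Homogeneous elements of K commute with homogeneous elements of L up to scalars. The
  claim is made for all k at once: in the step for a product u v, the element k u is a sum of left
  multiples of elements of K, and to each of these the hypothesis on v applies.\<close>

lemma K_right:
  assumes b: "b \<in> carrier E.U"
  shows "\<forall>k\<in>K. E.inc k \<otimes>\<^sub>U b \<in> P"
proof -
  have right: "z \<otimes>\<^sub>U b \<in> P" if z: "z \<in> P" and b: "b \<in> carrier E.U" "\<forall>k\<in>K. E.inc k \<otimes>\<^sub>U b \<in> P" for z b
    using z
  proof (induction rule: ideal_prod.induct)
    case (prod i j)
    then have "(i \<otimes>\<^sub>U j) \<otimes>\<^sub>U b = i \<otimes>\<^sub>U (j \<otimes>\<^sub>U b)"
      using b inc_K_closed by (subst E.U.m_assoc) auto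
    then show ?case using P_left prod b by auto
  next
    case (sum s1 s2)
    then show ?case using b P_closed by (simp add: E.U.l_distr ideal_prod.sum)
  qed
  have kc: "k \<in> K \<Longrightarrow> E.inc k \<in> carrier E.U" for k using inc_closed K_carrier by blast
  show ?thesis using b
  proof (induction rule: E.env_alg_generated)
    case one
    then show ?case using P_prod[OF E.U.one_closed] kc by simp
  next
    case (inc y)
    \<comment> \<open>The commutation scalar depends on both degrees, so y is split into homogeneous
      parts while k is kept homogeneous; k is split afterwards.\<close>
    have homog: "E.inc k \<otimes>\<^sub>U E.inc y \<in> P" if y: "y \<in> carrier L" and k: "k \<in> K" "k \<in> homog L g" for k g y
      using y
    proof (rule carrier_induct)
      fix h y assume y: "y \<in> homog L h"
      have "E.inc y \<in> carrier E.U" using inc_closed homog_closed[OF y] by blast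
      then show "E.inc k \<otimes>\<^sub>U E.inc y \<in> P"
        using inc_K_comm[OF _ k(2) y] k(1) sub_plus P_smult[OF P_prod[OF _ k(1)]] by auto
    next
      fix u v assume "u \<in> carrier L" "v \<in> carrier L" "E.inc k \<otimes>\<^sub>U E.inc u \<in> P" "E.inc k \<otimes>\<^sub>U E.inc v \<in> P"
      then show "E.inc k \<otimes>\<^sub>U E.inc (u \<oplus> v) \<in> P"
        using kc[OF k(1)] inc_closed by (simp add: inc_add E.U.r_distr ideal_prod.sum)
    qed
    show ?case
    proof
      fix k assume "k \<in> K"
      then show "E.inc k \<otimes>\<^sub>U E.inc y \<in> P"
      proof (rule K_induct)
        show "E.inc \<zero> \<otimes>\<^sub>U E.inc y \<in> P" using inc_closed[OF inc] P_zero by (simp add: inc_zero)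
        show "E.inc k \<otimes>\<^sub>U E.inc y \<in> P" if "k \<in> K" "k \<in> homog L g" for g k
          using homog[OF inc that] .
        show "E.inc (u \<oplus> v) \<otimes>\<^sub>U E.inc y \<in> P" if "u \<in> carrier L" "v \<in> carrier L"
          "E.inc u \<otimes>\<^sub>U E.inc y \<in> P" "E.inc v \<otimes>\<^sub>U E.inc y \<in> P" for u v
          using that inc_closed inc by (simp add: inc_add E.U.l_distr ideal_prod.sum)
        show "E.inc (c \<odot> u) \<otimes>\<^sub>U E.inc y \<in> P" if "u \<in> carrier L"
          "E.inc u \<otimes>\<^sub>U E.inc y \<in> P" for c u
          using that inc_closed inc P_smult by (simp add: inc_smult E.U.smult_mult_left)
      qed
    qed
  next
    case (add u v)
    then show ?case using kc by (simp add: E.U.r_distr ideal_prod.sum)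
  next
    case (mult u v)
    show ?case
    proof
      fix k assume k: "k \<in> K"
      have "(E.inc k \<otimes>\<^sub>U u) \<otimes>\<^sub>U v \<in> P" using right mult k by blast
      then show "E.inc k \<otimes>\<^sub>U (u \<otimes>\<^sub>U v) \<in> P" using E.U.m_assoc kc[OF k] mult by simp
    qed
  next
    case (smult c u)
    then show ?case using kc P_smult by (simp add: E.U.smult_mult_right)
  qed
qed

lemma P_ideal: "ideal P E.U"
proof (rule idealI)
  show "ring E.U" by (rule E.U.ring_axioms)
  show "subgroup P (add_monoid E.U)"
  proof (rule E.U.add.subgroupI)
    show "P \<subseteq> carrier E.U" using P_closed by blast
    show "P \<noteq> {}" using P_zero by blast
    show "\<ominus>\<^bsub>E.U\<^esub> z \<in> P" if "z \<in> P" for z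
      using P_smult[OF that, of "-1"] P_closed[OF that] by (simp add: E.U.smult_minus_one)
    show "y \<oplus>\<^sub>U z \<in> P" if "y \<in> P" "z \<in> P" for y z
      using that by (rule ideal_prod.sum)
  qed
  show "a \<otimes>\<^sub>U z \<in> P" if "z \<in> P" "a \<in> carrier E.U" for z a
    using P_left that by blast
  fix z b assume z: "z \<in> P" and b: "b \<in> carrier E.U"
  show "z \<otimes>\<^sub>U b \<in> P" using z
  proof (induction rule: ideal_prod.induct)
    case (prod i j)
    then have "(i \<otimes>\<^sub>U j) \<otimes>\<^sub>U b = i \<otimes>\<^sub>U (j \<otimes>\<^sub>U b)"
      using b inc_K_closed by (subst E.U.m_assoc) auto
    then show ?case using P_left prod K_right[OF b] by auto
  next
    case (sum s1 s2)
    then show ?case using b P_closed by (simp add: E.U.l_distr ideal_prod.sum)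
  qed
qed

abbreviation I where "I \<equiv> genideal E.U (E.inc ` K)"

lemma I_eq_P: "I = P"
proof
  have "E.inc ` K \<subseteq> P"
    using P_prod[OF E.U.one_closed] inc_K_closed E.U.l_one by (auto simp: subset_iff)
  then show "I \<subseteq> P" by (rule E.U.genideal_minimal[OF P_ideal])
  interpret I: ideal I E.U by (rule E.U.genideal_ideal[OF inc_K_closed])
  show "P \<subseteq> I"
  proof
    fix z assume "z \<in> P"
    then show "z \<in> I"
    proof (induction rule: ideal_prod.induct)
      case (prod i j)
      then show ?case using I.I_l_closed E.U.genideal_self[OF inc_K_closed] by blast
    next
      case (sum s1 s2)
      then show ?case by simp
    qed
  qed
qed

section \<open>The enveloping algebra of the quotient\<close>

abbreviation LK where "LK \<equiv> color_quot L K"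
abbreviation q where "q \<equiv> (+>) K"

lemma K_subgroup: "abelian_subgroup K L"
proof (rule abelian_subgroupI3)
  show "additive_subgroup K L"
  proof (rule additive_subgroup.intro, rule add.subgroupI)
    show "K \<subseteq> carrier L" "K \<noteq> {}" using K_closed by auto
    show "\<ominus> k \<in> K" if "k \<in> K" for k
      using K_closed(4)[OF that, of "-1"] K_carrier[OF that] by (simp add: vec_minus_eq)
    show "k \<oplus> l \<in> K" if "k \<in> K" "l \<in> K" for k l using K_closed(3) that by blast
  qed
  show "abelian_group L" by (rule abelian_group_axioms)
qed

interpretation KS: abelian_subgroup K L by (rule K_subgroup)

lemma q_eqI: "v \<in> carrier L \<Longrightarrow> w = k \<oplus> v \<Longrightarrow> k \<in> K \<Longrightarrow> q w = q v"
  using KS.a_repr_independence'[of w v] by (auto simp: a_r_coset_def')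

lemma q_D: "w \<in> q v \<Longrightarrow> \<exists>k\<in>K. w = k \<oplus> v"
  by (auto simp: a_r_coset_def')

lemma q_self: "v \<in> carrier L \<Longrightarrow> v \<in> q v"
  by (rule KS.a_rcos_self)

lemma q_add: "v \<in> carrier L \<Longrightarrow> w \<in> carrier L \<Longrightarrow> q v \<oplus>\<^bsub>LK\<^esub> q w = q (v \<oplus> w)"
  using KS.a_rcos_sum by (simp add: color_quot_def)

lemma q_smult:
  assumes "v \<in> carrier L"
  shows "c \<odot>\<^bsub>LK\<^esub> q v = q (c \<odot> v)"
proof -
  have "q (c \<odot> w) = q (c \<odot> v)" if w: "w \<in> q v" for w
  proof -
    obtain k where k: "k \<in> K" "w = k \<oplus> v" using q_D[OF w] by blast
    show ?thesis
      by (rule q_eqI[of _ _ "c \<odot> k"]) (use assms k K_carrier K_closed(4) in \<open>auto simp: vec_smult_add_right\<close>)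
  qed
  then have "(\<Union>a\<in>q v. q (c \<odot> a)) = (\<Union>a\<in>q v. q (c \<odot> v))"
    by (intro SUP_cong refl)
  moreover have "q v \<noteq> {}" using q_self[OF assms] by auto
  ultimately show ?thesis by (simp add: color_quot_def)
qed

text \<open>K is color central on both sides, so a change of representatives leaves the bracket
  unchanged even before passing to cosets.\<close>

lemma q_bracket:
  assumes "v \<in> carrier L" "w \<in> carrier L"
  shows "bracket LK (q v) (q w) = q (bracket L v w)"
proof -
  have "q (bracket L v' w') = q (bracket L v w)" if vw: "v' \<in> q v" "w' \<in> q w" for v' w'
  proof -
    obtain k l where k: "k \<in> K" "v' = k \<oplus> v" and l: "l \<in> K" "w' = l \<oplus> w" using q_D vw by meson
    have "k \<in> plus_part \<epsilon> L" "l \<in> plus_part \<epsilon> L" using k l sub_plus by auto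
    then have "bracket L v' w' = bracket L v w"
      using k l K_carrier assms color_central color_central_right bracket_closed
      by (simp add: bracket_add_left bracket_add_right)
    then show ?thesis by simp
  qed
  then have "(\<Union>a\<in>q v. \<Union>b\<in>q w. q (bracket L a b)) = (\<Union>a\<in>q v. \<Union>b\<in>q w. q (bracket L v w))"
    by (intro SUP_cong refl)
  moreover have "q v \<noteq> {}" "q w \<noteq> {}" using q_self assms by auto
  ultimately show ?thesis by (simp add: color_quot_def)
qed

lemma q_carrier: "carrier LK = q ` carrier L"
  by (auto simp: color_quot_def A_RCOSETS_defs a_r_coset_def)

lemma q_homog: "homog LK g = q ` homog L g"
  by (simp add: color_quot_def)

lemma bracket_closed_LK: "bracket_closed LK"
proof (rule bracket_closed.intro)
  fix A B assume "A \<in> carrier LK" "B \<in> carrier LK"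
  then show "A \<oplus>\<^bsub>LK\<^esub> B \<in> carrier LK" unfolding q_carrier by (auto simp: q_add)
next
  fix A c assume "A \<in> carrier LK"
  then show "c \<odot>\<^bsub>LK\<^esub> A \<in> carrier LK" unfolding q_carrier by (auto simp: q_smult)
next
  fix A g assume "A \<in> homog LK g"
  then show "A \<in> carrier LK" unfolding q_carrier q_homog using homog_closed by blast
next
  fix A B g h assume "A \<in> homog LK g" "B \<in> homog LK h"
  then obtain v w where "A = q v" "B = q w" "v \<in> carrier L" "w \<in> carrier L"
    unfolding q_homog using homog_closed by blast
  then show "bracket LK A B \<in> carrier LK" unfolding q_carrier using q_bracket bracket_closed by simp
qed

interpretation E': bracket_closed \<epsilon> LK by (rule bracket_closed_LK)
interpretation UI: alg_ideal E.U I
  by (intro alg_ideal.intro E.U.assoc_alg_axioms E.U.genideal_ideal inc_K_closed)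

text \<open>Universal properties give maps in both directions: \<phi> from that of the enveloping
  algebra of the quotient, \<psi> from that of the enveloping algebra of L, factored through I. They
  are mutually inverse because they are so on generators.\<close>

lemma env_alg_quotient_iso:
  "\<exists>\<phi>. \<phi> \<in> ring_iso (env_alg \<epsilon> LK) (alg_quot E.U I) \<and>
    \<phi> \<in> LinearCombinations.module_hom class_ring (env_alg \<epsilon> LK) (alg_quot E.U I)"
proof -
  let ?Q = "alg_quot E.U I"
  interpret Q: assoc_alg ?Q by (rule UI.assoc_alg_quot)
  \<comment> \<open>Two representatives of a coset differ by an element of K, whose image lies in I,
    so the choice does not affect the value.\<close>
  define f where "f A = UI.proj (E.inc (SOME v. v \<in> carrier L \<and> A = q v))" for A
  have inc_K: "E.inc k \<in> I" if "k \<in> K" for k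
    using E.U.genideal_self[OF inc_K_closed] that by blast
  have f: "f (q v) = UI.proj (E.inc v)" if v: "v \<in> carrier L" for v
  proof -
    define w where "w = (SOME w. w \<in> carrier L \<and> q v = q w)"
    have w: "w \<in> carrier L" "q v = q w"
      using someI[of "\<lambda>w. w \<in> carrier L \<and> q v = q w" v] v by (simp_all add: w_def)
    then obtain k where k: "k \<in> K" "w = k \<oplus> v" using q_D[of w v] q_self by blast
    have c: "E.inc k \<in> carrier E.U" "E.inc v \<in> carrier E.U" using inc_closed K_carrier k v by auto
    have "E.inc w \<ominus>\<^bsub>E.U\<^esub> E.inc v = E.inc k"
      unfolding k(2) inc_add[OF K_carrier[OF k(1)] v] using c
      by (simp add: E.U.minus_eq E.U.a_assoc E.U.r_neg)
    then have "UI.proj (E.inc w) = UI.proj (E.inc v)"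
      using UI.proj_eq_iff[OF inc_closed[OF w(1)] c(2)] inc_K[OF k(1)] by simp
    then show ?thesis by (simp add: f_def w_def)
  qed
  have "relation_preserving \<epsilon> LK ?Q f"
    unfolding relation_preserving_def
  proof (intro conjI ballI allI funcsetI)
    fix A assume "A \<in> carrier LK"
    then show "f A \<in> carrier ?Q" unfolding q_carrier using inc_closed by (auto simp: f)
  next
    fix A B assume "A \<in> carrier LK" "B \<in> carrier LK"
    then show "f (A \<oplus>\<^bsub>LK\<^esub> B) = f A \<oplus>\<^bsub>?Q\<^esub> f B" unfolding q_carrier using inc_closed
      by (auto simp: q_add f inc_add UI.proj_add)
  next
    fix A c assume "A \<in> carrier LK"
    then show "f (c \<odot>\<^bsub>LK\<^esub> A) = c \<odot>\<^bsub>?Q\<^esub> f A" unfolding q_carrier using inc_closed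
      by (auto simp: q_smult f inc_smult UI.proj_sm)
  next
    fix g h A B assume "A \<in> homog LK g" "B \<in> homog LK h"
    then obtain v w where vw: "A = q v" "B = q w" "v \<in> homog L g" "w \<in> homog L h"
      unfolding q_homog by blast
    have c: "v \<in> carrier L" "w \<in> carrier L" "bracket L v w \<in> carrier L"
      using homog_closed vw bracket_closed by blast+
    show "f A \<otimes>\<^bsub>?Q\<^esub> f B = \<epsilon> g h \<odot>\<^bsub>?Q\<^esub> (f B \<otimes>\<^bsub>?Q\<^esub> f A) \<oplus>\<^bsub>?Q\<^esub> f (bracket LK A B)"
      using inc_relation[OF vw(3,4)] c inc_closed
      by (simp add: vw q_bracket f flip: UI.proj_mult UI.proj_sm UI.proj_add)
  qed
  from E'.env_alg_universal[OF UI.assoc_alg_quot this]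
  obtain \<phi> where \<phi>: "\<phi> \<in> alg_homs E'.U ?Q" "\<And>A. A \<in> carrier LK \<Longrightarrow> \<phi> (E'.inc A) = f A"
    by blast
  have qc: "q v \<in> carrier LK" if "v \<in> carrier L" for v using q_carrier that by blast
  note E'_inc = E'.inc_relation_preserving[unfolded relation_preserving_def]
  have E'_closed: "E'.inc A \<in> carrier E'.U"
    and E'_add: "B \<in> carrier LK \<Longrightarrow> E'.inc (A \<oplus>\<^bsub>LK\<^esub> B) = E'.inc A \<oplus>\<^bsub>E'.U\<^esub> E'.inc B"
    and E'_smult: "E'.inc (c \<odot>\<^bsub>LK\<^esub> A) = c \<odot>\<^bsub>E'.U\<^esub> E'.inc A" if "A \<in> carrier LK" for A B c
    using E'_inc that by blast+
  have E'_relation: "E'.inc A \<otimes>\<^bsub>E'.U\<^esub> E'.inc B =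
      \<epsilon> g h \<odot>\<^bsub>E'.U\<^esub> (E'.inc B \<otimes>\<^bsub>E'.U\<^esub> E'.inc A) \<oplus>\<^bsub>E'.U\<^esub> E'.inc (bracket LK A B)"
    if "A \<in> homog LK g" "B \<in> homog LK h" for A B g h
    using E'_inc that by blast
  have "relation_preserving \<epsilon> L E'.U (\<lambda>v. E'.inc (q v))"
    unfolding relation_preserving_def
  proof (intro conjI ballI allI funcsetI)
    fix v assume "v \<in> carrier L"
    then show "E'.inc (q v) \<in> carrier E'.U" using E'_closed qc by simp
  next
    fix v w assume "v \<in> carrier L" "w \<in> carrier L"
    then show "E'.inc (q (v \<oplus> w)) = E'.inc (q v) \<oplus>\<^bsub>E'.U\<^esub> E'.inc (q w)"
      using E'_add[OF qc qc] by (simp only: q_add)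
  next
    fix c v assume "v \<in> carrier L"
    then show "E'.inc (q (c \<odot> v)) = c \<odot>\<^bsub>E'.U\<^esub> E'.inc (q v)"
      using E'_smult[OF qc] by (simp only: q_smult)
  next
    fix g h v w assume vw: "v \<in> homog L g" "w \<in> homog L h"
    then have "q v \<in> homog LK g" "q w \<in> homog LK h" unfolding q_homog by blast+
    then show "E'.inc (q v) \<otimes>\<^bsub>E'.U\<^esub> E'.inc (q w) =
        \<epsilon> g h \<odot>\<^bsub>E'.U\<^esub> (E'.inc (q w) \<otimes>\<^bsub>E'.U\<^esub> E'.inc (q v)) \<oplus>\<^bsub>E'.U\<^esub> E'.inc (q (bracket L v w))"
      unfolding q_bracket[OF homog_closed[OF vw(1)] homog_closed[OF vw(2)], symmetric] by (rule E'_relation)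
  qed
  from E.env_alg_universal[OF E'.U.assoc_alg_axioms this]
  obtain \<psi>0 where \<psi>0: "\<psi>0 \<in> alg_homs E.U E'.U" "\<And>v. v \<in> carrier L \<Longrightarrow> \<psi>0 (E.inc v) = E'.inc (q v)"
    by blast
  have "\<psi>0 z = \<zero>\<^bsub>E'.U\<^esub>" if z: "z \<in> E.inc ` K" for z
  proof -
    obtain k where k: "k \<in> K" "z = E.inc k" using z by blast
    have "q k = q \<zero>" by (rule q_eqI[of _ _ k]) (use k K_carrier in auto)
    moreover have "E'.inc (q \<zero>) = \<zero>\<^bsub>E'.U\<^esub>"
      using \<psi>0(2)[of \<zero>] alg_homs_zero[OF E.U.assoc_alg_axioms E'.U.assoc_alg_axioms \<psi>0(1)]
      by (simp add: inc_zero)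
    ultimately show ?thesis using \<psi>0(2)[OF K_carrier[OF k(1)]] k(2) by simp
  qed
  from UI.alg_quot_factor[OF E'.U.assoc_alg_axioms \<psi>0(1)
      alg_homs_genideal[OF E.U.assoc_alg_axioms E'.U.assoc_alg_axioms \<psi>0(1) inc_K_closed this]]
  obtain \<psi> where \<psi>: "\<psi> \<in> alg_homs ?Q E'.U" "\<And>u. u \<in> carrier E.U \<Longrightarrow> \<psi> (UI.proj u) = \<psi>0 u"
    by blast
  have \<psi>\<phi>: "\<psi> (\<phi> u) = u" if "u \<in> carrier E'.U" for u
    using that
  proof (induction rule: E'.env_alg_generated)
    case one
    then show ?case by (simp add: alg_homs_one[OF \<phi>(1)] alg_homs_one[OF \<psi>(1)])
  next
    case (inc A)
    then obtain v where "v \<in> carrier L" "A = q v" unfolding q_carrier by blast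
    then show ?case using \<phi>(2)[OF inc] f \<psi>(2)[OF inc_closed] \<psi>0(2) by simp
  next
    case (add u v)
    then show ?case
      by (simp add: alg_homs_add[OF \<phi>(1)] alg_homs_add[OF \<psi>(1)] alg_homs_closed[OF \<phi>(1)])
  next
    case (mult u v)
    then show ?case
      by (simp add: alg_homs_mult[OF \<phi>(1)] alg_homs_mult[OF \<psi>(1)] alg_homs_closed[OF \<phi>(1)])
  next
    case (smult c u)
    then show ?case
      by (simp add: alg_homs_smult[OF \<phi>(1)] alg_homs_smult[OF \<psi>(1)] alg_homs_closed[OF \<phi>(1)])
  qed
  have "\<phi> (\<psi>0 u) = UI.proj u" if "u \<in> carrier E.U" for u
    using that
  proof (induction rule: E.env_alg_generated)
    case one
    then show ?case by (simp add: alg_homs_one[OF \<phi>(1)] alg_homs_one[OF \<psi>0(1)] UI.proj_one)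
  next
    case (inc v)
    then show ?case using \<psi>0(2) \<phi>(2)[OF qc] f by simp
  next
    case (add u v)
    then show ?case
      by (simp add: alg_homs_add[OF \<phi>(1)] alg_homs_add[OF \<psi>0(1)] alg_homs_closed[OF \<psi>0(1)] UI.proj_add)
  next
    case (mult u v)
    then show ?case
      by (simp add: alg_homs_mult[OF \<phi>(1)] alg_homs_mult[OF \<psi>0(1)] alg_homs_closed[OF \<psi>0(1)] UI.proj_mult)
  next
    case (smult c u)
    then show ?case
      by (simp add: alg_homs_smult[OF \<phi>(1)] alg_homs_smult[OF \<psi>0(1)] alg_homs_closed[OF \<psi>0(1)] UI.proj_sm)
  qed
  then have \<phi>\<psi>: "\<phi> (\<psi> z) = z" if "z \<in> carrier ?Q" for z
    using that \<psi>(2) unfolding UI.carrier_alg_quot by auto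
  have "bij_betw \<phi> (carrier E'.U) (carrier ?Q)"
    by (rule bij_betw_byWitness[where f' = \<psi>])
      (use \<psi>\<phi> \<phi>\<psi> alg_homs_closed[OF \<phi>(1)] alg_homs_closed[OF \<psi>(1)] in auto)
  then show ?thesis
    using \<phi>(1) alg_homs_ring_hom[OF \<phi>(1)] alg_homs_module_hom[OF \<phi>(1)] unfolding ring_iso_def by blast
qed

end

section \<open>Admissible orderings\<close>

lemma nat_seq_incseq_subseq: "\<exists>g. strict_mono (g :: nat \<Rightarrow> nat) \<and> incseq (\<lambda>k. h (g k) :: nat)"
proof -
  obtain g where g: "strict_mono g" "monoseq (\<lambda>k. h (g k))" using seq_monosub by blast
  show ?thesis
  proof (cases "incseq (\<lambda>k. h (g k))")
    case True
    then show ?thesis using g by blast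
  next
    case False
    then have dec: "decseq (\<lambda>k. h (g k))" using g(2) unfolding monoseq_iff by blast
    \<comment> \<open>A decreasing sequence of naturals is constant from the place N where it
      reaches its least value n, so after dropping the first N terms it is weakly increasing as
      well.\<close>
    define n where "n = (LEAST n. \<exists>k. n = h (g k))"
    have "\<exists>N. n = h (g N)" unfolding n_def by (rule LeastI_ex) blast
    then obtain N where N: "n = h (g N)" by blast
    have "h (g (k + N)) = n" for k
    proof (rule antisym)
      show "h (g (k + N)) \<le> n" using decseqD[OF dec, of N "k + N"] N by simp
      show "n \<le> h (g (k + N))" unfolding n_def by (rule Least_le) blast
    qed
    then have "incseq (\<lambda>k. h (g (k + N)))" by (simp add: incseq_def)
    moreover have "strict_mono (\<lambda>k. g (k + N))" using g(1) by (simp add: strict_mono_def)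
    ultimately show ?thesis by blast
  qed
qed

text \<open>Dickson's lemma for sequences: coordinates are made monotone one after the other, and
  passing to a further subsequence keeps the earlier ones monotone.\<close>

lemma dickson_subseq:
  assumes "finite A"
  shows "\<exists>g. strict_mono (g :: nat \<Rightarrow> nat) \<and> (\<forall>i\<in>A. incseq (\<lambda>k. f (g k) i :: nat))"
  using assms
proof (induction A)
  case empty
  then show ?case by (auto intro: exI[of _ id] simp: strict_mono_def)
next
  case (insert a A)
  then obtain g where g: "strict_mono g" "\<forall>i\<in>A. incseq (\<lambda>k. f (g k) i)" by blast
  obtain g' where g': "strict_mono g'" "incseq (\<lambda>k. f (g (g' k)) a)"
    using nat_seq_incseq_subseq[of "\<lambda>k. f (g k) a"] by blast
  have "incseq (\<lambda>k. f (g (g' k)) i)" if "i \<in> A" for i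
  proof (rule incseq_SucI)
    fix k
    have "incseq (\<lambda>k. f (g k) i)" using g(2) that by blast
    then show "f (g (g' k)) i \<le> f (g (g' (Suc k))) i"
      by (rule incseqD) (use g'(1) in \<open>simp add: strict_mono_less_eq\<close>)
  qed
  then show ?case using g g' strict_mono_o[OF g(1) g'(1)] by (intro exI[of _ "g \<circ> g'"]) (auto simp: comp_def)
qed

section \<open>Spans of infinite families\<close>

context kvec
begin

definition lspan :: "'i set \<Rightarrow> ('i \<Rightarrow> 'v) \<Rightarrow> 'v set" where
  "lspan M f = {comb T f c | T c. finite T \<and> T \<subseteq> M}"

lemma lspan_zero: "\<zero> \<in> lspan M f"
  unfolding lspan_def by (intro CollectI exI[of _ "{}"] exI[of _ "\<lambda>_. 0"]) simp

lemma lspan_add: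
  assumes "f \<in> M \<rightarrow> carrier V" "v \<in> lspan M f" "w \<in> lspan M f"
  shows "v \<oplus> w \<in> lspan M f"
proof -
  obtain T c T' c' where T: "finite T" "T \<subseteq> M" "v = comb T f c" and T': "finite T'" "T' \<subseteq> M" "w = comb T' f c'"
    using assms(2,3) unfolding lspan_def by blast
  have f: "f \<in> T \<union> T' \<rightarrow> carrier V" "f \<in> T \<rightarrow> carrier V" "f \<in> T' \<rightarrow> carrier V" using assms(1) T T' by auto
  let ?c = "\<lambda>\<alpha>. if \<alpha> \<in> T then c \<alpha> else 0" and ?c' = "\<lambda>\<alpha>. if \<alpha> \<in> T' then c' \<alpha> else 0"
  have "v = comb T f ?c" unfolding T(3) by (rule comb_cong[OF f(2)]) simp
  also have "\<dots> = comb (T \<union> T') f ?c" by (rule comb_superset) (use T T' f in auto)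
  finally have v: "v = comb (T \<union> T') f ?c" .
  have "w = comb T' f ?c'" unfolding T'(3) by (rule comb_cong[OF f(3)]) simp
  also have "\<dots> = comb (T \<union> T') f ?c'" by (rule comb_superset) (use T T' f in auto)
  finally have "v \<oplus> w = comb (T \<union> T') f (\<lambda>\<alpha>. ?c \<alpha> + ?c' \<alpha>)"
    unfolding v using comb_add[OF f(1), of ?c ?c'] by simp
  moreover have "finite (T \<union> T')" "T \<union> T' \<subseteq> M" using T T' by auto
  ultimately show ?thesis unfolding lspan_def by blast
qed

lemma lspan_smult:
  assumes "f \<in> M \<rightarrow> carrier V" "v \<in> lspan M f"
  shows "a \<odot> v \<in> lspan M f"
proof -
  obtain T c where T: "finite T" "T \<subseteq> M" "v = comb T f c" using assms(2) unfolding lspan_def by blast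
  have "f \<in> T \<rightarrow> carrier V" using assms(1) T by auto
  then have "a \<odot> v = comb T f (\<lambda>j. a * c j)" unfolding T(3) using comb_smult[OF T(1)] by simp
  then show ?thesis unfolding lspan_def using T by blast
qed

lemma lspan_gen:
  assumes "f \<in> M \<rightarrow> carrier V" "i \<in> M"
  shows "f i \<in> lspan M f"
proof -
  have "comb {i} f (\<lambda>_. 1) = f i" using assms by (auto simp: comb_insert Pi_iff)
  then show ?thesis using assms(2) unfolding lspan_def by (intro CollectI exI[of _ "{i}"] exI[of _ "\<lambda>_. 1"]) auto
qed

end

lemma (in assoc_alg) comb_mult_right:
  assumes "finite T" "f \<in> T \<rightarrow> carrier A" "v \<in> carrier A"
  shows "kvec.comb A T f c \<otimes> v = kvec.comb A T (\<lambda>i. f i \<otimes> v) c"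
proof -
  interpret AV: kvec A by (rule kvec)
  show ?thesis using assms
  proof (induction T)
    case (insert i T)
    then have f: "f i \<in> carrier A" "f \<in> T \<rightarrow> carrier A" "(\<lambda>i. f i \<otimes> v) \<in> insert i T \<rightarrow> carrier A"
      "f \<in> insert i T \<rightarrow> carrier A" by auto
    then show ?case using insert AV.comb_closed[OF f(2)]
      by (simp add: AV.comb_insert l_distr smult_mult_left)
  qed simp
qed

lemma (in assoc_alg) comb_mult_left:
  assumes "finite T" "f \<in> T \<rightarrow> carrier A" "v \<in> carrier A"
  shows "v \<otimes> kvec.comb A T f c = kvec.comb A T (\<lambda>i. v \<otimes> f i) c"
proof -
  interpret AV: kvec A by (rule kvec)
  show ?thesis using assms
  proof (induction T)
    case (insert i T)
    then have f: "f i \<in> carrier A" "f \<in> T \<rightarrow> carrier A" "(\<lambda>i. v \<otimes> f i) \<in> insert i T \<rightarrow> carrier A"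
      "f \<in> insert i T \<rightarrow> carrier A" by auto
    then show ?case using insert AV.comb_closed[OF f(2)]
      by (simp add: AV.comb_insert r_distr smult_mult_right)
  qed simp
qed

section \<open>Leading exponents\<close>

locale adm_gens = generic_gens \<epsilon> L x m t p
  for \<epsilon> :: "'g::ab_group_add \<Rightarrow> 'g \<Rightarrow> 'k::field" and L :: "('k, 'v, 'g) color_alg" (structure) and x m t p +
  fixes r :: "(nat \<Rightarrow> nat) rel"
  assumes admissible: "admissible_ordering E.U \<tau> p r"
begin

lemma r_linear: "linear_order_on (nat_pow p) r"
  and r_zero: "\<alpha> \<in> nat_pow p \<Longrightarrow> ((\<lambda>i. 0), \<alpha>) \<in> r"
  and r_add_prec: "\<lbrakk>\<alpha> \<in> nat_pow p; \<beta> \<in> nat_pow p; \<gamma> \<in> nat_pow p; prec r \<alpha> \<beta>\<rbrakk> \<Longrightarrow>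
    prec r (exp_plus \<alpha> \<gamma>) (exp_plus \<beta> \<gamma>)"
  and exponent_mon_mon: "\<lbrakk>\<alpha> \<in> nat_pow p; \<beta> \<in> nat_pow p\<rbrakk> \<Longrightarrow>
    exponent E.U \<tau> p r (mon p \<alpha> \<otimes>\<^sub>U mon p \<beta>) = exp_plus \<alpha> \<beta>"
  using admissible unfolding admissible_ordering_def by blast+

lemma r_refl: "\<alpha> \<in> nat_pow p \<Longrightarrow> (\<alpha>, \<alpha>) \<in> r"
  and r_trans: "(\<alpha>, \<beta>) \<in> r \<Longrightarrow> (\<beta>, \<gamma>) \<in> r \<Longrightarrow> (\<alpha>, \<gamma>) \<in> r"
  and r_antisym: "(\<alpha>, \<beta>) \<in> r \<Longrightarrow> (\<beta>, \<alpha>) \<in> r \<Longrightarrow> \<alpha> = \<beta>"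
  and r_total: "\<alpha> \<in> nat_pow p \<Longrightarrow> \<beta> \<in> nat_pow p \<Longrightarrow> (\<alpha>, \<beta>) \<in> r \<or> (\<beta>, \<alpha>) \<in> r"
proof -
  have *: "refl_on (nat_pow p) r" "trans r" "antisym r" "total_on (nat_pow p) r"
    using r_linear unfolding linear_order_on_def partial_order_on_def preorder_on_def by auto
  show "\<alpha> \<in> nat_pow p \<Longrightarrow> (\<alpha>, \<alpha>) \<in> r" using *(1) by (rule refl_onD)
  show "(\<alpha>, \<beta>) \<in> r \<or> (\<beta>, \<alpha>) \<in> r" if "\<alpha> \<in> nat_pow p" "\<beta> \<in> nat_pow p"
    using *(4) refl_onD[OF *(1) that(1)] that unfolding total_on_def by (cases "\<alpha> = \<beta>") simp_all
  show "(\<alpha>, \<beta>) \<in> r \<Longrightarrow> (\<beta>, \<gamma>) \<in> r \<Longrightarrow> (\<alpha>, \<gamma>) \<in> r" using *(2) by (rule transD)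
  show "(\<alpha>, \<beta>) \<in> r \<Longrightarrow> (\<beta>, \<alpha>) \<in> r \<Longrightarrow> \<alpha> = \<beta>" using *(3) by (rule antisymD)
qed

lemma exp_plus_closed: "\<alpha> \<in> nat_pow p \<Longrightarrow> \<beta> \<in> nat_pow p \<Longrightarrow> exp_plus \<alpha> \<beta> \<in> nat_pow p"
  by (simp add: exp_plus_def nat_pow_def)

lemma exp_plus_comm: "exp_plus \<alpha> \<beta> = exp_plus \<beta> \<alpha>"
  by (simp add: exp_plus_def add.commute)

lemma r_add:
  assumes "\<alpha> \<in> nat_pow p" "\<beta> \<in> nat_pow p" "\<gamma> \<in> nat_pow p" "(\<alpha>, \<beta>) \<in> r"
  shows "(exp_plus \<alpha> \<gamma>, exp_plus \<beta> \<gamma>) \<in> r"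
  using r_add_prec[OF assms(1-3)] assms(4) r_refl[OF exp_plus_closed[OF assms(1,3)]]
  by (cases "\<alpha> = \<beta>") (auto simp: prec_def)

text \<open>The second clause says that the sum of two maxima is attained by one pair only, which
  prevents cancellation at the leading exponent of a product.\<close>

lemma r_add2:
  assumes "\<alpha> \<in> nat_pow p" "\<alpha>' \<in> nat_pow p" "\<beta> \<in> nat_pow p" "\<beta>' \<in> nat_pow p" "(\<alpha>, \<alpha>') \<in> r" "(\<beta>, \<beta>') \<in> r"
  shows "(exp_plus \<alpha> \<beta>, exp_plus \<alpha>' \<beta>') \<in> r"
    and "exp_plus \<alpha> \<beta> = exp_plus \<alpha>' \<beta>' \<Longrightarrow> \<alpha> = \<alpha>' \<and> \<beta> = \<beta>'"
proof -
  have 1: "(exp_plus \<alpha> \<beta>, exp_plus \<alpha>' \<beta>) \<in> r" by (rule r_add) (use assms in auto)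
  have 2: "(exp_plus \<alpha>' \<beta>, exp_plus \<alpha>' \<beta>') \<in> r"
    unfolding exp_plus_comm[of \<alpha>'] by (rule r_add) (use assms in auto)
  show "(exp_plus \<alpha> \<beta>, exp_plus \<alpha>' \<beta>') \<in> r" using r_trans[OF 1 2] .
  assume eq: "exp_plus \<alpha> \<beta> = exp_plus \<alpha>' \<beta>'"
  then have eq': "exp_plus \<alpha> \<beta> = exp_plus \<alpha>' \<beta>" using r_antisym[OF 1] 2 by simp
  have a: "\<alpha> i = \<alpha>' i" for i using fun_cong[OF eq', of i] by (simp add: exp_plus_def)
  have b: "\<beta> i = \<beta>' i" for i using fun_cong[OF eq, of i] a[of i] by (simp add: exp_plus_def)
  show "\<alpha> = \<alpha>' \<and> \<beta> = \<beta>'" by (intro conjI ext a b)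
qed

text \<open>In a strictly descending chain Dickson's lemma finds an earlier term \<alpha> that is
  below a later term \<beta> in every coordinate. Then \<beta> = \<alpha> + \<gamma>, and 0
  \<preceq> \<gamma> gives \<alpha> \<preceq> \<beta> by compatibility with addition, against the
  descent.\<close>

lemma wf_prec: "wf {(\<alpha>, \<beta>). \<alpha> \<in> nat_pow p \<and> \<beta> \<in> nat_pow p \<and> prec r \<alpha> \<beta>}"
  unfolding wf_iff_no_infinite_down_chain
proof
  assume "\<exists>f. \<forall>i. (f (Suc i), f i) \<in> {(\<alpha>, \<beta>). \<alpha> \<in> nat_pow p \<and> \<beta> \<in> nat_pow p \<and> prec r \<alpha> \<beta>}"
  then obtain f where f: "\<And>i. f i \<in> nat_pow p" "\<And>i. prec r (f (Suc i)) (f i)" by blast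
  have less: "prec r (f j) (f i)" if "i < j" for i j
    using that
  proof (induction j rule: less_Suc_induct)
    case (1 i)
    then show ?case using f by blast
  next
    case (2 i j k)
    then have *: "(f j, f i) \<in> r" "(f k, f j) \<in> r" "f k \<noteq> f j" by (simp_all add: prec_def)
    have "(f k, f i) \<in> r" using r_trans[OF *(2,1)] .
    moreover have "f k \<noteq> f i" using r_antisym[OF *(2)] * by metis
    ultimately show ?case by (simp add: prec_def)
  qed
  obtain g where g: "strict_mono g" "\<forall>i\<in>{1..p}. incseq (\<lambda>k. f (g k) i)"
    using dickson_subseq[of "{1..p}" f] by auto
  let ?\<alpha> = "f (g 0)" and ?\<beta> = "f (g 1)"
  have lt: "prec r ?\<beta> ?\<alpha>" using less g(1) by (simp add: strict_mono_def)
  define \<gamma> where "\<gamma> = (\<lambda>i. ?\<beta> i - ?\<alpha> i)"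
  have \<gamma>: "\<gamma> \<in> nat_pow p" using f(1) by (simp add: \<gamma>_def nat_pow_def)
  have "?\<alpha> i \<le> ?\<beta> i" for i
    using g(2) f(1)[of "g 0"] by (cases "i \<in> {1..p}") (auto simp: incseq_def nat_pow_def)
  then have "exp_plus \<gamma> ?\<alpha> = ?\<beta>" by (auto simp: exp_plus_def \<gamma>_def)
  moreover have "exp_plus (\<lambda>i. 0) ?\<alpha> = ?\<alpha>" by (simp add: exp_plus_def)
  moreover have "(\<lambda>i. 0) \<in> nat_pow p" by (simp add: nat_pow_def)
  ultimately have "(?\<alpha>, ?\<beta>) \<in> r" using r_add[of "\<lambda>i. 0" \<gamma> ?\<alpha>] r_zero[OF \<gamma>] \<gamma> f(1) by simp
  then show False using lt r_antisym unfolding prec_def by blast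
qed

lemma r_max_exists: "finite S \<Longrightarrow> S \<noteq> {} \<Longrightarrow> S \<subseteq> nat_pow p \<Longrightarrow> \<exists>\<alpha>\<in>S. \<forall>\<beta>\<in>S. (\<beta>, \<alpha>) \<in> r"
proof (induction S rule: finite_ne_induct)
  case (singleton \<alpha>)
  then show ?case using r_refl by simp
next
  case (insert \<alpha> S)
  then obtain \<alpha>' where \<alpha>': "\<alpha>' \<in> S" "\<forall>\<beta>\<in>S. (\<beta>, \<alpha>') \<in> r" by auto
  have np: "\<alpha> \<in> nat_pow p" "\<alpha>' \<in> nat_pow p" using insert.prems \<alpha>' by auto
  show ?case
  proof (cases "(\<alpha>, \<alpha>') \<in> r")
    case True
    then show ?thesis using \<alpha>' by auto
  next
    case False
    then have "(\<alpha>', \<alpha>) \<in> r" using r_total[OF np] by blast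
    then have "\<forall>\<beta>\<in>insert \<alpha> S. (\<beta>, \<alpha>) \<in> r" using \<alpha>' r_trans r_refl[OF np(1)] by blast
    then show ?thesis by blast
  qed
qed

text \<open>A relational form of the exponent that forces u to be a nonzero element of the algebra,
  so that later arguments need no description operator.\<close>

definition lead :: "('v list \<Rightarrow> 'k) set set \<Rightarrow> (nat \<Rightarrow> nat) \<Rightarrow> bool" where
  "lead u \<alpha> \<longleftrightarrow> u \<in> carrier E.U \<and> co u \<alpha> \<noteq> 0 \<and> (\<forall>\<beta>. co u \<beta> \<noteq> 0 \<longrightarrow> (\<beta>, \<alpha>) \<in> r)"

lemma lead_closed: "lead u \<alpha> \<Longrightarrow> u \<in> carrier E.U"
  and lead_nat_pow: "lead u \<alpha> \<Longrightarrow> \<alpha> \<in> nat_pow p"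
  using co_expansion(2)[of u] by (auto simp: lead_def)

lemma lead_nonzero: "lead u \<alpha> \<Longrightarrow> u \<noteq> \<zero>\<^sub>U"
  by (auto simp: lead_def co_zero)

lemma lead_exists:
  assumes "u \<in> carrier E.U" "u \<noteq> \<zero>\<^sub>U"
  shows "\<exists>\<alpha>. lead u \<alpha>"
  using r_max_exists[OF co_expansion(1)[OF assms(1)] _ co_expansion(2)[OF assms(1)]]
    co_eq_zero_iff[OF assms(1)] assms unfolding lead_def by blast

lemma lead_exponent: "lead u \<alpha> \<Longrightarrow> exponent E.U \<tau> p r u = \<alpha>"
  unfolding exponent_def newton_diagram_eq[OF lead_closed]
  by (rule the_equality) (use r_antisym in \<open>auto simp: lead_def newton_diagram_eq\<close>)

lemma co_UV_comb:
  assumes "finite T" "f \<in> T \<rightarrow> carrier E.U"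
  shows "co (UV.comb T f c) \<gamma> = (\<Sum>i\<in>T. c i * co (f i) \<gamma>)"
  using assms
proof (induction T)
  case empty
  then show ?case by (simp add: co_zero)
next
  case (insert i T)
  then have f: "f i \<in> carrier E.U" "f \<in> T \<rightarrow> carrier E.U" by auto
  then show ?case using insert UV.comb_closed[OF f(2)] by (simp add: UV.comb_insert co_add co_smult)
qed

text \<open>Admissibility prescribes the value of \<open>exponent\<close>; since the product is
  nonzero, this value is an actual maximum of its Newton diagram.\<close>

lemma lead_mon_mon:
  assumes "\<alpha> \<in> nat_pow p" "\<beta> \<in> nat_pow p"
  shows "lead (mon p \<alpha> \<otimes>\<^sub>U mon p \<beta>) (exp_plus \<alpha> \<beta>)"
proof -
  let ?u = "mon p \<alpha> \<otimes>\<^sub>U mon p \<beta>"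
  have "?u \<in> carrier E.U" using mon_closed by simp
  moreover have "?u \<noteq> \<zero>\<^sub>U" using co_mon_mon[OF assms] by (auto simp: co_zero)
  ultimately obtain \<gamma> where \<gamma>: "lead ?u \<gamma>" using lead_exists by blast
  then show ?thesis using lead_exponent[OF \<gamma>] exponent_mon_mon[OF assms] by simp
qed

text \<open>After expanding both factors, the pair of leading exponents is the only one whose
  product of monomials reaches \<alpha> + \<beta>. The coefficient there is the product of the two
  leading coefficients and that of the product of monomials, all nonzero.\<close>

lemma lead_mult:
  assumes u: "lead u \<alpha>" and v: "lead v \<beta>"
  shows "lead (u \<otimes>\<^sub>U v) (exp_plus \<alpha> \<beta>)"
proof -
  note mc = mon_closed[OF order_refl]
  note uc = lead_closed[OF u] and vc = lead_closed[OF v]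
  let ?S = "{\<alpha>. co u \<alpha> \<noteq> 0}" and ?T = "{\<alpha>. co v \<alpha> \<noteq> 0}"
  note S = co_expansion[OF uc] and T = co_expansion[OF vc]
  have "u \<otimes>\<^sub>U v = UV.comb ?S (mon p) (co u) \<otimes>\<^sub>U v" using S(3) by simp
  also have "\<dots> = UV.comb ?S (\<lambda>\<alpha>. mon p \<alpha> \<otimes>\<^sub>U v) (co u)"
    by (rule E.U.comb_mult_right) (use S(1) mc vc in auto)
  finally have "co (u \<otimes>\<^sub>U v) \<gamma> = (\<Sum>\<alpha>\<in>?S. co u \<alpha> * co (mon p \<alpha> \<otimes>\<^sub>U v) \<gamma>)" for \<gamma>
    using co_UV_comb[OF S(1), of "\<lambda>\<alpha>. mon p \<alpha> \<otimes>\<^sub>U v"] mc vc by simp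
  moreover have "co (mon p \<alpha> \<otimes>\<^sub>U v) \<gamma> = (\<Sum>\<beta>\<in>?T. co v \<beta> * co (mon p \<alpha> \<otimes>\<^sub>U mon p \<beta>) \<gamma>)" for \<alpha> \<gamma>
  proof -
    have "mon p \<alpha> \<otimes>\<^sub>U v = mon p \<alpha> \<otimes>\<^sub>U UV.comb ?T (mon p) (co v)" using T(3) by simp
    also have "\<dots> = UV.comb ?T (\<lambda>\<beta>. mon p \<alpha> \<otimes>\<^sub>U mon p \<beta>) (co v)"
      by (rule E.U.comb_mult_left) (use T(1) mc in auto)
    finally show ?thesis using co_UV_comb[OF T(1), of "\<lambda>\<beta>. mon p \<alpha> \<otimes>\<^sub>U mon p \<beta>"] mc by simp
  qed
  ultimately have co: "co (u \<otimes>\<^sub>U v) \<gamma> =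
      (\<Sum>\<alpha>\<in>?S. \<Sum>\<beta>\<in>?T. co u \<alpha> * (co v \<beta> * co (mon p \<alpha> \<otimes>\<^sub>U mon p \<beta>) \<gamma>))" for \<gamma>
    by (simp add: sum_distrib_left)
  have \<alpha>: "\<alpha> \<in> nat_pow p" and \<beta>: "\<beta> \<in> nat_pow p" using lead_nat_pow u v by blast+
  have bound: "(exp_plus \<alpha>' \<beta>', exp_plus \<alpha> \<beta>) \<in> r"
    "exp_plus \<alpha>' \<beta>' = exp_plus \<alpha> \<beta> \<Longrightarrow> \<alpha>' = \<alpha> \<and> \<beta>' = \<beta>"
    if "\<alpha>' \<in> ?S" "\<beta>' \<in> ?T" for \<alpha>' \<beta>'
    using r_add2[of \<alpha>' \<alpha> \<beta>' \<beta>] that S(2) T(2) \<alpha> \<beta> u v unfolding lead_def by blast+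
  have low: "(\<gamma>, exp_plus \<alpha>' \<beta>') \<in> r"
    if "\<alpha>' \<in> ?S" "\<beta>' \<in> ?T" "co (mon p \<alpha>' \<otimes>\<^sub>U mon p \<beta>') \<gamma> \<noteq> 0" for \<alpha>' \<beta>' \<gamma>
    using lead_mon_mon[of \<alpha>' \<beta>'] that S(2) T(2) unfolding lead_def by blast
  have le: "(\<gamma>, exp_plus \<alpha> \<beta>) \<in> r" if "co (u \<otimes>\<^sub>U v) \<gamma> \<noteq> 0" for \<gamma>
  proof -
    from that obtain \<alpha>' where a: "\<alpha>' \<in> ?S"
      "(\<Sum>\<beta>\<in>?T. co u \<alpha>' * (co v \<beta> * co (mon p \<alpha>' \<otimes>\<^sub>U mon p \<beta>) \<gamma>)) \<noteq> 0"
      unfolding co by (rule sum.not_neutral_contains_not_neutral)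
    from a(2) obtain \<beta>' where b: "\<beta>' \<in> ?T" "co u \<alpha>' * (co v \<beta>' * co (mon p \<alpha>' \<otimes>\<^sub>U mon p \<beta>') \<gamma>) \<noteq> 0"
      by (rule sum.not_neutral_contains_not_neutral)
    then have "co (mon p \<alpha>' \<otimes>\<^sub>U mon p \<beta>') \<gamma> \<noteq> 0" by auto
    then show ?thesis using r_trans[OF low[OF a(1) b(1)] bound(1)[OF a(1) b(1)]] by blast
  qed
  have zero: "co (mon p \<alpha>' \<otimes>\<^sub>U mon p \<beta>') (exp_plus \<alpha> \<beta>) = 0"
    if "\<alpha>' \<in> ?S" "\<beta>' \<in> ?T" "\<not> (\<alpha>' = \<alpha> \<and> \<beta>' = \<beta>)" for \<alpha>' \<beta>'
    using low[OF that(1,2), of "exp_plus \<alpha> \<beta>"] bound[OF that(1,2)] r_antisym that(3) by blast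
  have ST: "\<alpha> \<in> ?S" "\<beta> \<in> ?T" using u v by (auto simp: lead_def)
  have "co (u \<otimes>\<^sub>U v) (exp_plus \<alpha> \<beta>) =
      (\<Sum>\<alpha>'\<in>?S. if \<alpha>' = \<alpha> then \<Sum>\<beta>'\<in>?T. if \<beta>' = \<beta> then
        co u \<alpha> * (co v \<beta> * co (mon p \<alpha> \<otimes>\<^sub>U mon p \<beta>) (exp_plus \<alpha> \<beta>)) else 0 else 0)"
    unfolding co
  proof (rule sum.cong[OF refl])
    fix \<alpha>' assume a: "\<alpha>' \<in> ?S"
    show "(\<Sum>\<beta>'\<in>?T. co u \<alpha>' * (co v \<beta>' * co (mon p \<alpha>' \<otimes>\<^sub>U mon p \<beta>') (exp_plus \<alpha> \<beta>))) =
      (if \<alpha>' = \<alpha> then \<Sum>\<beta>'\<in>?T. if \<beta>' = \<beta> then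
        co u \<alpha> * (co v \<beta> * co (mon p \<alpha> \<otimes>\<^sub>U mon p \<beta>) (exp_plus \<alpha> \<beta>)) else 0 else 0)"
    proof (cases "\<alpha>' = \<alpha>")
      case True
      have "(\<Sum>\<beta>'\<in>?T. co u \<alpha>' * (co v \<beta>' * co (mon p \<alpha>' \<otimes>\<^sub>U mon p \<beta>') (exp_plus \<alpha> \<beta>))) =
        (\<Sum>\<beta>'\<in>?T. if \<beta>' = \<beta> then
          co u \<alpha> * (co v \<beta> * co (mon p \<alpha> \<otimes>\<^sub>U mon p \<beta>) (exp_plus \<alpha> \<beta>)) else 0)"
        by (rule sum.cong[OF refl]) (use True zero[OF a] in auto)
      then show ?thesis using True by simp
    next
      case False
      then show ?thesis using zero[OF a] by (auto intro!: sum.neutral)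
    qed
  qed
  also have "\<dots> = co u \<alpha> * (co v \<beta> * co (mon p \<alpha> \<otimes>\<^sub>U mon p \<beta>) (exp_plus \<alpha> \<beta>))"
    using S(1) T(1) ST by simp
  also have "\<dots> \<noteq> 0" using ST co_mon_mon[OF \<alpha> \<beta>] by simp
  finally show ?thesis using le uc vc unfolding lead_def by simp
qed

lemma lead_mon: "\<alpha> \<in> nat_pow p \<Longrightarrow> lead (mon p \<alpha>) \<alpha>"
  using mon_closed[of p] r_refl by (simp add: lead_def co_mon unit_fun_def)

lemma lead_one: "lead \<one>\<^sub>U (\<lambda>i. 0)"
proof -
  have "mon n (\<lambda>i. 0) = \<one>\<^sub>U" for n by (induction n) auto
  then show ?thesis using lead_mon[of "\<lambda>i. 0"] by (simp add: nat_pow_def)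
qed

lemma lead_pow: "lead u \<alpha> \<Longrightarrow> lead (u [^]\<^bsub>E.U\<^esub> (k::nat)) (\<lambda>i. k * \<alpha> i)"
proof (induction k)
  case 0
  then show ?case using lead_one by simp
next
  case (Suc k)
  have "exp_plus (\<lambda>i. k * \<alpha> i) \<alpha> = (\<lambda>i. Suc k * \<alpha> i)" by (simp add: exp_plus_def add.commute)
  then show ?case using lead_mult[OF Suc.IH[OF Suc.prems] Suc.prems] by simp
qed

lemma lead_monomial:
  assumes "\<And>i. i \<in> {1..n} \<Longrightarrow> lead (v i) (e i)"
  shows "lead (monomial E.U v n \<gamma>) (\<lambda>j. \<Sum>i\<in>{1..n}. \<gamma> i * e i j)"
  using assms
proof (induction n)
  case 0
  then show ?case using lead_one by simp
next
  case (Suc n)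
  have "exp_plus (\<lambda>j. \<Sum>i\<in>{1..n}. \<gamma> i * e i j) (\<lambda>j. \<gamma> (Suc n) * e (Suc n) j) =
      (\<lambda>j. \<Sum>i\<in>{1..Suc n}. \<gamma> i * e i j)"
    by (simp add: exp_plus_def)
  then show ?case
    using lead_mult[OF Suc.IH lead_pow[OF Suc.prems, of "Suc n" "\<gamma> (Suc n)"]] Suc.prems by simp
qed

text \<open>At the greatest exponent that occurs with nonzero coefficient nothing can cancel: every
  other member involved is bounded by a smaller exponent.\<close>

lemma lead_comb:
  assumes B: "\<And>\<alpha>. \<alpha> \<in> T \<Longrightarrow> lead (B \<alpha>) \<alpha>" and T: "finite T" and nz: "UV.comb T B c \<noteq> \<zero>\<^sub>U"
  shows "\<exists>\<alpha>\<in>T. lead (UV.comb T B c) \<alpha>"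
proof -
  have BT: "B \<in> T \<rightarrow> carrier E.U" using B lead_closed by blast
  let ?S = "{\<alpha>\<in>T. c \<alpha> \<noteq> 0}"
  have "?S \<noteq> {}"
  proof
    assume "?S = {}"
    then have "UV.comb T B c = \<zero>\<^sub>U" by (intro UV.comb_zero[OF BT]) auto
    then show False using nz by simp
  qed
  moreover have "?S \<subseteq> nat_pow p" using B lead_nat_pow by blast
  ultimately obtain \<alpha> where \<alpha>: "\<alpha> \<in> ?S" "\<forall>\<beta>\<in>?S. (\<beta>, \<alpha>) \<in> r"
    using r_max_exists[of ?S] T by auto
  have co: "co (UV.comb T B c) \<gamma> = (\<Sum>\<beta>\<in>T. c \<beta> * co (B \<beta>) \<gamma>)" for \<gamma>
    by (rule co_UV_comb[OF T BT])
  have "co (UV.comb T B c) \<alpha> = (\<Sum>\<beta>\<in>T. if \<beta> = \<alpha> then c \<alpha> * co (B \<alpha>) \<alpha> else 0)"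
    unfolding co
  proof (rule sum.cong[OF refl])
    fix \<beta> assume b: "\<beta> \<in> T"
    have "co (B \<beta>) \<alpha> = 0" if "\<beta> \<noteq> \<alpha>" "c \<beta> \<noteq> 0"
      using \<alpha>(2) b that B[OF b] r_antisym unfolding lead_def by blast
    then show "c \<beta> * co (B \<beta>) \<alpha> = (if \<beta> = \<alpha> then c \<alpha> * co (B \<alpha>) \<alpha> else 0)" by auto
  qed
  also have "\<dots> \<noteq> 0" using \<alpha> T B[of \<alpha>] by (auto simp: lead_def)
  finally have 1: "co (UV.comb T B c) \<alpha> \<noteq> 0" .
  have "(\<gamma>, \<alpha>) \<in> r" if "co (UV.comb T B c) \<gamma> \<noteq> 0" for \<gamma>
  proof -
    from that obtain \<beta> where b: "\<beta> \<in> T" "c \<beta> * co (B \<beta>) \<gamma> \<noteq> 0"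
      unfolding co by (rule sum.not_neutral_contains_not_neutral)
    then have "(\<gamma>, \<beta>) \<in> r" "(\<beta>, \<alpha>) \<in> r" using B[OF b(1)] \<alpha>(2) unfolding lead_def by auto
    then show ?thesis by (rule r_trans)
  qed
  then show ?thesis using 1 \<alpha>(1) UV.comb_closed[OF BT] unfolding lead_def by blast
qed

text \<open>Reduction along the well-founded order: a multiple of \<open>B \<alpha>\<close> removes
  the leading coefficient of u, and what remains is zero or leads strictly lower.\<close>

lemma lead_family_spans:
  assumes B: "\<And>\<alpha>. \<alpha> \<in> nat_pow p \<Longrightarrow> lead (B \<alpha>) \<alpha>" and u: "u \<in> carrier E.U"
  shows "u \<in> UV.lspan (nat_pow p) B"
proof -
  have BT: "B \<in> nat_pow p \<rightarrow> carrier E.U" using B lead_closed by blast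
  have "lead u \<alpha> \<longrightarrow> u \<in> UV.lspan (nat_pow p) B" for \<alpha> u
  proof (induction \<alpha> arbitrary: u rule: wf_induct_rule[OF wf_prec])
    case (1 \<alpha>)
    show ?case
    proof
      assume lu: "lead u \<alpha>"
      have \<alpha>: "\<alpha> \<in> nat_pow p" using lead_nat_pow[OF lu] .
      have Bl: "lead (B \<alpha>) \<alpha>" using B[OF \<alpha>] .
      define c where "c = - (co u \<alpha> / co (B \<alpha>) \<alpha>)"
      define w where "w = u \<oplus>\<^sub>U c \<odot>\<^sub>U B \<alpha>"
      have uc: "u \<in> carrier E.U" "B \<alpha> \<in> carrier E.U" using lead_closed lu Bl by blast+
      have wc: "w \<in> carrier E.U" using uc by (simp add: w_def)
      have cow: "co w \<gamma> = co u \<gamma> + c * co (B \<alpha>) \<gamma>" for \<gamma> using uc by (simp add: w_def co_add co_smult)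
      have w: "w \<in> UV.lspan (nat_pow p) B"
      proof (cases "w = \<zero>\<^sub>U")
        case True
        then show ?thesis using UV.lspan_zero by simp
      next
        case False
        obtain \<beta> where \<beta>: "lead w \<beta>" using lead_exists[OF wc False] by blast
        have "co w \<alpha> = 0" using Bl by (simp add: cow c_def lead_def)
        then have "\<beta> \<noteq> \<alpha>" using \<beta> by (auto simp: lead_def)
        moreover have "co u \<beta> \<noteq> 0 \<or> co (B \<alpha>) \<beta> \<noteq> 0" using \<beta> by (auto simp: lead_def cow)
        then have "(\<beta>, \<alpha>) \<in> r" using lu Bl unfolding lead_def by blast
        ultimately have "(\<beta>, \<alpha>) \<in> {(\<alpha>, \<beta>). \<alpha> \<in> nat_pow p \<and> \<beta> \<in> nat_pow p \<and> prec r \<alpha> \<beta>}"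
          using \<alpha> lead_nat_pow[OF \<beta>] by (simp add: prec_def)
        then show ?thesis using 1 \<beta> by blast
      qed
      have "u = w \<oplus>\<^sub>U (- c) \<odot>\<^sub>U B \<alpha>"
        using uc by (simp add: w_def E.U.smult_minus_left E.U.a_assoc E.U.r_neg)
      then show "u \<in> UV.lspan (nat_pow p) B"
        using UV.lspan_add[OF BT w UV.lspan_smult[OF BT UV.lspan_gen[OF BT \<alpha>]]] by metis
    qed
  qed
  then show ?thesis using lead_exists[OF u] UV.lspan_zero by blast
qed

end

section \<open>Groebner bases\<close>

lemma monomial_cong: "(\<And>i. i \<in> {1..n} \<Longrightarrow> \<alpha> i = \<beta> i) \<Longrightarrow> monomial A t n \<alpha> = monomial A t n \<beta>"
  by (induction n) auto

lemma (in assoc_alg) monomial_closed: "v \<in> {1..n} \<rightarrow> carrier A \<Longrightarrow> monomial A v n \<gamma> \<in> carrier A"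
  by (induction n) (auto simp: Pi_iff)

lemma (in assoc_alg) pow_commute:
  assumes "u \<in> carrier A" "v \<in> carrier A" "v \<otimes> u = c \<odot> (u \<otimes> v)"
  shows "v [^] (k::nat) \<otimes> u = (c ^ k) \<odot> (u \<otimes> v [^] k)"
proof (induction k)
  case (Suc k)
  have p: "v [^] k \<in> carrier A" using assms by simp
  have "v [^] Suc k \<otimes> u = v [^] k \<otimes> (v \<otimes> u)" using assms p by (simp add: m_assoc)
  also have "\<dots> = c \<odot> ((v [^] k \<otimes> u) \<otimes> v)"
    unfolding assms(3) using assms(1,2) p by (simp add: smult_mult_right m_assoc)
  also have "\<dots> = (c ^ Suc k) \<odot> (u \<otimes> v [^] Suc k)"
    unfolding Suc using assms(1,2) p by (simp add: smult_mult_left smult_smult m_assoc)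
  finally show ?case .
qed (use assms in simp)

text \<open>The new factor passes the powers of higher index up to scalars until it joins its own
  power.\<close>

lemma (in assoc_alg) monomial_mult:
  assumes "v \<in> {1..n} \<rightarrow> carrier A" "i \<in> {1..n}"
    and "\<And>i j. i \<in> {1..n} \<Longrightarrow> j \<in> {1..n} \<Longrightarrow> \<exists>c. v j \<otimes> v i = c \<odot> (v i \<otimes> v j)"
  shows "\<exists>c. monomial A v n \<gamma> \<otimes> v i = c \<odot> monomial A v n (\<gamma>(i := Suc (\<gamma> i)))"
  using assms
proof (induction n)
  case (Suc n)
  have v: "v i \<in> carrier A" "v (Suc n) \<in> carrier A" "v \<in> {1..n} \<rightarrow> carrier A"
    using Suc.prems by auto
  have p: "v (Suc n) [^] k \<in> carrier A" for k :: nat using v by simp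
  note mc = monomial_closed[OF v(3)]
  show ?case
  proof (cases "i = Suc n")
    case True
    have "monomial A v (Suc n) \<gamma> \<otimes> v i = monomial A v n \<gamma> \<otimes> v (Suc n) [^] Suc (\<gamma> (Suc n))"
      using True v mc p by (simp add: m_assoc)
    also have "monomial A v n \<gamma> = monomial A v n (\<gamma>(i := Suc (\<gamma> i)))"
      by (rule monomial_cong) (use True in auto)
    finally have "monomial A v (Suc n) \<gamma> \<otimes> v i = monomial A v (Suc n) (\<gamma>(i := Suc (\<gamma> i)))"
      using True by simp
    also have "\<dots> = 1 \<odot> monomial A v (Suc n) (\<gamma>(i := Suc (\<gamma> i)))"
      using monomial_closed[OF Suc.prems(1)] by (simp del: monomial.simps)
    finally show ?thesis by blast
  next
    case False
    then have i: "i \<in> {1..n}" using Suc.prems by auto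
    obtain c where c: "monomial A v n \<gamma> \<otimes> v i = c \<odot> monomial A v n (\<gamma>(i := Suc (\<gamma> i)))"
      using Suc.IH[OF v(3) i] Suc.prems(3) by fastforce
    obtain a where a: "v (Suc n) \<otimes> v i = a \<odot> (v i \<otimes> v (Suc n))"
      using Suc.prems(3)[of i "Suc n"] i by fastforce
    let ?p = "v (Suc n) [^] \<gamma> (Suc n)"
    have "monomial A v (Suc n) \<gamma> \<otimes> v i = monomial A v n \<gamma> \<otimes> (?p \<otimes> v i)"
      using v mc p by (simp add: m_assoc)
    also have "\<dots> = (a ^ \<gamma> (Suc n)) \<odot> ((monomial A v n \<gamma> \<otimes> v i) \<otimes> ?p)"
      unfolding pow_commute[OF v(1,2) a] using v mc p by (simp add: smult_mult_right m_assoc)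
    also have "\<dots> = (a ^ \<gamma> (Suc n) * c) \<odot> monomial A v (Suc n) (\<gamma>(i := Suc (\<gamma> i)))"
      unfolding c using False mc p by (simp add: smult_mult_left smult_smult)
    finally show ?thesis by blast
  qed
qed simp

context adm_gens
begin

text \<open>If the leading exponents of \<open>v\<^sub>1, \<dots>, v\<^sub>n\<close> are multiples of distinct unit vectors, division
  with remainder in these coordinates turns the ordered products of standard monomials and powers
  of the \<open>v\<^sub>i\<close> into a family with leading exponents \<open>\<alpha>\<close>, one for each \<open>\<alpha>\<close>.\<close>

lemma adapted_family:
  fixes v :: "nat \<Rightarrow> ('v list \<Rightarrow> 'k) set set" and s \<mu> :: "nat \<Rightarrow> nat" and n :: nat
  defines "e \<equiv> \<lambda>i j. if j = s i then \<mu> i else 0"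
  defines "M \<equiv> \<Union>i\<in>{1..n}. exp_plus (e i) ` nat_pow p"
  assumes lead_v: "\<And>i. i \<in> {1..n} \<Longrightarrow> lead (v i) (e i)"
    and s: "inj_on s {1..n}" "s ` {1..n} \<subseteq> {1..p}"
    and \<mu>: "\<And>i. i \<in> {1..n} \<Longrightarrow> \<mu> i > 0"
    and comm: "\<And>i j. i \<in> {1..n} \<Longrightarrow> j \<in> {1..n} \<Longrightarrow> \<exists>c. v j \<otimes>\<^sub>U v i = c \<odot>\<^sub>U (v i \<otimes>\<^sub>U v j)"
  shows "\<exists>B. (\<forall>\<alpha>\<in>nat_pow p. lead (B \<alpha>) \<alpha>) \<and>
    (\<forall>i\<in>{1..n}. \<forall>a\<in>carrier E.U. a \<otimes>\<^sub>U v i \<in> UV.lspan M B)"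
proof -
  define rem where "rem \<alpha> = (\<lambda>j. if j \<in> s ` {1..n} then \<alpha> j mod \<mu> (the_inv_into {1..n} s j) else \<alpha> j)" for \<alpha> :: "nat \<Rightarrow> nat"
  define quo where "quo \<alpha> = (\<lambda>i. \<alpha> (s i) div \<mu> i)" for \<alpha> :: "nat \<Rightarrow> nat"
  define B where "B \<alpha> = mon p (rem \<alpha>) \<otimes>\<^sub>U monomial E.U v n (quo \<alpha>)" for \<alpha>
  have rem_s: "rem \<alpha> (s i) = \<alpha> (s i) mod \<mu> i" if "i \<in> {1..n}" for \<alpha> i
    using the_inv_into_f_f[OF s(1) that] that by (simp add: rem_def)
  have rem: "rem \<alpha> \<in> nat_pow p" if "\<alpha> \<in> nat_pow p" for \<alpha>
    using that by (simp add: rem_def nat_pow_def)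
  have vc: "v \<in> {1..n} \<rightarrow> carrier E.U" using lead_closed[OF lead_v] by blast
  \<comment> \<open>Since s is injective, at most one \<open>v i\<close> contributes to a given
    coordinate, and there quotient and remainder recombine to the entry of \<alpha>.\<close>
  have decomp: "exp_plus (rem \<alpha>) (\<lambda>j. \<Sum>i\<in>{1..n}. quo \<alpha> i * e i j) = \<alpha>" for \<alpha>
  proof
    fix j
    show "exp_plus (rem \<alpha>) (\<lambda>j. \<Sum>i\<in>{1..n}. quo \<alpha> i * e i j) j = \<alpha> j"
    proof (cases "j \<in> s ` {1..n}")
      case True
      then obtain i where i: "i \<in> {1..n}" "j = s i" by blast
      have "(\<Sum>i'\<in>{1..n}. quo \<alpha> i' * e i' j) = (\<Sum>i'\<in>{1..n}. if i' = i then quo \<alpha> i * \<mu> i else 0)"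
      proof (rule sum.cong[OF refl])
        fix i' assume i': "i' \<in> {1..n}"
        show "quo \<alpha> i' * e i' j = (if i' = i then quo \<alpha> i * \<mu> i else 0)"
          using inj_on_eq_iff[OF s(1) i(1) i'] i(2) by (cases "i' = i") (simp_all add: e_def)
      qed
      also have "\<dots> = quo \<alpha> i * \<mu> i" using i by simp
      finally have 1: "(\<Sum>i'\<in>{1..n}. quo \<alpha> i' * e i' j) = quo \<alpha> i * \<mu> i" .
      have "rem \<alpha> j + quo \<alpha> i * \<mu> i = \<alpha> j"
        using rem_s[OF i(1), of \<alpha>] i(2) mod_div_mult_eq[of "\<alpha> j" "\<mu> i"] by (simp add: quo_def)
      then show ?thesis unfolding exp_plus_def 1 .
    next
      case False
      then have "(\<Sum>i'\<in>{1..n}. quo \<alpha> i' * e i' j) = 0" by (intro sum.neutral) (auto simp: e_def)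
      then show ?thesis using False by (simp add: exp_plus_def rem_def)
    qed
  qed
  have B_lead: "lead (B \<alpha>) \<alpha>" if "\<alpha> \<in> nat_pow p" for \<alpha>
    using lead_mult[OF lead_mon[OF rem[OF that]] lead_monomial[of n v e "quo \<alpha>", OF lead_v]]
    unfolding decomp B_def by simp
  have e_nat_pow: "e i \<in> nat_pow p" if "i \<in> {1..n}" for i using lead_nat_pow[OF lead_v[OF that]] .
  have MP: "M \<subseteq> nat_pow p" unfolding M_def using e_nat_pow exp_plus_closed by blast
  have BM: "B \<in> M \<rightarrow> carrier E.U" using B_lead lead_closed MP by blast
  \<comment> \<open>Raising \<alpha> by the leading exponent of \<open>v i\<close> raises one
    quotient by 1 and keeps all remainders. So right multiplication by \<open>v i\<close> sends each
    member of the family to a multiple of a member with index in M.\<close>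
  have step: "B \<alpha> \<otimes>\<^sub>U v i \<in> UV.lspan M B" if \<alpha>: "\<alpha> \<in> nat_pow p" and i: "i \<in> {1..n}" for \<alpha> i
  proof -
    let ?\<beta> = "exp_plus (e i) \<alpha>"
    have rem': "rem ?\<beta> = rem \<alpha>"
    proof
      fix j
      show "rem ?\<beta> j = rem \<alpha> j"
      proof (cases "j = s i")
        case True
        then show ?thesis using rem_s[OF i] by (simp add: exp_plus_def e_def)
      next
        case False
        then show ?thesis by (simp add: rem_def exp_plus_def e_def)
      qed
    qed
    have quo': "monomial E.U v n (quo ?\<beta>) = monomial E.U v n ((quo \<alpha>)(i := Suc (quo \<alpha> i)))"
    proof (rule monomial_cong)
      fix i' assume i': "i' \<in> {1..n}"
      show "quo ?\<beta> i' = ((quo \<alpha>)(i := Suc (quo \<alpha> i))) i'"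
        using inj_on_eq_iff[OF s(1) i i'] \<mu>[OF i]
        by (cases "i' = i") (simp_all add: quo_def exp_plus_def e_def)
    qed
    obtain c where c: "monomial E.U v n (quo \<alpha>) \<otimes>\<^sub>U v i =
        c \<odot>\<^sub>U monomial E.U v n ((quo \<alpha>)(i := Suc (quo \<alpha> i)))"
      using E.U.monomial_mult[OF vc i comm] by blast
    have "B \<alpha> \<otimes>\<^sub>U v i = mon p (rem \<alpha>) \<otimes>\<^sub>U (monomial E.U v n (quo \<alpha>) \<otimes>\<^sub>U v i)"
      unfolding B_def using mon_closed[of p] E.U.monomial_closed[OF vc] funcset_mem[OF vc i]
      by (simp add: E.U.m_assoc)
    also have "\<dots> = c \<odot>\<^sub>U B ?\<beta>"
      unfolding c B_def rem' quo' using mon_closed[of p] E.U.monomial_closed[OF vc]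
      by (simp add: E.U.smult_mult_right)
    finally have eq: "B \<alpha> \<otimes>\<^sub>U v i = c \<odot>\<^sub>U B ?\<beta>" .
    have "?\<beta> \<in> M" unfolding M_def using i \<alpha> by blast
    then show ?thesis unfolding eq by (intro UV.lspan_smult[OF BM] UV.lspan_gen[OF BM])
  qed
  \<comment> \<open>The whole family spans the algebra, so the previous step carries over from its
    members to an arbitrary left factor.\<close>
  have "a \<otimes>\<^sub>U v i \<in> UV.lspan M B" if a: "a \<in> carrier E.U" and i: "i \<in> {1..n}" for a i
  proof -
    obtain T c where T: "finite T" "T \<subseteq> nat_pow p" "a = UV.comb T B c"
      using lead_family_spans[OF B_lead a] unfolding UV.lspan_def by blast
    have BT: "B \<in> T \<rightarrow> carrier E.U" using B_lead lead_closed T(2) by blast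
    have vi: "v i \<in> carrier E.U" using funcset_mem[OF vc i] .
    have "a \<otimes>\<^sub>U v i = UV.comb T (\<lambda>\<alpha>. B \<alpha> \<otimes>\<^sub>U v i) c"
      unfolding T(3) by (rule E.U.comb_mult_right[OF T(1) BT vi])
    also have "\<dots> \<in> UV.lspan M B"
    proof (rule UV.comb_in_subset[OF T(1)])
      show "(\<lambda>\<alpha>. B \<alpha> \<otimes>\<^sub>U v i) \<in> T \<rightarrow> carrier E.U" using BT vi by auto
      show "\<zero>\<^sub>U \<in> UV.lspan M B" by (rule UV.lspan_zero)
      show "w \<oplus>\<^sub>U z \<in> UV.lspan M B" if "w \<in> UV.lspan M B" "z \<in> UV.lspan M B" for w z
        using UV.lspan_add[OF BM that] .
      show "c \<alpha> \<odot>\<^sub>U (B \<alpha> \<otimes>\<^sub>U v i) \<in> UV.lspan M B" if "\<alpha> \<in> T" for \<alpha>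
        by (rule UV.lspan_smult[OF BM step[OF _ i]]) (use that T(2) in blast)
    qed
    finally show ?thesis .
  qed
  then show ?thesis using B_lead by blast
qed

section \<open>Leading exponents of elements of the plus part\<close>

lemma mon_single:
  assumes "s \<in> {1..p}"
  shows "mon p (\<lambda>j. if j = s then k else 0) = \<tau> s [^]\<^bsub>E.U\<^esub> k"
proof -
  have "n \<le> p \<Longrightarrow> mon n (\<lambda>j. if j = s then k else 0) = (if s \<le> n then \<tau> s [^]\<^bsub>E.U\<^esub> k else \<one>\<^sub>U)" for n
  proof (induction n)
    case 0
    then show ?case using assms by simp
  next
    case (Suc n)
    have c: "\<tau> (Suc n) \<in> carrier E.U" "\<tau> s \<in> carrier E.U" using \<tau>_closed Suc.prems assms by simp_all
    consider "s \<le> n" | "s = Suc n" | "Suc n < s" by linarith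
    then show ?case by cases (use Suc c in simp_all)
  qed
  then show ?thesis using assms by simp
qed

text \<open>For i < j the bracket [x_i, x_j] is t_s itself, whereas [x_j, x_j] is 2 t_s^2 with t_s =
  x_j; hence the entry 2 on the diagonal.\<close>

definition y_exp :: "nat \<times> nat \<Rightarrow> nat \<Rightarrow> nat" where
  "y_exp = (\<lambda>(i, j) s. if s = pair_index i j then (if i = j then 2 else 1) else 0)"

lemma pair_index_range: "(i, j) \<in> pairs \<Longrightarrow> pair_index i j \<in> {1..p}"
  unfolding p pair_index_image[symmetric] pairs_def by auto

lemma y_exp_nat_pow: "q \<in> pairs \<Longrightarrow> y_exp q \<in> nat_pow p"
  using pair_index_range by (cases q) (auto simp: y_exp_def nat_pow_def)

lemma y_exp_inj:
  assumes "q \<in> pairs" "q' \<in> pairs" "y_exp q = y_exp q'"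
  shows "q = q'"
proof -
  obtain i j i' j' where q: "q = (i, j)" "q' = (i', j')" by fastforce
  have "y_exp q' (pair_index i j) \<noteq> 0" using assms(3)[symmetric] q by (simp add: y_exp_def)
  then have "pair_index i j = pair_index i' j'" using q by (auto simp: y_exp_def split: if_splits)
  then show ?thesis using assms q pair_index_eq_iff by (simp add: pairs_def)
qed

text \<open>\<kappa> is 1 off the diagonal and 2 on it; the latter is nonzero because the
  characteristic is not 2.\<close>

lemma co_inc_y:
  assumes "q \<in> pairs"
  shows "\<exists>\<kappa>. \<kappa> \<noteq> 0 \<and> (\<forall>\<gamma>. co (E.inc (y q)) \<gamma> = \<kappa> * unit_fun (y_exp q) \<gamma>)"
proof -
  obtain i j where q: "q = (i, j)" "1 \<le> i" "i \<le> j" "j \<le> m" using assms by (auto simp: pairs_def)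
  have s: "pair_index i j \<in> {1..p}" using pair_index_range assms q by simp
  have e: "y_exp q = (\<lambda>s. if s = pair_index i j then (if i = j then 2 else 1) else 0)"
    by (simp add: y_exp_def q)
  have mon: "mon p (y_exp q) = \<tau> (pair_index i j) [^]\<^bsub>E.U\<^esub> (if i = j then 2 else 1 :: nat)"
    unfolding e by (rule mon_single[OF s])
  have \<tau>c: "\<tau> (pair_index i j) \<in> carrier E.U" by (rule \<tau>_closed[OF s])
  show ?thesis
  proof (cases "i = j")
    case False
    then have "E.inc (y q) = mon p (y_exp q)"
      using t_off_diag[of i j] q mon \<tau>c by (simp add: \<tau>_apply y_def)
    then show ?thesis using co_mon[OF y_exp_nat_pow[OF assms]] by (intro exI[of _ 1]) simp
  next
    case True
    have "mon p (y_exp q) = E.inc (x j) \<otimes>\<^sub>U E.inc (x j)"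
      using mon True t_diag[of j] q \<tau>c by (simp add: \<tau>_apply numeral_2_eq_2)
    then have "E.inc (y q) = mon p (y_exp q) \<oplus>\<^sub>U mon p (y_exp q)"
      using inc_bracket_self[of j] q True by (simp add: y_def)
    then have "co (E.inc (y q)) \<gamma> = 2 * unit_fun (y_exp q) \<gamma>" for \<gamma>
      using co_mon[OF y_exp_nat_pow[OF assms]] mon_closed[of p] by (simp add: co_add)
    then show ?thesis using two_neq_zero by blast
  qed
qed

lemma inc_comb:
  assumes "finite J" "f \<in> J \<rightarrow> carrier L"
  shows "E.inc (comb J f c) = UV.comb J (\<lambda>j. E.inc (f j)) c"
  using assms
proof (induction J)
  case empty
  then show ?case by (simp add: inc_zero)
next
  case (insert j J)
  then have f: "f j \<in> carrier L" "f \<in> J \<rightarrow> carrier L" "(\<lambda>j. E.inc (f j)) \<in> insert j J \<rightarrow> carrier E.U"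
    using inc_closed by auto
  then show ?case using insert comb_closed[OF f(2)]
    by (simp add: comb_insert UV.comb_insert inc_add inc_smult)
qed

text \<open>Each bracket with i \<le> j has a single exponent in its Newton diagram, and these
  exponents are pairwise different. A combination of them therefore has no cancellation and no other
  exponents.\<close>

lemma lead_plus_part:
  assumes k: "k \<in> plus_part \<epsilon> L" "k \<noteq> \<zero>"
  shows "\<exists>q\<in>pairs. lead (E.inc k) (y_exp q)"
proof -
  obtain c where c: "k = comb pairs y c" using k(1) y_range by auto
  have yc: "y q \<in> carrier L" if "q \<in> pairs" for q using funcset_mem[OF y_closed that] .
  have "\<forall>q\<in>pairs. \<exists>\<kappa>. \<kappa> \<noteq> 0 \<and> (\<forall>\<gamma>. co (E.inc (y q)) \<gamma> = \<kappa> * unit_fun (y_exp q) \<gamma>)"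
    using co_inc_y by blast
  then obtain \<kappa> where \<kappa>: "\<And>q. q \<in> pairs \<Longrightarrow> \<kappa> q \<noteq> 0"
    "\<And>q \<gamma>. q \<in> pairs \<Longrightarrow> co (E.inc (y q)) \<gamma> = \<kappa> q * unit_fun (y_exp q) \<gamma>"
    by metis
  have kc: "E.inc k \<in> carrier E.U" using inc_closed k(1) subspace_closed(1)[OF parts_subspace(1)] by blast
  have "co (E.inc k) \<gamma> = (\<Sum>q\<in>pairs. c q * co (E.inc (y q)) \<gamma>)" for \<gamma>
    unfolding c inc_comb[OF finite_pairs y_closed]
    by (rule co_UV_comb[OF finite_pairs]) (use yc inc_closed in auto)
  then have co: "co (E.inc k) \<gamma> = (\<Sum>q\<in>pairs. c q * (\<kappa> q * unit_fun (y_exp q) \<gamma>))" for \<gamma>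
    using \<kappa>(2) by simp
  obtain q0 where q0: "q0 \<in> pairs" "c q0 \<noteq> 0"
    using k(2) comb_zero[OF y_closed, of c] c by blast
  have "co (E.inc k) (y_exp q0) = (\<Sum>q\<in>pairs. if q = q0 then c q0 * \<kappa> q0 else 0)"
    unfolding co
  proof (rule sum.cong[OF refl])
    fix q assume "q \<in> pairs"
    then show "c q * (\<kappa> q * unit_fun (y_exp q) (y_exp q0)) = (if q = q0 then c q0 * \<kappa> q0 else 0)"
      using y_exp_inj[OF q0(1), of q] by (cases "q = q0") (auto simp: unit_fun_def)
  qed
  also have "\<dots> = c q0 * \<kappa> q0" using finite_pairs q0(1) by simp
  finally have "co (E.inc k) (y_exp q0) \<noteq> 0" using q0 \<kappa>(1) by simp
  then have "E.inc k \<noteq> \<zero>\<^sub>U" by (auto simp: co_zero)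
  then obtain \<alpha> where \<alpha>: "lead (E.inc k) \<alpha>" using lead_exists[OF kc] by blast
  then have "(\<Sum>q\<in>pairs. c q * (\<kappa> q * unit_fun (y_exp q) \<alpha>)) \<noteq> 0" using co by (simp add: lead_def)
  then obtain q where "q \<in> pairs" "c q * (\<kappa> q * unit_fun (y_exp q) \<alpha>) \<noteq> 0"
    by (rule sum.not_neutral_contains_not_neutral)
  then have "\<alpha> = y_exp q" "q \<in> pairs" by (auto simp: unit_fun_def split: if_splits)
  then show ?thesis using \<alpha> by blast
qed

end

section \<open>The Groebner basis of the ideal generated by K\<close>

locale groebner_setup = adm_gens \<epsilon> L x m t p r + central_subspace \<epsilon> L K
  for \<epsilon> :: "'g::ab_group_add \<Rightarrow> 'g \<Rightarrow> 'k::field" and L :: "('k, 'v, 'g) color_alg" (structure) and x m t p r K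
begin

text \<open>An element of I is a combination of members of the adapted family with index in M, so
  its exponent lies in M. Conversely the products of ordered monomials with the u_i lie in I and
  reach every exponent in M.\<close>

lemma groebner:
  assumes u: "homogeneous_basis L K n u"
    and incr: "\<And>i j. 1 \<le> i \<Longrightarrow> i < j \<Longrightarrow> j \<le> n \<Longrightarrow>
      prec r (exponent E.U \<tau> p r (E.inc (u i))) (exponent E.U \<tau> p r (E.inc (u j)))"
  shows "groebner_basis E.U \<tau> p r (genideal E.U (E.inc ` K)) (E.inc ` u ` {1..n})"
proof -
  have u_range: "K = range (comb {1..n} u)" and u_indep: "indep {1..n} u" and uK: "u \<in> {1..n} \<rightarrow> K"
    using basis_subspace_image[OF K_subspace, of "{1..n}" u] u by (auto simp: homogeneous_basis_def)
  have u_closed: "u \<in> {1..n} \<rightarrow> carrier L" using uK K_carrier by blast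
  have u_nz: "u i \<noteq> \<zero>" if "i \<in> {1..n}" for i
    using indepD[OF u_indep, of "\<lambda>j. if j = i then 1 else 0" i] comb_single[OF _ u_closed, of i 1] that by auto
  define v where "v i = E.inc (u i)" for i
  have vc: "v i \<in> carrier E.U" if "i \<in> {1..n}" for i
    unfolding v_def using inc_closed funcset_mem[OF u_closed that] by blast
  have "\<forall>i\<in>{1..n}. \<exists>q. q \<in> pairs \<and> lead (v i) (y_exp q)"
  proof
    fix i assume i: "i \<in> {1..n}"
    have "u i \<in> plus_part \<epsilon> L" using funcset_mem[OF uK i] sub_plus by blast
    from lead_plus_part[OF this u_nz[OF i]] show "\<exists>q. q \<in> pairs \<and> lead (v i) (y_exp q)"
      unfolding v_def by blast
  qed
  then obtain Q where Q: "\<And>i. i \<in> {1..n} \<Longrightarrow> Q i \<in> pairs" "\<And>i. i \<in> {1..n} \<Longrightarrow> lead (v i) (y_exp (Q i))"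
    by metis
  \<comment> \<open>\<open>Q i\<close> names the bracket whose exponent leads u_i;
    \<open>s i\<close> is the axis of this exponent and \<open>\<mu> i\<close> its entry there,
    which is 2 exactly for a diagonal bracket.\<close>
  define s where "s i = pair_index (fst (Q i)) (snd (Q i))" for i
  define \<mu> where "\<mu> i = (if fst (Q i) = snd (Q i) then 2 else 1 :: nat)" for i
  define e where "e = (\<lambda>i j. if j = s i then \<mu> i else 0)"
  have e: "y_exp (Q i) = e i" for i
    by (cases "Q i") (auto simp: y_exp_def e_def s_def \<mu>_def)
  have lead_v: "lead (v i) (e i)" if "i \<in> {1..n}" for i using Q(2)[OF that] e by simp
  have exponent_v: "exponent E.U \<tau> p r (v i) = e i" if "i \<in> {1..n}" for i
    using lead_exponent[OF lead_v[OF that]] .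
  \<comment> \<open>The strict increase of the u_i is used to separate their exponents.\<close>
  have e_less: "e i \<noteq> e j" if "i \<in> {1..n}" "j \<in> {1..n}" "i < j" for i j
    using incr[of i j] exponent_v[OF that(1)] exponent_v[OF that(2)] that by (auto simp: prec_def v_def)
  have e_inj: "i = j" if "i \<in> {1..n}" "j \<in> {1..n}" "e i = e j" for i j
    using e_less[of i j] e_less[of j i] that by (cases i j rule: linorder_cases) simp_all
  \<comment> \<open>Two exponents on one axis would be equal, since the axis determines the pair and
    with it the entry 1 or 2.\<close>
  have s_inj: "inj_on s {1..n}"
  proof (rule inj_onI)
    fix i j assume ij: "i \<in> {1..n}" "j \<in> {1..n}" "s i = s j"
    have "Q i = Q j"
      using ij(3) Q(1)[OF ij(1)] Q(1)[OF ij(2)] pair_index_eq_iff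
      by (cases "Q i"; cases "Q j") (simp add: s_def pairs_def)
    then show "i = j" using e_inj[OF ij(1,2)] e[of i] e[of j] by simp
  qed
  have s_range: "s ` {1..n} \<subseteq> {1..p}"
  proof
    fix j assume "j \<in> s ` {1..n}"
    then obtain i where i: "i \<in> {1..n}" "j = s i" by blast
    show "j \<in> {1..p}" using pair_index_range[of "fst (Q i)" "snd (Q i)"] Q(1)[OF i(1)] i(2) by (simp add: s_def)
  qed
  have comm: "\<exists>c. v j \<otimes>\<^sub>U v i = c \<odot>\<^sub>U (v i \<otimes>\<^sub>U v j)" if ij: "i \<in> {1..n}" "j \<in> {1..n}" for i j
  proof -
    obtain g h where gh: "u j \<in> homog L g" "u i \<in> homog L h"
      using u ij unfolding homogeneous_basis_def by blast
    have "u j \<in> plus_part \<epsilon> L" using funcset_mem[OF uK ij(2)] sub_plus by blast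
    then show ?thesis unfolding v_def using inc_K_comm[OF _ gh] by blast
  qed
  define M where "M = (\<Union>i\<in>{1..n}. exp_plus (e i) ` nat_pow p)"
  have "\<exists>B. (\<forall>\<alpha>\<in>nat_pow p. lead (B \<alpha>) \<alpha>) \<and>
      (\<forall>i\<in>{1..n}. \<forall>a\<in>carrier E.U. a \<otimes>\<^sub>U v i \<in> UV.lspan M B)"
    unfolding M_def e_def
    by (rule adapted_family[OF lead_v[unfolded e_def] s_inj s_range _ comm]) (simp_all add: \<mu>_def)
  then obtain B where B: "\<forall>\<alpha>\<in>nat_pow p. lead (B \<alpha>) \<alpha>"
    "\<forall>i\<in>{1..n}. \<forall>a\<in>carrier E.U. a \<otimes>\<^sub>U v i \<in> UV.lspan M B"
    by blast
  have e_nat_pow: "e i \<in> nat_pow p" if "i \<in> {1..n}" for i using lead_nat_pow[OF lead_v[OF that]] .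
  have MP: "M \<subseteq> nat_pow p" unfolding M_def using e_nat_pow exp_plus_closed by blast
  have BM: "B \<in> M \<rightarrow> carrier E.U" using B(1) lead_closed MP by blast
  have span: "z \<in> UV.lspan M B" if "z \<in> P" for z
    using that
  proof (induction rule: ideal_prod.induct)
    case (prod a w)
    then obtain k where k: "k \<in> K" "w = E.inc k" by blast
    obtain c where c: "k = comb {1..n} u c" using k(1) u_range by blast
    have "a \<otimes>\<^sub>U w = a \<otimes>\<^sub>U UV.comb {1..n} v c"
      unfolding k(2) c v_def by (subst inc_comb[OF _ u_closed]) simp_all
    also have "\<dots> = UV.comb {1..n} (\<lambda>i. a \<otimes>\<^sub>U v i) c"
      by (rule E.U.comb_mult_left) (use vc prod in auto)
    also have "\<dots> \<in> UV.lspan M B"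
    proof (rule UV.comb_in_subset)
      show "(\<lambda>i. a \<otimes>\<^sub>U v i) \<in> {1..n} \<rightarrow> carrier E.U" using vc prod by auto
      show "\<zero>\<^sub>U \<in> UV.lspan M B" by (rule UV.lspan_zero)
      show "w \<oplus>\<^sub>U z \<in> UV.lspan M B" if "w \<in> UV.lspan M B" "z \<in> UV.lspan M B" for w z
        using UV.lspan_add[OF BM that] .
      show "c i \<odot>\<^sub>U (a \<otimes>\<^sub>U v i) \<in> UV.lspan M B" if "i \<in> {1..n}" for i
        using UV.lspan_smult[OF BM] B(2) that prod(1) by blast
    qed simp
    finally show ?case .
  next
    case (sum w z)
    then show ?case using UV.lspan_add[OF BM] by blast
  qed
  have I: "ideal (genideal E.U (E.inc ` K)) E.U" by (rule E.U.genideal_ideal[OF inc_K_closed])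
  have v_in: "v i \<in> genideal E.U (E.inc ` K)" if "i \<in> {1..n}" for i
    unfolding v_def using E.U.genideal_self[OF inc_K_closed] funcset_mem[OF uK that] by blast
  show ?thesis
    unfolding groebner_basis_def
  proof (intro conjI)
    show "left_ideal (genideal E.U (E.inc ` K)) E.U"
      unfolding left_ideal_def
      by (intro conjI ballI ideal.axioms(1)[OF I] ideal.I_l_closed[OF I])
    show "finite (E.inc ` u ` {1..n})" by simp
    show "E.inc ` u ` {1..n} \<subseteq> genideal E.U (E.inc ` K) - {\<zero>\<^sub>U}"
    proof
      fix w assume "w \<in> E.inc ` u ` {1..n}"
      then obtain i where i: "i \<in> {1..n}" "w = v i" unfolding v_def by blast
      show "w \<in> genideal E.U (E.inc ` K) - {\<zero>\<^sub>U}"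
        unfolding i(2) using v_in[OF i(1)] lead_nonzero[OF lead_v[OF i(1)]] by simp
    qed
    have "(\<Union>w\<in>E.inc ` u ` {1..n}. exp_plus (exponent E.U \<tau> p r w) ` nat_pow p) = M"
      unfolding M_def using exponent_v unfolding v_def by auto
    moreover have "{exponent E.U \<tau> p r f |f. f \<in> genideal E.U (E.inc ` K) \<and> f \<noteq> \<zero>\<^sub>U} = M"
    proof
      show "{exponent E.U \<tau> p r f |f. f \<in> genideal E.U (E.inc ` K) \<and> f \<noteq> \<zero>\<^sub>U} \<subseteq> M"
      proof
        fix \<alpha> assume "\<alpha> \<in> {exponent E.U \<tau> p r f |f. f \<in> genideal E.U (E.inc ` K) \<and> f \<noteq> \<zero>\<^sub>U}"
        then obtain f where f: "\<alpha> = exponent E.U \<tau> p r f" "f \<in> P" "f \<noteq> \<zero>\<^sub>U"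
          unfolding I_eq_P by blast
        obtain T c where T: "finite T" "T \<subseteq> M" "f = UV.comb T B c"
          using span[OF f(2)] unfolding UV.lspan_def by blast
        have "\<exists>\<beta>\<in>T. lead (UV.comb T B c) \<beta>"
          by (rule lead_comb[OF _ T(1)]) (use B(1) T MP f(3) in auto)
        then obtain \<beta> where "\<beta> \<in> T" "lead f \<beta>" using T(3) by blast
        then show "\<alpha> \<in> M" using lead_exponent f(1) T(2) by blast
      qed
      show "M \<subseteq> {exponent E.U \<tau> p r f |f. f \<in> genideal E.U (E.inc ` K) \<and> f \<noteq> \<zero>\<^sub>U}"
      proof
        fix \<alpha> assume "\<alpha> \<in> M"
        then obtain i \<gamma> where i: "i \<in> {1..n}" "\<gamma> \<in> nat_pow p" "\<alpha> = exp_plus (e i) \<gamma>"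
          unfolding M_def by blast
        have l: "lead (mon p \<gamma> \<otimes>\<^sub>U v i) \<alpha>"
          unfolding i(3) exp_plus_comm[of "e i"] by (rule lead_mult[OF lead_mon[OF i(2)] lead_v[OF i(1)]])
        have "mon p \<gamma> \<otimes>\<^sub>U v i \<in> genideal E.U (E.inc ` K)"
          by (rule ideal.I_l_closed[OF I v_in[OF i(1)] mon_closed[OF order_refl]])
        then show "\<alpha> \<in> {exponent E.U \<tau> p r f |f. f \<in> genideal E.U (E.inc ` K) \<and> f \<noteq> \<zero>\<^sub>U}"
          using lead_exponent[OF l, symmetric] lead_nonzero[OF l] by (intro CollectI exI conjI)
      qed
    qed
    ultimately show "{exponent E.U \<tau> p r f |f. f \<in> genideal E.U (E.inc ` K) \<and> f \<noteq> \<zero>\<^sub>U} =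
        (\<Union>w\<in>E.inc ` u ` {1..n}. exp_plus (exponent E.U \<tau> p r w) ` nat_pow p)"
      by simp
  qed
qed

end
theorem theorem4p5:
  fixes \<epsilon> :: "'g::ab_group_add \<Rightarrow> 'g \<Rightarrow> 'k::field"
    and X :: "('k, 'v, 'g) color_alg"
    and x t :: "nat \<Rightarrow> 'v"
    and m p :: nat
    and r :: "(nat \<Rightarrow> nat) rel"
    and K :: "'v set"
    and U :: "('k, ('v list \<Rightarrow> 'k) set set) module"
    and inc :: "'v \<Rightarrow> ('v list \<Rightarrow> 'k) set set"
    and I :: "('v list \<Rightarrow> 'k) set set set"
  assumes char: "CHAR('k) \<noteq> 2"
    and generic: "generic_lie_color_algebra \<epsilon> X"
    and U: "U = env_alg \<epsilon> X"
    and inc: "inc = env_incl \<epsilon> X"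
    and basis: "homogeneous_basis X (minus_part \<epsilon> X) m x"
    and p: "p = m * (m + 1) div 2"
    and t_diag: "\<And>j. \<lbrakk>1 \<le> j; j \<le> m\<rbrakk> \<Longrightarrow> t (pair_index j j) = x j"
    and t_off_diag: "\<And>i j. \<lbrakk>1 \<le> i; i < j; j \<le> m\<rbrakk> \<Longrightarrow> t (pair_index i j) = bracket X (x i) (x j)"
    and admissible: "admissible_ordering U (inc \<circ> t) p r"
    and t_increasing: "\<And>i j. \<lbrakk>1 \<le> i; i < j; j \<le> p\<rbrakk> \<Longrightarrow>
      prec r (exponent U (inc \<circ> t) p r (inc (t i))) (exponent U (inc \<circ> t) p r (inc (t j)))"
    and K: "graded_subspace X K" "K \<subseteq> plus_part \<epsilon> X"
    and I: "I = genideal U (inc ` K)"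
  shows "I = ideal_prod U (carrier U) (inc ` K) \<and>
    (\<exists>\<phi>. \<phi> \<in> ring_iso (env_alg \<epsilon> (color_quot X K)) (alg_quot U I) \<and>
         \<phi> \<in> LinearCombinations.module_hom class_ring (env_alg \<epsilon> (color_quot X K)) (alg_quot U I)) \<and>
    (\<forall>n u. homogeneous_basis X K n u \<and>
       (\<forall>i j. 1 \<le> i \<and> i < j \<and> j \<le> n \<longrightarrow>
          prec r (exponent U (inc \<circ> t) p r (inc (u i))) (exponent U (inc \<circ> t) p r (inc (u j)))) \<and>
       (\<forall>i j. 1 \<le> i \<and> i < j \<and> j \<le> n \<longrightarrow>
          exponent U (inc \<circ> t) p r (inc (u i)) \<notin> newton_diagram U (inc \<circ> t) p (inc (u j))) \<longrightarrow>
       groebner_basis U (inc \<circ> t) p r I (inc ` u ` {1..n}))"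
proof -
  interpret generic_lie_color_algebra \<epsilon> X by (rule generic)
  interpret generic_basis \<epsilon> X x m by unfold_locales (rule char, rule basis)
  interpret generic_gens \<epsilon> X x m t p by unfold_locales (rule p, fact t_diag, fact t_off_diag)
  have \<tau>: "env_incl \<epsilon> X \<circ> t = \<tau>" by (simp add: \<tau>_def)
  interpret adm_gens \<epsilon> X x m t p r
    by unfold_locales (use admissible in \<open>simp add: U inc \<tau>\<close>)
  interpret groebner_setup \<epsilon> X x m t p r K by unfold_locales (fact K)+
  show ?thesis
    unfolding I U inc \<tau> by (intro conjI I_eq_P env_alg_quotient_iso allI impI groebner) auto
qed

end
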